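(* Let $(A,\mu)$ be a Lie algebroid. Let $N$ be a vector bundle endomorphism of $A$, and let $\pi$ be a bivector on $A$ such that $N\pi=\pi\,{}^tN$. If $(\pi,N)$ is a PN-structure on $A$, then the skew-symmetric endomorphism of $A\oplus A^*$, $\mathcal N=\begin{pmatrix}N&\pi\\0&-{}^tN\end{pmatrix}$, is a weak deforming tensor for $(A\oplus A^*,\mu)$.
   Context: Let $A$ be a (smooth, real, finite rank) vector bundle over a manifold $M$, and equip $E=A\oplus A^*$ with the canonical symmetric bilinear form $\langle X+\xi,Y+\eta\rangle=\xi(Y)+\eta(X)$. $\mathcal A=\bigoplus_k\mathcal A^k$ is the graded algebra of functions on the graded manifold $T^*[2]A[1]$, with its canonical Poisson bracket $\{\cdot,\cdot\}$ of degree $-2$ (the big bracket), with $\{a,b\}=-(-1)^{|a||b|}\{b,a\}$ and the graded Leibniz and Jacobi identities. For a local basis $(e_\alpha)$ of $\Gamma A$ with dual basis $(\epsilon^\alpha)$, local coordinates are $(x^i,\tau^\alpha,p_i,\theta_\alpha)$ of degrees $0,1,2,1$, with non-vanishing brackets $\{x^i,p_j\}=\delta^i_j$, $\{\tau^\alpha,\theta_\beta\}=\delta^\alpha_\beta$. $\mathcal A^0=C^\infty(M)$; $\mathcal A^1=\Gamma(A\oplus A^* )$, with $X=X^\alpha e_\alpha$ identified with $X^\alpha\theta_\alpha$ and $\xi=\xi_\alpha\epsilon^\alpha$ with $\xi_\alpha\tau^\alpha$; $\{u,v\}=\langle u,v\rangle$ for sections of $E$. A Lie algebroid structure on $A$ is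 given by $\mu\in\mathcal A^3$, locally a combination with coefficients in $C^\infty(M)$ of terms $\tau^\alpha p_i$ and $\tau^\alpha\tau^\beta\theta_\gamma$, with $\{\mu,\mu\}=0$: anchor $\rho(X)f=\{\{X,\mu\},f\}$, bracket $[X,Y]^\mu=\{\{X,\mu\},Y\}$. Then $\Theta=\mu$ is a Courant algebroid structure on $A\oplus A^*$ (the double of the trivial Lie bialgebroid $((A,\mu),(A^*,0))$), with Dorfman bracket $\{\{u,\mu\},v\}$. For a skew-symmetric endomorphism $\mathcal N$ of $E$ ($\langle\mathcal Nu,v\rangle+\langle u,\mathcal Nv\rangle=0$), $\widetilde{\mathcal N}\in\mathcal A^2$ is the unique element with $\mathcal N(u)=\{u,\widetilde{\mathcal N}\}$ for all $u\in\Gamma E$. $\mathcal N$ is a weak deforming tensor for $(E,\Theta)$ if $\{\Theta,\{\{\widetilde{\mathcal N},\Theta\},\widetilde{\mathcal N}\}\}=0$. A bivector $\pi$ on $A$ is viewed as a skew-symmetric bundle map $\pi:A^*\to A$. Endomorphisms $N$ of $A$ and bivectors $\pi$ are identified with the elements $\widetilde{\mathcal N}$ of $\mathcal A^2$ attached to $\begin{pmatrix}N&0\\0&-{}^tN\end{pmatrix}$ and $\begin{pmatrix}0&\pi\\0&0\end{pmatrix}$. The Schouten–Nijenhuis bracket is $[\pi,\pi]^\mu=\{\{\pi,\mu\},\pi\}$. $(\pi,N)$ is a PN-structure (Poisson–Nijenhuis structure) on $(A,\mu)$ if: $\pi$ is a Poisson bivector, $[\pi,\pi]^\mu=0$; $N$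 is a Nijenhuis tensor, i.e. $[NX,NY]^\mu-N([NX,Y]^\mu+[X,NY]^\mu-N[X,Y]^\mu)=0$ for all sections $X,Y$; and $\pi$ and $N$ are compatible, i.e. $N\pi=\pi\,{}^tN$ and $C_\mu(\pi,N)=\{\pi,\{N,\mu\}\}+\{N,\{\pi,\mu\}\}=0$. *)

theory Defs
  imports "HOL-Analysis.Analysis" "HOL-Library.Multiset"
begin

section \<open>Smooth functions on open subsets of \<open>\<real>\<^sup>n\<close>\<close>

text \<open>\<open>\<real>\<^sup>n\<close> is the set of real sequences vanishing from index \<open>n\<close> on (with the product topology),
  so that every \<open>n \<ge> 0\<close> is allowed; manifolds of dimension 0 (Lie algebras) are included.\<close>

definition Rn :: "nat \<Rightarrow> (nat \<Rightarrow> real) set" where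
  "Rn n = {y. \<forall>i\<ge>n. y i = 0}"

definition pderiv_at :: "nat \<Rightarrow> ((nat \<Rightarrow> real) \<Rightarrow> real) \<Rightarrow> (nat \<Rightarrow> real) \<Rightarrow> real" where
  "pderiv_at i f y = deriv (\<lambda>t. f (y(i := t))) (y i)"

fun Ck_on :: "nat \<Rightarrow> nat \<Rightarrow> (nat \<Rightarrow> real) set \<Rightarrow> ((nat \<Rightarrow> real) \<Rightarrow> real) \<Rightarrow> bool" where
  "Ck_on n 0 V f = continuous_on V f"
| "Ck_on n (Suc k) V f =
    (continuous_on V f \<and>
     (\<forall>i<n. (\<forall>y\<in>V. (\<lambda>t. f (y(i := t))) field_differentiable (at (y i))) \<and>
            Ck_on n k V (pderiv_at i f)))"

definition smooth_Rn :: "nat \<Rightarrow> (nat \<Rightarrow> real) set \<Rightarrow> ((nat \<Rightarrow> real) \<Rightarrow> real) \<Rightarrow> bool" where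
  "smooth_Rn n V f \<longleftrightarrow> (\<forall>k. Ck_on n k V f)"


section \<open>Smooth manifolds and vector bundles\<close>

type_synonym 'm chart = "'m set \<times> ('m \<Rightarrow> nat \<Rightarrow> real)"
type_synonym ('m, 'v) frame = "'m set \<times> (nat \<Rightarrow> 'm \<Rightarrow> 'v)"

text \<open>The base manifold is the whole type \<open>'m\<close>.  The fibre over \<open>x\<close> is a linear subspace of an
  ambient real vector space \<open>'v\<close> that carries no further structure (any family of vector spaces
  embeds into its direct sum).  The smooth structure of the bundle is given by local frames,
  i.e. by local trivialisations.\<close>

record ('m, 'v) vbundle =
  base_dim :: nat
  charts :: "'m chart set"
  bundle_rank :: nat
  fibre :: "'m \<Rightarrow> 'v set"
  frames :: "('m, 'v) frame set"

definition smooth_atlas :: "nat \<Rightarrow> ('m::topological_space) chart set \<Rightarrow> bool" where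
  "smooth_atlas n C \<longleftrightarrow>
     \<Union> (fst ` C) = UNIV \<and>
     (\<forall>(U, \<phi>)\<in>C. open U \<and> openin (top_of_set (Rn n)) (\<phi> ` U) \<and>
        (\<exists>\<psi>. homeomorphism U (\<phi> ` U) \<phi> \<psi>)) \<and>
     (\<forall>(U, \<phi>)\<in>C. \<forall>(U', \<phi>')\<in>C. \<forall>i<n.
        smooth_Rn n (\<phi> ` (U \<inter> U')) (\<lambda>y. \<phi>' (inv_into U \<phi> y) i))"

definition smooth_on_base :: "('m, 'v) vbundle \<Rightarrow> 'm set \<Rightarrow> ('m \<Rightarrow> real) \<Rightarrow> bool" where
  "smooth_on_base A W f \<longleftrightarrow>
     (\<forall>(U, \<phi>)\<in>charts A. smooth_Rn (base_dim A) (\<phi> ` (U \<inter> W)) (f \<circ> inv_into U \<phi>))"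

text \<open>The coframe \<open>\<epsilon>\<^sup>\<alpha>\<close> dual to a frame \<open>e\<close>; \<open>representation\<close> is 0 outside the span of the
  frame, so \<open>\<epsilon>\<^sup>\<alpha> x\<close> is 0 outside the fibre, as required by \<open>dual_fibre\<close> below.\<close>

definition coframe :: "('m, 'v::real_vector) vbundle \<Rightarrow> (nat \<Rightarrow> 'm \<Rightarrow> 'v) \<Rightarrow> nat \<Rightarrow> 'm \<Rightarrow> 'v \<Rightarrow> real" where
  "coframe A e \<alpha> x v = representation ((\<lambda>\<beta>. e \<beta> x) ` {..<bundle_rank A}) v (e \<alpha> x)"

definition vector_bundle ::
  "('m::{t2_space, second_countable_topology}, 'v::real_vector) vbundle \<Rightarrow> bool" where
  "vector_bundle A \<longleftrightarrow>
     smooth_atlas (base_dim A) (charts A) \<and>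
     \<Union> (fst ` frames A) = UNIV \<and>
     (\<forall>x. subspace (fibre A x)) \<and>
     (\<forall>(V, e)\<in>frames A. open V \<and>
        (\<forall>x\<in>V. inj_on (\<lambda>\<alpha>. e \<alpha> x) {..<bundle_rank A} \<and>
               independent ((\<lambda>\<alpha>. e \<alpha> x) ` {..<bundle_rank A}) \<and>
               span ((\<lambda>\<alpha>. e \<alpha> x) ` {..<bundle_rank A}) = fibre A x)) \<and>
     (\<forall>(V, e)\<in>frames A. \<forall>(V', e')\<in>frames A. \<forall>\<alpha><bundle_rank A. \<forall>\<beta><bundle_rank A.
        smooth_on_base A (V \<inter> V') (\<lambda>x. coframe A e' \<alpha> x (e \<beta> x)))"

text \<open>Covectors at \<open>x\<close> are extended by 0 outside the fibre, which makes their representation unique.\<close>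

definition dual_fibre :: "('m, 'v::real_vector) vbundle \<Rightarrow> 'm \<Rightarrow> ('v \<Rightarrow> real) set" where
  "dual_fibre A x = {\<xi>.
     (\<forall>v\<in>fibre A x. \<forall>w\<in>fibre A x. \<xi> (v + w) = \<xi> v + \<xi> w) \<and>
     (\<forall>s. \<forall>v\<in>fibre A x. \<xi> (s *\<^sub>R v) = s * \<xi> v) \<and>
     (\<forall>v. v \<notin> fibre A x \<longrightarrow> \<xi> v = 0)}"

definition sections :: "('m, 'v::real_vector) vbundle \<Rightarrow> ('m \<Rightarrow> 'v) set" where
  "sections A = {X. (\<forall>x. X x \<in> fibre A x) \<and>
     (\<forall>(V, e)\<in>frames A. \<forall>\<alpha><bundle_rank A. smooth_on_base A V (\<lambda>x. coframe A e \<alpha> x (X x)))}"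


section \<open>The bundle \<open>E = A \<oplus> A\<^sup>*\<close>\<close>

type_synonym 'v gvec = "'v \<times> ('v \<Rightarrow> real)"

definition E_fibre :: "('m, 'v::real_vector) vbundle \<Rightarrow> 'm \<Rightarrow> 'v gvec set" where
  "E_fibre A x = fibre A x \<times> dual_fibre A x"

definition E_add :: "'v::real_vector gvec \<Rightarrow> 'v gvec \<Rightarrow> 'v gvec" where
  "E_add u v = (fst u + fst v, \<lambda>w. snd u w + snd v w)"

definition E_scale :: "real \<Rightarrow> 'v::real_vector gvec \<Rightarrow> 'v gvec" where
  "E_scale s u = (s *\<^sub>R fst u, \<lambda>w. s * snd u w)"

definition E_pair :: "'v gvec \<Rightarrow> 'v gvec \<Rightarrow> real" where
  "E_pair u v = snd u (fst v) + snd v (fst u)"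

definition E_sections :: "('m, 'v::real_vector) vbundle \<Rightarrow> ('m \<Rightarrow> 'v gvec) set" where
  "E_sections A = {u. (\<forall>x. u x \<in> E_fibre A x) \<and>
     (\<forall>(V, e)\<in>frames A. \<forall>\<alpha><bundle_rank A.
        smooth_on_base A V (\<lambda>x. coframe A e \<alpha> x (fst (u x))) \<and>
        smooth_on_base A V (\<lambda>x. snd (u x) (e \<alpha> x)))}"

text \<open>The local frame \<open>(e\<^sub>0, \<dots>, \<epsilon>\<^sup>0, \<dots>)\<close> of \<open>E\<close> induced by a frame of \<open>A\<close>.\<close>

definition E_frame ::
  "('m, 'v::real_vector) vbundle \<Rightarrow> (nat \<Rightarrow> 'm \<Rightarrow> 'v) \<Rightarrow> nat \<Rightarrow> 'm \<Rightarrow> 'v gvec" where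
  "E_frame A e a x =
     (if a < bundle_rank A then (e a x, \<lambda>_. 0) else (0, coframe A e (a - bundle_rank A) x))"

definition skew_endomorphism ::
  "('m, 'v::real_vector) vbundle \<Rightarrow> ('m \<Rightarrow> 'v gvec \<Rightarrow> 'v gvec) \<Rightarrow> bool" where
  "skew_endomorphism A NN \<longleftrightarrow>
     (\<forall>x. \<forall>u\<in>E_fibre A x. NN x u \<in> E_fibre A x) \<and>
     (\<forall>x. \<forall>u\<in>E_fibre A x. \<forall>v\<in>E_fibre A x. NN x (E_add u v) = E_add (NN x u) (NN x v)) \<and>
     (\<forall>x s. \<forall>u\<in>E_fibre A x. NN x (E_scale s u) = E_scale s (NN x u)) \<and>
     (\<forall>(V, e)\<in>frames A. \<forall>a<2 * bundle_rank A. \<forall>b<2 * bundle_rank A.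
        smooth_on_base A V (\<lambda>x. E_pair (NN x (E_frame A e a x)) (E_frame A e b x))) \<and>
     (\<forall>x. \<forall>u\<in>E_fibre A x. \<forall>v\<in>E_fibre A x. E_pair (NN x u) v + E_pair u (NN x v) = 0)"

definition endomorphism :: "('m, 'v::real_vector) vbundle \<Rightarrow> ('m \<Rightarrow> 'v \<Rightarrow> 'v) \<Rightarrow> bool" where
  "endomorphism A N \<longleftrightarrow>
     (\<forall>x. \<forall>v\<in>fibre A x. N x v \<in> fibre A x) \<and>
     (\<forall>x. \<forall>v\<in>fibre A x. \<forall>w\<in>fibre A x. N x (v + w) = N x v + N x w) \<and>
     (\<forall>x s. \<forall>v\<in>fibre A x. N x (s *\<^sub>R v) = s *\<^sub>R N x v) \<and>
     (\<forall>(V, e)\<in>frames A. \<forall>\<alpha><bundle_rank A. \<forall>\<beta><bundle_rank A.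
        smooth_on_base A V (\<lambda>x. coframe A e \<alpha> x (N x (e \<beta> x))))"

definition bivector :: "('m, 'v::real_vector) vbundle \<Rightarrow> ('m \<Rightarrow> ('v \<Rightarrow> real) \<Rightarrow> 'v) \<Rightarrow> bool" where
  "bivector A \<pi> \<longleftrightarrow>
     (\<forall>x. \<forall>\<xi>\<in>dual_fibre A x. \<pi> x \<xi> \<in> fibre A x) \<and>
     (\<forall>x. \<forall>\<xi>\<in>dual_fibre A x. \<forall>\<eta>\<in>dual_fibre A x. \<pi> x (\<lambda>w. \<xi> w + \<eta> w) = \<pi> x \<xi> + \<pi> x \<eta>) \<and>
     (\<forall>x s. \<forall>\<xi>\<in>dual_fibre A x. \<pi> x (\<lambda>w. s * \<xi> w) = s *\<^sub>R \<pi> x \<xi>) \<and>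
     (\<forall>(V, e)\<in>frames A. \<forall>\<alpha><bundle_rank A. \<forall>\<beta><bundle_rank A.
        smooth_on_base A V (\<lambda>x. coframe A e \<alpha> x (\<pi> x (coframe A e \<beta> x)))) \<and>
     (\<forall>x. \<forall>\<xi>\<in>dual_fibre A x. \<forall>\<eta>\<in>dual_fibre A x. \<xi> (\<pi> x \<eta>) + \<eta> (\<pi> x \<xi>) = 0)"

definition transp ::
  "('m, 'v) vbundle \<Rightarrow> ('m \<Rightarrow> 'v \<Rightarrow> 'v) \<Rightarrow> 'm \<Rightarrow> ('v \<Rightarrow> real) \<Rightarrow> 'v \<Rightarrow> real" where
  "transp A N x \<xi> w = (if w \<in> fibre A x then \<xi> (N x w) else 0)"

text \<open>The endomorphism of \<open>E\<close> with block matrix having rows \<open>(N, \<pi>)\<close> and \<open>(0, - \<^sup>tN)\<close>.\<close>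

definition block_endo ::
  "('m, 'v::real_vector) vbundle \<Rightarrow> ('m \<Rightarrow> 'v \<Rightarrow> 'v) \<Rightarrow> ('m \<Rightarrow> ('v \<Rightarrow> real) \<Rightarrow> 'v)
     \<Rightarrow> 'm \<Rightarrow> 'v gvec \<Rightarrow> 'v gvec" where
  "block_endo A N \<pi> x u = (N x (fst u) + \<pi> x (snd u), \<lambda>w. - transp A N x (snd u) w)"


section \<open>Polynomials in the graded fibre coordinates\<close>

text \<open>A function \<open>a :: mono \<Rightarrow> real\<close> stands for \<open>\<Sum> a (S, K) \<zeta>\<^sup>S p\<^sub>K\<close> where \<open>\<zeta>\<^sup>S\<close> is the product of the
  odd generators \<open>\<zeta>\<^sub>s\<close>, \<open>s \<in> S\<close>, in increasing order, and \<open>p\<^sub>K\<close> the product of the \<open>p\<^sub>i\<close>, \<open>i \<in># K\<close>.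
  For a bundle of rank \<open>r\<close>, \<open>\<zeta>\<^sub>\<alpha> = \<tau>\<^sup>\<alpha>\<close> and \<open>\<zeta>\<^bsub>r+\<alpha>\<^esub> = \<theta>\<^sub>\<alpha>\<close> for \<open>\<alpha> < r\<close>.\<close>

type_synonym mono = "nat set \<times> nat multiset"

definition mono_deg :: "mono \<Rightarrow> nat" where
  "mono_deg m = card (fst m) + 2 * size (snd m)"

definition single :: "mono \<Rightarrow> mono \<Rightarrow> real" where
  "single m m' = (if m' = m then 1 else 0)"

definition gsign :: "nat set \<Rightarrow> nat set \<Rightarrow> real" where
  "gsign S T = (- 1) ^ card {(s, t). s \<in> S \<and> t \<in> T \<and> t < s}"

definition gmult :: "(mono \<Rightarrow> real) \<Rightarrow> (mono \<Rightarrow> real) \<Rightarrow> mono \<Rightarrow> real" where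
  "gmult a b = (\<lambda>(S, K). \<Sum>S1\<in>Pow S. \<Sum>K1\<in>{K1. K1 \<subseteq># K}.
     gsign S1 (S - S1) * a (S1, K1) * b (S - S1, K - K1))"

definition dp :: "nat \<Rightarrow> (mono \<Rightarrow> real) \<Rightarrow> mono \<Rightarrow> real" where
  "dp i a = (\<lambda>(S, K). real (count K i + 1) * a (S, add_mset i K))"

text \<open>Left and right derivatives with respect to the odd generator \<open>\<zeta>\<^sub>s\<close>.\<close>

definition dleft :: "nat \<Rightarrow> (mono \<Rightarrow> real) \<Rightarrow> mono \<Rightarrow> real" where
  "dleft s a = (\<lambda>(S, K). if s \<in> S then 0 else (- 1) ^ card {t \<in> S. t < s} * a (insert s S, K))"

definition dright :: "nat \<Rightarrow> (mono \<Rightarrow> real) \<Rightarrow> mono \<Rightarrow> real" where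
  "dright s a = (\<lambda>(S, K). if s \<in> S then 0 else (- 1) ^ card {t \<in> S. s < t} * a (insert s S, K))"


section \<open>Functions on \<open>T\<^sup>*[2]A[1]\<close> and the big bracket\<close>

text \<open>A chart of \<open>M\<close> and a frame of \<open>A\<close> give coordinates \<open>(x\<^sup>i, \<tau>\<^sup>\<alpha>, p\<^sub>i, \<theta>\<^sub>\<alpha>)\<close> over the
  intersection of their domains.  A function on the graded manifold is the family of its
  coordinate expressions; coefficients are 0 outside the domain, so that equality of functions is
  equality in HOL.\<close>

type_synonym ('m, 'v) coords = "'m chart \<times> ('m, 'v) frame"
type_synonym ('m, 'v) gfun = "('m, 'v) coords \<Rightarrow> mono \<Rightarrow> 'm \<Rightarrow> real"

definition coord_systems :: "('m, 'v) vbundle \<Rightarrow> ('m, 'v) coords set" where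
  "coord_systems A = charts A \<times> frames A"

definition coord_dom :: "('m, 'v) coords \<Rightarrow> 'm set" where
  "coord_dom c = fst (fst c) \<inter> fst (snd c)"

definition coord_frame :: "('m, 'v) coords \<Rightarrow> nat \<Rightarrow> 'm \<Rightarrow> 'v" where
  "coord_frame c = snd (snd c)"

definition dx :: "('m, 'v) coords \<Rightarrow> nat \<Rightarrow> ('m \<Rightarrow> real) \<Rightarrow> 'm \<Rightarrow> real" where
  "dx c i f x = (case fst c of (U, \<phi>) \<Rightarrow> pderiv_at i (f \<circ> inv_into U \<phi>) (\<phi> x))"

text \<open>Change of coordinates from \<open>c\<close> to \<open>c'\<close> at \<open>x\<close>: the generators belonging to \<open>c'\<close>
  expressed through those belonging to \<open>c\<close>,
  \<open>\<tau>'\<^sup>\<alpha> = \<epsilon>'\<^sup>\<alpha>(e\<^sub>\<beta>) \<tau>\<^sup>\<beta>\<close>, \<open>\<theta>'\<^sub>\<alpha> = \<epsilon>\<^sup>\<beta>(e'\<^sub>\<alpha>) \<theta>\<^sub>\<beta>\<close>, and by cotangent lift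
  \<open>p'\<^sub>i = (\<partial>x\<^sup>j/\<partial>x'\<^sup>i) p\<^sub>j + \<theta>\<^sub>\<beta> (\<partial>\<tau>\<^sup>\<beta>/\<partial>x'\<^sup>i)\<close> where \<open>\<tau>\<^sup>\<beta> = \<epsilon>\<^sup>\<beta>(e'\<^sub>\<alpha>) \<tau>'\<^sup>\<alpha>\<close>.\<close>

definition odd_image ::
  "('m, 'v::real_vector) vbundle \<Rightarrow> ('m, 'v) coords \<Rightarrow> ('m, 'v) coords \<Rightarrow> 'm \<Rightarrow> nat \<Rightarrow> mono \<Rightarrow> real" where
  "odd_image A c c' x s m =
     (let r = bundle_rank A; e = coord_frame c; e' = coord_frame c' in
      if s < r
      then (\<Sum>\<beta><r. coframe A e' s x (e \<beta> x) * single ({\<beta>}, {#}) m)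
      else (\<Sum>\<beta><r. coframe A e \<beta> x (e' (s - r) x) * single ({r + \<beta>}, {#}) m))"

definition even_image ::
  "('m, 'v::real_vector) vbundle \<Rightarrow> ('m, 'v) coords \<Rightarrow> ('m, 'v) coords \<Rightarrow> 'm \<Rightarrow> nat \<Rightarrow> mono \<Rightarrow> real" where
  "even_image A c c' x i m =
     (let r = bundle_rank A; e = coord_frame c; e' = coord_frame c' in
      (\<Sum>j<base_dim A. dx c' i (\<lambda>y. snd (fst c) y j) x * single ({}, {#j#}) m) +
      (\<Sum>\<alpha><r. \<Sum>\<beta><r. \<Sum>\<gamma><r.
         dx c' i (\<lambda>y. coframe A e \<beta> y (e' \<alpha> y)) x * coframe A e' \<alpha> x (e \<gamma> x) *
         gmult (single ({r + \<beta>}, {#})) (single ({\<gamma>}, {#})) m))"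

definition mono_image ::
  "('m, 'v::real_vector) vbundle \<Rightarrow> ('m, 'v) coords \<Rightarrow> ('m, 'v) coords \<Rightarrow> 'm \<Rightarrow> mono \<Rightarrow> mono \<Rightarrow> real" where
  "mono_image A c c' x = (\<lambda>(S, K).
     foldr gmult (map (odd_image A c c' x) (sorted_list_of_set S) @
                  map (even_image A c c' x) (sorted_list_of_multiset K))
       (single ({}, {#})))"

text \<open>\<open>gfun_deg A k\<close> is the homogeneous component \<open>\<A>\<^sup>k\<close>.\<close>

definition gfun_deg :: "('m, 'v::real_vector) vbundle \<Rightarrow> nat \<Rightarrow> ('m, 'v) gfun set" where
  "gfun_deg A k = {a.
     (\<forall>c S K x. a c (S, K) x \<noteq> 0 \<longrightarrow>
        c \<in> coord_systems A \<and> x \<in> coord_dom c \<and>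
        S \<subseteq> {..<2 * bundle_rank A} \<and> set_mset K \<subseteq> {..<base_dim A} \<and> mono_deg (S, K) = k) \<and>
     (\<forall>c\<in>coord_systems A. \<forall>m. smooth_on_base A (coord_dom c) (a c m)) \<and>
     (\<forall>c\<in>coord_systems A. \<forall>c'\<in>coord_systems A. \<forall>x\<in>coord_dom c \<inter> coord_dom c'. \<forall>m.
        a c m x = (\<Sum>m'\<in>{m'. a c' m' x \<noteq> 0}. a c' m' x * mono_image A c c' x m' m))}"

definition gzero :: "('m, 'v) gfun" where
  "gzero = (\<lambda>c m x. 0)"

definition gadd :: "('m, 'v) gfun \<Rightarrow> ('m, 'v) gfun \<Rightarrow> ('m, 'v) gfun" where
  "gadd a b = (\<lambda>c m x. a c m x + b c m x)"

text \<open>The canonical bracket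
  \<open>{a,b} = \<partial>a/\<partial>x\<^sup>i \<partial>b/\<partial>p\<^sub>i - \<partial>a/\<partial>p\<^sub>i \<partial>b/\<partial>x\<^sup>i + (a \<partial>/\<partial>\<tau>\<^sup>\<alpha>) (\<partial>/\<partial>\<theta>\<^sub>\<alpha> b) + (a \<partial>/\<partial>\<theta>\<^sub>\<alpha>) (\<partial>/\<partial>\<tau>\<^sup>\<alpha> b)\<close>
  with right derivatives of \<open>a\<close> and left derivatives of \<open>b\<close>: the bracket with
  \<open>{x\<^sup>i, p\<^sub>j} = \<delta>\<^sup>i\<^sub>j\<close>, \<open>{\<tau>\<^sup>\<alpha>, \<theta>\<^sub>\<beta>} = \<delta>\<^sup>\<alpha>\<^sub>\<beta>\<close>, \<open>{a,b} = -(-1)\<^bsup>|a||b|\<^esup> {b,a}\<close> and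
  \<open>{a,bc} = {a,b}c + (-1)\<^bsup>|a||b|\<^esup> b{a,c}\<close>.\<close>

definition big_bracket ::
  "('m, 'v) vbundle \<Rightarrow> ('m, 'v) gfun \<Rightarrow> ('m, 'v) gfun \<Rightarrow> ('m, 'v) gfun" where
  "big_bracket A a b = (\<lambda>c m x.
     if c \<in> coord_systems A \<and> x \<in> coord_dom c then
       (let r = bundle_rank A; at_x = (\<lambda>f m'. f c m' x); dx_x = (\<lambda>i f m'. dx c i (f c m') x) in
        (\<Sum>i<base_dim A.
           gmult (dx_x i a) (dp i (at_x b)) m - gmult (dp i (at_x a)) (dx_x i b) m) +
        (\<Sum>\<alpha><r.
           gmult (dright \<alpha> (at_x a)) (dleft (r + \<alpha>) (at_x b)) m +
           gmult (dright (r + \<alpha>) (at_x a)) (dleft \<alpha> (at_x b)) m))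
     else 0)"

text \<open>The identification \<open>\<Gamma>(A \<oplus> A\<^sup>*) = \<A>\<^sup>1\<close>, \<open>X + \<xi> \<mapsto> X\<^sup>\<alpha> \<theta>\<^sub>\<alpha> + \<xi>\<^sub>\<alpha> \<tau>\<^sup>\<alpha>\<close>.\<close>

definition of_section ::
  "('m, 'v::real_vector) vbundle \<Rightarrow> ('m \<Rightarrow> 'v gvec) \<Rightarrow> ('m, 'v) gfun" where
  "of_section A u = (\<lambda>c m x.
     if c \<in> coord_systems A \<and> x \<in> coord_dom c then
       (\<Sum>\<alpha><bundle_rank A.
          coframe A (coord_frame c) \<alpha> x (fst (u x)) * single ({bundle_rank A + \<alpha>}, {#}) m +
          snd (u x) (coord_frame c \<alpha> x) * single ({\<alpha>}, {#}) m)
     else 0)"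

definition of_A_section :: "('m, 'v::real_vector) vbundle \<Rightarrow> ('m \<Rightarrow> 'v) \<Rightarrow> ('m, 'v) gfun" where
  "of_A_section A X = of_section A (\<lambda>x. (X x, \<lambda>_. 0))"

definition tilde ::
  "('m, 'v::real_vector) vbundle \<Rightarrow> ('m \<Rightarrow> 'v gvec \<Rightarrow> 'v gvec) \<Rightarrow> ('m, 'v) gfun" where
  "tilde A NN = (THE a. a \<in> gfun_deg A 2 \<and>
     (\<forall>u\<in>E_sections A. of_section A (\<lambda>x. NN x (u x)) = big_bracket A (of_section A u) a))"

definition endo_gfun :: "('m, 'v::real_vector) vbundle \<Rightarrow> ('m \<Rightarrow> 'v \<Rightarrow> 'v) \<Rightarrow> ('m, 'v) gfun" where
  "endo_gfun A N = tilde A (block_endo A N (\<lambda>x \<xi>. 0))"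

definition bivector_gfun ::
  "('m, 'v::real_vector) vbundle \<Rightarrow> ('m \<Rightarrow> ('v \<Rightarrow> real) \<Rightarrow> 'v) \<Rightarrow> ('m, 'v) gfun" where
  "bivector_gfun A \<pi> = tilde A (block_endo A (\<lambda>x v. 0) \<pi>)"


section \<open>Lie algebroids, PN-structures and weak deforming tensors\<close>

definition lie_algebroid :: "('m, 'v::real_vector) vbundle \<Rightarrow> ('m, 'v) gfun \<Rightarrow> bool" where
  "lie_algebroid A \<mu> \<longleftrightarrow>
     \<mu> \<in> gfun_deg A 3 \<and>
     (\<forall>c m x. \<mu> c m x \<noteq> 0 \<longrightarrow>
        (\<exists>\<alpha><bundle_rank A. \<exists>i<base_dim A. m = ({\<alpha>}, {#i#})) \<or>
        (\<exists>\<alpha><bundle_rank A. \<exists>\<beta><bundle_rank A. \<exists>\<gamma><bundle_rank A.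
           \<alpha> \<noteq> \<beta> \<and> m = ({\<alpha>, \<beta>, bundle_rank A + \<gamma>}, {#}))) \<and>
     big_bracket A \<mu> \<mu> = gzero"

text \<open>The section \<open>[X,Y]\<^sup>\<mu> = {{X,\<mu>},Y}\<close> of \<open>A\<close>, as given in the coordinates \<open>c\<close>: the
  coefficients of the \<open>\<theta>\<^sub>\<alpha>\<close> are its components in the frame.\<close>

definition lie_bracket ::
  "('m, 'v::real_vector) vbundle \<Rightarrow> ('m, 'v) gfun \<Rightarrow> ('m, 'v) coords \<Rightarrow>
     ('m \<Rightarrow> 'v) \<Rightarrow> ('m \<Rightarrow> 'v) \<Rightarrow> 'm \<Rightarrow> 'v" where
  "lie_bracket A \<mu> c X Y x =
     (\<Sum>\<alpha><bundle_rank A.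
        big_bracket A (big_bracket A (of_A_section A X) \<mu>) (of_A_section A Y)
          c ({bundle_rank A + \<alpha>}, {#}) x *\<^sub>R coord_frame c \<alpha> x)"

definition nijenhuis_tensor ::
  "('m, 'v::real_vector) vbundle \<Rightarrow> ('m, 'v) gfun \<Rightarrow> ('m \<Rightarrow> 'v \<Rightarrow> 'v) \<Rightarrow> bool" where
  "nijenhuis_tensor A \<mu> N \<longleftrightarrow>
     (\<forall>X\<in>sections A. \<forall>Y\<in>sections A. \<forall>c\<in>coord_systems A. \<forall>x\<in>coord_dom c.
        let NX = (\<lambda>y. N y (X y)); NY = (\<lambda>y. N y (Y y)); br = lie_bracket A \<mu> c in
        br NX NY x - N x (br NX Y x + br X NY x - N x (br X Y x)) = 0)"

definition poisson_bivector ::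
  "('m, 'v::real_vector) vbundle \<Rightarrow> ('m, 'v) gfun \<Rightarrow> ('m \<Rightarrow> ('v \<Rightarrow> real) \<Rightarrow> 'v) \<Rightarrow> bool" where
  "poisson_bivector A \<mu> \<pi> \<longleftrightarrow>
     big_bracket A (big_bracket A (bivector_gfun A \<pi>) \<mu>) (bivector_gfun A \<pi>) = gzero"

definition C_concomitant ::
  "('m, 'v::real_vector) vbundle \<Rightarrow> ('m, 'v) gfun \<Rightarrow> ('m \<Rightarrow> ('v \<Rightarrow> real) \<Rightarrow> 'v) \<Rightarrow>
     ('m \<Rightarrow> 'v \<Rightarrow> 'v) \<Rightarrow> ('m, 'v) gfun" where
  "C_concomitant A \<mu> \<pi> N =
     gadd (big_bracket A (bivector_gfun A \<pi>) (big_bracket A (endo_gfun A N) \<mu>))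
          (big_bracket A (endo_gfun A N) (big_bracket A (bivector_gfun A \<pi>) \<mu>))"

definition intertwined ::
  "('m, 'v::real_vector) vbundle \<Rightarrow> ('m \<Rightarrow> ('v \<Rightarrow> real) \<Rightarrow> 'v) \<Rightarrow> ('m \<Rightarrow> 'v \<Rightarrow> 'v) \<Rightarrow> bool" where
  "intertwined A \<pi> N \<longleftrightarrow> (\<forall>x. \<forall>\<xi>\<in>dual_fibre A x. N x (\<pi> x \<xi>) = \<pi> x (transp A N x \<xi>))"

definition PN_structure ::
  "('m, 'v::real_vector) vbundle \<Rightarrow> ('m, 'v) gfun \<Rightarrow> ('m \<Rightarrow> ('v \<Rightarrow> real) \<Rightarrow> 'v) \<Rightarrow>
     ('m \<Rightarrow> 'v \<Rightarrow> 'v) \<Rightarrow> bool" where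
  "PN_structure A \<mu> \<pi> N \<longleftrightarrow>
     bivector A \<pi> \<and> endomorphism A N \<and>
     poisson_bivector A \<mu> \<pi> \<and> nijenhuis_tensor A \<mu> N \<and>
     intertwined A \<pi> N \<and> C_concomitant A \<mu> \<pi> N = gzero"

text \<open>Courant algebroid structures on \<open>A \<oplus> A\<^sup>*\<close> with its canonical pairing.\<close>

definition courant_structure :: "('m, 'v::real_vector) vbundle \<Rightarrow> ('m, 'v) gfun \<Rightarrow> bool" where
  "courant_structure A \<Theta> \<longleftrightarrow> \<Theta> \<in> gfun_deg A 3 \<and> big_bracket A \<Theta> \<Theta> = gzero"

definition weak_deforming_tensor ::
  "('m, 'v::real_vector) vbundle \<Rightarrow> ('m, 'v) gfun \<Rightarrow> ('m \<Rightarrow> 'v gvec \<Rightarrow> 'v gvec) \<Rightarrow> bool" where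
  "weak_deforming_tensor A \<Theta> NN \<longleftrightarrow>
     courant_structure A \<Theta> \<and> skew_endomorphism A NN \<and>
     big_bracket A \<Theta> (big_bracket A (big_bracket A (tilde A NN) \<Theta>) (tilde A NN)) = gzero"

end

theory Submission
  imports Defs "HOL-Library.Function_Algebras"
begin

text \<open>The function attached to the block endomorphism is \<open>N + \<pi>\<close>.  In \<open>{{N + \<pi>, \<mu>}, N + \<pi>}\<close> the term
  \<open>{{\<pi>, \<mu>}, \<pi>}\<close> vanishes because \<open>\<pi>\<close> is Poisson, and the mixed terms add up to \<open>- C\<^sub>\<mu>(\<pi>, N) = 0\<close>, so
  that \<open>{{N, \<mu>}, N} = - {N, {N, \<mu>}}\<close> is left.  The element \<open>{N, {N, \<mu>}} - {N\<^sup>2, \<mu>}\<close> has no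
  \<open>p\<close>-component, and its derived bracket is twice the Nijenhuis torsion, hence it is 0.  So what is left
  is \<open>- {N\<^sup>2, \<mu>}\<close>, and \<open>{\<mu>, {N\<^sup>2, \<mu>}} = 0\<close> by the Jacobi identity and \<open>{\<mu>, \<mu>} = 0\<close>.
  Only Jacobi identities whose first argument is even and free of \<open>p\<close> occur.
  Bump functions are needed because \<open>tilde\<close> is characterised by brackets with global sections and the
  Nijenhuis condition is stated for global sections.  For rank 0 \<open>tilde\<close> is a description without a
  unique witness, but then \<open>\<mu> = 0\<close> for degree reasons.\<close>

section \<open>Polynomials in odd and even variables\<close>

text \<open>All computations take place in one coordinate system at a time. Coefficients are whole
  functions on the manifold, so that a coordinate expression is a single polynomial over a ring with
  commuting derivations and the bracket is an operation on such polynomials; points return only when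
  sections are compared. Bracketing with an even element free of \<open>p\<close> never
  differentiates the coefficients of the other argument, which keeps the Jacobi identity within
  reach; N and N^2 are of this kind, \<mu> is not. The element {N^2, \<mu>} comes from deforming
  twice. Bracketing \<mu> with N replaces [X,Y] by [NX,Y] + [X,NY] - N[X,Y]. Doing this again yields
  2[NX,NY] - 2N[NX,Y] - 2N[X,NY] as in twice the torsion, but also [N^2X,Y] + [X,N^2Y] + N^2[X,Y] in
  place of 2N^2[X,Y]. Subtracting the structure deformed by N^2 corrects exactly this. The torsion
  is known on sections of A only, while an element of degree 3 acts on all of E. Counting momenta
  closes the gap: one momentum and no \<open>p\<close> leave only monomials \<tau>\<tau>\<theta>,
  and brackets of sections of A read these off.\<close>

text \<open>Coefficients are indexed as in \<open>gmult\<close>, whose sum over \<open>Pow S\<close> is 0 for infinite \<open>S\<close>; such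
  index sets are therefore excluded.\<close>

typedef (overloaded) 'b gpoly = "{a :: mono \<Rightarrow> 'b::zero. \<forall>S K. infinite S \<longrightarrow> a (S, K) = 0}"
  morphisms gcoeff Abs_gpoly
  by (rule exI[of _ "\<lambda>_. 0"]) simp

setup_lifting type_definition_gpoly

lemma gpoly_eqI: "(\<And>S K. finite S \<Longrightarrow> gcoeff a (S, K) = gcoeff b (S, K)) \<Longrightarrow> a = b"
  by transfer (metis ext surj_pair)

lemma gcoeff_infinite: "infinite S \<Longrightarrow> gcoeff a (S, K) = 0"
  by transfer blast

text \<open>The sign \<open>gsign\<close> with values in an arbitrary ring, because the coefficients
  will lie in the ring of functions on the manifold. It counts the inversions met when the
  generators of \<open>S\<close> followed by those of \<open>T\<close> are sorted.\<close>

definition sg :: "nat set \<Rightarrow> nat set \<Rightarrow> 'b::comm_ring_1" where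
  "sg S T = (- 1) ^ card {(s, t). s \<in> S \<and> t \<in> T \<and> t < s}"

lemma finite_sg: "finite S \<Longrightarrow> finite T \<Longrightarrow> finite {(s, t). s \<in> S \<and> t \<in> T \<and> t < (s::nat)}"
  by (rule finite_subset[of _ "S \<times> T"]) auto

text \<open>The inversions of a disjoint union split. Being multiplicative in each argument is the
  property of the sign on which associativity of the product rests.\<close>

lemma sg_Un_left:
  assumes "finite S" "finite S'" "finite T" "S \<inter> S' = {}"
  shows "sg (S \<union> S') T = sg S T * (sg S' T :: 'b::comm_ring_1)"
proof -
  have "{(s, t). s \<in> S \<union> S' \<and> t \<in> T \<and> t < s} =
      {(s, t). s \<in> S \<and> t \<in> T \<and> t < s} \<union> {(s, t). s \<in> S' \<and> t \<in> T \<and> t < s}"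
    by auto
  moreover have "{(s, t). s \<in> S \<and> t \<in> T \<and> t < s} \<inter> {(s, t). s \<in> S' \<and> t \<in> T \<and> t < s} = {}"
    using assms(4) by auto
  ultimately show ?thesis
    unfolding sg_def using assms finite_sg by (simp add: card_Un_disjoint power_add)
qed

lemma sg_Un_right:
  assumes "finite S" "finite T" "finite T'" "T \<inter> T' = {}"
  shows "sg S (T \<union> T') = sg S T * (sg S T' :: 'b::comm_ring_1)"
proof -
  have "{(s, t). s \<in> S \<and> t \<in> T \<union> T' \<and> t < s} =
      {(s, t). s \<in> S \<and> t \<in> T \<and> t < s} \<union> {(s, t). s \<in> S \<and> t \<in> T' \<and> t < s}"
    by auto
  moreover have "{(s, t). s \<in> S \<and> t \<in> T \<and> t < s} \<inter> {(s, t). s \<in> S \<and> t \<in> T' \<and> t < s} = {}"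
    using assms(4) by auto
  ultimately show ?thesis
    unfolding sg_def using assms finite_sg by (simp add: card_Un_disjoint power_add)
qed

lemma minus_one_power_square [simp]: "(- 1) ^ k * (- 1) ^ k = (1 :: 'b::comm_ring_1)"
  by (simp flip: power_mult_distrib)

lemma sg_square [simp]: "sg S T * sg S T = (1 :: 'b::comm_ring_1)"
  unfolding sg_def by simp

lemma sg_square_left [simp]: "sg S T * (sg S T * x) = (x :: 'b::comm_ring_1)"
  by (simp flip: mult.assoc)

text \<open>Every pair in \<open>S \<times> T\<close> is an inversion for exactly one of the two
  orders, so the two inversion counts add up to \<open>card S * card T\<close>.\<close>

lemma sg_swap:
  assumes "finite S" "finite T" "S \<inter> T = {}"
  shows "sg T S = sg S T * ((- 1) ^ (card S * card T) :: 'b::comm_ring_1)"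
proof -
  let ?A = "{(s, t). s \<in> S \<and> t \<in> T \<and> t < s}" and ?B = "{(s, t). s \<in> S \<and> t \<in> T \<and> s < t}"
  have "S \<times> T = ?A \<union> ?B" using assms(3) by force
  moreover have "finite ?A" "finite ?B" using assms
    by (auto intro: finite_subset[of _ "S \<times> T"])
  moreover have "?A \<inter> ?B = {}" by auto
  ultimately have "card (S \<times> T) = card ?A + card ?B" by (simp add: card_Un_disjoint)
  moreover have "card {(s, t). s \<in> S \<and> t \<in> T \<and> s < t} = card {(s, t). s \<in> T \<and> t \<in> S \<and> t < s}"
    by (rule bij_betw_same_card[of prod.swap]) (auto simp: bij_betw_def inj_on_def image_iff)
  ultimately show ?thesis
    unfolding sg_def using assms by (simp add: card_cartesian_product power_add flip: mult.assoc)
qed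

text \<open>The index set of the product, as ordered pairs of complementary monomials. In contrast
  to the nested sum of \<open>gmult\<close> it is symmetric in the two factors and easy to
  reindex.\<close>

definition splits :: "mono \<Rightarrow> (mono \<times> mono) set" where
  "splits m = {(m1, m2). fst m1 \<inter> fst m2 = {} \<and> fst m1 \<union> fst m2 = fst m \<and> snd m1 + snd m2 = snd m}"

lemma splits_iff: "((S1, K1), (S2, K2)) \<in> splits (S, K) \<longleftrightarrow> S1 \<inter> S2 = {} \<and> S1 \<union> S2 = S \<and> K1 + K2 = K"
  by (simp add: splits_def)

lemma finite_sub_msets: "finite {K1. K1 \<subseteq># (K::'a multiset)}"
proof (induction K)
  case (add x K)
  have "{K1. K1 \<subseteq># add_mset x K} \<subseteq> {K1. K1 \<subseteq># K} \<union> add_mset x ` {K1. K1 \<subseteq># K}"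
  proof
    fix K1 assume "K1 \<in> {K1. K1 \<subseteq># add_mset x K}"
    then have le: "K1 \<subseteq># add_mset x K" by simp
    show "K1 \<in> {K1. K1 \<subseteq># K} \<union> add_mset x ` {K1. K1 \<subseteq># K}"
    proof (cases "x \<in># K1")
      case True
      then obtain K2 where "K1 = add_mset x K2" by (metis insert_DiffM)
      with le show ?thesis by auto
    next
      case False
      with le have "K1 \<subseteq># K"
        by (metis add_mset_remove_trivial diff_single_trivial subset_eq_diff_conv add_mset_add_single)
      then show ?thesis by simp
    qed
  qed
  then show ?case using add by (meson finite_Un finite_imageI finite_subset)
qed simp

lemma finite_splits: "finite S \<Longrightarrow> finite (splits (S, K))"
  by (rule finite_subset[of _ "(Pow S \<times> {K1. K1 \<subseteq># K}) \<times> (Pow S \<times> {K1. K1 \<subseteq># K})"])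
    (auto simp: splits_def finite_sub_msets)

instantiation gpoly :: (comm_ring_1) ring
begin

lift_definition zero_gpoly :: "'a gpoly" is "\<lambda>_. 0" by simp
lift_definition plus_gpoly :: "'a gpoly \<Rightarrow> 'a gpoly \<Rightarrow> 'a gpoly" is "\<lambda>a b m. a m + b m" by simp
lift_definition minus_gpoly :: "'a gpoly \<Rightarrow> 'a gpoly \<Rightarrow> 'a gpoly" is "\<lambda>a b m. a m - b m" by simp
lift_definition uminus_gpoly :: "'a gpoly \<Rightarrow> 'a gpoly" is "\<lambda>a m. - a m" by simp
lift_definition times_gpoly :: "'a gpoly \<Rightarrow> 'a gpoly \<Rightarrow> 'a gpoly" is
  "\<lambda>a b m. if finite (fst m) then
     (\<Sum>(m1, m2)\<in>splits m. sg (fst m1) (fst m2) * (a m1 * b m2)) else 0" by simp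

lemma gcoeff_times':
  "gcoeff (a * b) m = (if finite (fst m) then
     (\<Sum>(m1, m2)\<in>splits m. sg (fst m1) (fst m2) * (gcoeff a m1 * gcoeff b m2)) else 0)"
  for a b :: "'a gpoly"
  by (simp add: times_gpoly.rep_eq)

lemma gpoly_mult_assoc: "a * b * c = a * (b * c)" for a b c :: "'a gpoly"
proof (rule gpoly_eqI)
  fix S :: "nat set" and K :: "nat multiset" assume S: "finite S"
  \<comment> \<open>Both bracketings become the same sum over ordered triples of monomials; the sign
    of a triple is the product of the signs of its three pairs.\<close>
  define T where "T = {(m1, m2, m3). fst m1 \<inter> fst m2 = {} \<and> fst m1 \<inter> fst m3 = {} \<and> fst m2 \<inter> fst m3 = {} \<and>
    fst m1 \<union> fst m2 \<union> fst m3 = S \<and> snd m1 + snd m2 + snd m3 = K}"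
  define F where "F = (\<lambda>(m1, m2, m3). sg (fst m1) (fst m2) * sg (fst m1) (fst m3) * sg (fst m2) (fst m3) *
    (gcoeff a m1 * gcoeff b m2 * gcoeff c m3))"
  have fin: "finite S1" if "((S1, K1), (S2, K2)) \<in> splits (S, K)" for S1 S2 K1 K2
    using that S by (auto simp: splits_iff)
  have fin': "finite S2" if "((S1, K1), (S2, K2)) \<in> splits (S, K)" for S1 S2 K1 K2
    using that S by (auto simp: splits_iff)
  have "gcoeff (a * b * c) (S, K) = (\<Sum>p\<in>splits (S, K). \<Sum>q\<in>splits (fst p).
      sg (fst (fst p)) (fst (snd p)) * (sg (fst (fst q)) (fst (snd q)) * (gcoeff a (fst q) * gcoeff b (snd q)) * gcoeff c (snd p)))"
    using S fin by (subst gcoeff_times')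
      (fastforce simp: gcoeff_times' case_prod_beta sum_distrib_left sum_distrib_right intro!: sum.cong)
  also have "\<dots> = (\<Sum>(p, q)\<in>Sigma (splits (S, K)) (\<lambda>p. splits (fst p)).
      sg (fst (fst p)) (fst (snd p)) * (sg (fst (fst q)) (fst (snd q)) * (gcoeff a (fst q) * gcoeff b (snd q)) * gcoeff c (snd p)))"
    using S fin by (intro sum.Sigma ballI) (auto intro!: finite_splits)
  also have "\<dots> = sum F T"
  proof (rule sum.reindex_bij_witness[where
          j = "\<lambda>(p, q). (fst q, snd q, snd p)" and
          i = "\<lambda>(m1, m2, m3). (((fst m1 \<union> fst m2, snd m1 + snd m2), m3), (m1, m2))"], goal_cases)
    case (5 x)
    then show ?case using S
      by (clarsimp simp: F_def splits_iff sg_Un_left mult_ac)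
  qed (auto simp: T_def splits_iff)
  finally have 1: "gcoeff (a * b * c) (S, K) = sum F T" .
  have "gcoeff (a * (b * c)) (S, K) = (\<Sum>p\<in>splits (S, K). \<Sum>q\<in>splits (snd p).
      sg (fst (fst p)) (fst (snd p)) * (gcoeff a (fst p) * (sg (fst (fst q)) (fst (snd q)) * (gcoeff b (fst q) * gcoeff c (snd q)))))"
    using S fin' by (subst gcoeff_times')
      (fastforce simp: gcoeff_times' case_prod_beta sum_distrib_left intro!: sum.cong)
  also have "\<dots> = (\<Sum>(p, q)\<in>Sigma (splits (S, K)) (\<lambda>p. splits (snd p)).
      sg (fst (fst p)) (fst (snd p)) * (gcoeff a (fst p) * (sg (fst (fst q)) (fst (snd q)) * (gcoeff b (fst q) * gcoeff c (snd q)))))"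
    using S fin' by (intro sum.Sigma ballI) (auto intro!: finite_splits)
  also have "\<dots> = sum F T"
  proof (rule sum.reindex_bij_witness[where
          j = "\<lambda>(p, q). (fst p, fst q, snd q)" and
          i = "\<lambda>(m1, m2, m3). ((m1, (fst m2 \<union> fst m3, snd m2 + snd m3)), (m2, m3))"], goal_cases)
    case (5 x)
    then show ?case using S
      by (clarsimp simp: F_def splits_iff sg_Un_right mult_ac)
  qed (auto simp: T_def splits_iff add_ac)
  finally show "gcoeff (a * b * c) (S, K) = gcoeff (a * (b * c)) (S, K)" using 1 by simp
qed

instance
proof
  fix a b c :: "'a gpoly"
  show "a * b * c = a * (b * c)" by (rule gpoly_mult_assoc)
  show "(a + b) * c = a * c + b * c" "a * (b + c) = a * b + a * c"
    by (transfer, auto simp: fun_eq_iff case_prod_beta algebra_simps sum.distrib)+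
qed (transfer, auto simp: fun_eq_iff algebra_simps)+

end

lemma gcoeff_zero [simp]: "gcoeff 0 m = 0" by transfer simp
lemma gcoeff_plus [simp]: "gcoeff (a + b) m = gcoeff a m + gcoeff b m" by transfer simp
lemma gcoeff_minus [simp]: "gcoeff (a - b) m = gcoeff a m - gcoeff b m" by transfer simp
lemma gcoeff_uminus [simp]: "gcoeff (- a) m = - gcoeff a m" by transfer simp

lemma gcoeff_sum: "gcoeff (sum f I) m = (\<Sum>i\<in>I. gcoeff (f i) m)"
  by (induction I rule: infinite_finite_induct) auto

lemma gcoeff_times:
  "finite S \<Longrightarrow> gcoeff (a * b) (S, K) =
     (\<Sum>(m1, m2)\<in>splits (S, K). sg (fst m1) (fst m2) * (gcoeff a m1 * gcoeff b m2))"
  by (simp add: gcoeff_times')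

section \<open>Parity and the derivations along the generators\<close>

lemma splits_insertD1:
  "s \<notin> S \<Longrightarrow> ((S1, K1), (S2, K2)) \<in> splits (insert s S, K) \<Longrightarrow> s \<in> S1 \<Longrightarrow> ((S1 - {s}, K1), (S2, K2)) \<in> splits (S, K)"
  unfolding splits_iff by (auto simp: set_eq_iff)

lemma splits_insertD2:
  "s \<notin> S \<Longrightarrow> ((S1, K1), (S2, K2)) \<in> splits (insert s S, K) \<Longrightarrow> s \<in> S2 \<Longrightarrow> ((S1, K1), (S2 - {s}, K2)) \<in> splits (S, K)"
  unfolding splits_iff by (auto simp: set_eq_iff)

lemma splits_insertI:
  assumes "s \<notin> S" "((S1, K1), (S2, K2)) \<in> splits (S, K)"
  shows "((insert s S1, K1), (S2, K2)) \<in> splits (insert s S, K)"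
    and "((S1, K1), (insert s S2, K2)) \<in> splits (insert s S, K)"
    and "s \<notin> S1" "s \<notin> S2"
  using assms unfolding splits_iff by auto

text \<open>A new odd generator falls into exactly one of the two factors. The two sums are the two
  halves of the Leibniz rule for \<open>lder\<close>.\<close>

lemma splits_insert_cases:
  fixes f :: "_ \<Rightarrow> 'b::comm_monoid_add"
  assumes fin: "finite S" and "s \<notin> S"
  shows "sum f (splits (insert s S, K)) =
    (\<Sum>(m1, m2)\<in>splits (S, K). f ((insert s (fst m1), snd m1), m2)) +
    (\<Sum>(m1, m2)\<in>splits (S, K). f (m1, (insert s (fst m2), snd m2)))"
proof -
  let ?A = "{p \<in> splits (insert s S, K). s \<in> fst (fst p)}" and ?B = "{p \<in> splits (insert s S, K). s \<in> fst (snd p)}"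
  have p: "fst (fst p) \<inter> fst (snd p) = {}" "fst (fst p) \<union> fst (snd p) = insert s S"
    if "p \<in> splits (insert s S, K)" for p
    using that by (simp_all add: splits_def case_prod_beta)
  have or: "s \<in> fst (fst p) \<or> s \<in> fst (snd p)" if "p \<in> splits (insert s S, K)" for p
    using p(2)[OF that] by (metis UnE insertI1)
  have nand: "\<not> (s \<in> fst (fst p) \<and> s \<in> fst (snd p))" if "p \<in> splits (insert s S, K)" for p
    using p(1)[OF that] by blast
  have "sum f (splits (insert s S, K)) = sum f (?A \<union> ?B)"
    using or by (intro arg_cong[where f = "sum f"]) blast
  also have "\<dots> = sum f ?A + sum f ?B"
    using finite_splits[of "insert s S" K] fin nand by (intro sum.union_disjoint) auto
  finally have "sum f (splits (insert s S, K)) = sum f ?A + sum f ?B" .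
  moreover have "sum f ?A = (\<Sum>(m1, m2)\<in>splits (S, K). f ((insert s (fst m1), snd m1), m2))"
    by (rule sum.reindex_bij_witness[where
          j = "\<lambda>(m1, m2). ((fst m1 - {s}, snd m1), m2)" and i = "\<lambda>(m1, m2). ((insert s (fst m1), snd m1), m2)"])
    (use assms in \<open>auto simp: insert_Diff insert_absorb splits_insertI(1,2) intro: splits_insertD1 splits_insertD2 dest: splits_insertI(3,4)\<close>)
  moreover have "sum f ?B = (\<Sum>(m1, m2)\<in>splits (S, K). f (m1, (insert s (fst m2), snd m2)))"
    by (rule sum.reindex_bij_witness[where
          j = "\<lambda>(m1, m2). (m1, (fst m2 - {s}, snd m2))" and i = "\<lambda>(m1, m2). (m1, (insert s (fst m2), snd m2))"])
    (use assms in \<open>auto simp: insert_Diff insert_absorb splits_insertI(1,2) intro: splits_insertD1 splits_insertD2 dest: splits_insertI(3,4)\<close>)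
  ultimately show ?thesis by simp
qed

text \<open>The grading automorphism. It replaces the signs depending on the degree of an element,
  so that graded identities can be stated for inhomogeneous elements as well.\<close>

lift_definition parity :: "'b::comm_ring_1 gpoly \<Rightarrow> 'b gpoly" is
  "\<lambda>a m. (- 1) ^ card (fst m) * a m" by simp

lift_definition lder :: "nat \<Rightarrow> 'b::comm_ring_1 gpoly \<Rightarrow> 'b gpoly" is
  "\<lambda>s a m. if s \<in> fst m then 0 else sg {s} (fst m) * a (insert s (fst m), snd m)" by simp

lift_definition pder :: "nat \<Rightarrow> 'b::comm_ring_1 gpoly \<Rightarrow> 'b gpoly" is
  "\<lambda>i a m. of_nat (count (snd m) i + 1) * a (fst m, add_mset i (snd m))" by simp

lemma gcoeff_parity [simp]: "gcoeff (parity a) (S, K) = (- 1) ^ card S * gcoeff a (S, K)"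
  by transfer simp
lemma gcoeff_lder: "gcoeff (lder s a) (S, K) = (if s \<in> S then 0 else sg {s} S * gcoeff a (insert s S, K))"
  by transfer simp
lemma gcoeff_pder: "gcoeff (pder i a) (S, K) = of_nat (count K i + 1) * gcoeff a (S, add_mset i K)"
  by transfer simp

lemma parity_add: "parity (a + b) = parity a + parity b"
  by (rule gpoly_eqI) (simp add: algebra_simps)
lemma parity_minus: "parity (a - b) = parity a - parity b"
  by (rule gpoly_eqI) (simp add: algebra_simps)
lemma parity_uminus: "parity (- a) = - parity a"
  by (rule gpoly_eqI) simp
lemma parity_zero [simp]: "parity 0 = 0"
  by (rule gpoly_eqI) simp
lemma parity_sum: "parity (sum f I) = (\<Sum>i\<in>I. parity (f i))"
  by (induction I rule: infinite_finite_induct) (auto simp: parity_add)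
lemma parity_parity [simp]: "parity (parity a) = a"
  by (rule gpoly_eqI) (simp flip: mult.assoc)

lemma parity_mult: "parity (a * b) = parity a * parity b"
proof (rule gpoly_eqI)
  fix S :: "nat set" and K :: "nat multiset" assume S: "finite S"
  then show "gcoeff (parity (a * b)) (S, K) = gcoeff (parity a * parity b) (S, K)"
    by (auto simp: gcoeff_times sum_distrib_left splits_iff card_Un_disjoint power_add mult_ac intro!: sum.cong)
qed

lemma lder_add: "lder s (a + b) = lder s a + lder s b"
  by (rule gpoly_eqI) (simp add: gcoeff_lder algebra_simps)
lemma lder_minus: "lder s (a - b) = lder s a - lder s b"
  by (rule gpoly_eqI) (simp add: gcoeff_lder algebra_simps)
lemma lder_uminus: "lder s (- a) = - lder s a"
  by (rule gpoly_eqI) (simp add: gcoeff_lder)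
lemma lder_zero [simp]: "lder s 0 = 0"
  by (rule gpoly_eqI) (simp add: gcoeff_lder)
lemma lder_sum: "lder s (sum f I) = (\<Sum>i\<in>I. lder s (f i))"
  by (induction I rule: infinite_finite_induct) (auto simp: lder_add)
lemma pder_add: "pder s (a + b) = pder s a + pder s b"
  by (rule gpoly_eqI) (simp add: gcoeff_pder algebra_simps)
lemma pder_minus: "pder s (a - b) = pder s a - pder s b"
  by (rule gpoly_eqI) (simp add: gcoeff_pder algebra_simps)
lemma pder_uminus: "pder s (- a) = - pder s a"
  by (rule gpoly_eqI) (simp add: gcoeff_pder algebra_simps)
lemma pder_zero [simp]: "pder s 0 = 0"
  by (rule gpoly_eqI) (simp add: gcoeff_pder)
lemma pder_sum: "pder s (sum f I) = (\<Sum>i\<in>I. pder s (f i))"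
  by (induction I rule: infinite_finite_induct) (auto simp: pder_add)

lemma sg_insert_left:
  "finite S \<Longrightarrow> finite T \<Longrightarrow> s \<notin> S \<Longrightarrow> sg (insert s S) T = sg {s} T * (sg S T :: 'b::comm_ring_1)"
  using sg_Un_left[of "{s}" S T] by simp
lemma sg_insert_right:
  "finite S \<Longrightarrow> finite T \<Longrightarrow> s \<notin> T \<Longrightarrow> sg S (insert s T) = sg S {s} * (sg S T :: 'b::comm_ring_1)"
  using sg_Un_right[of S "{s}" T] by simp

lemma lder_parity: "lder s (parity a) = - parity (lder s a)"
  by (rule gpoly_eqI) (simp add: gcoeff_lder mult_ac)
lemma lder_pder: "lder s (pder i a) = pder i (lder s a)"
  by (rule gpoly_eqI) (simp add: gcoeff_lder gcoeff_pder mult_ac)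
lemma pder_pder: "pder j (pder i a) = pder i (pder j a)"
  by (rule gpoly_eqI) (simp add: gcoeff_pder mult_ac add_mset_commute)
lemma parity_pder: "parity (pder i a) = pder i (parity a)"
  by (rule gpoly_eqI) (simp add: gcoeff_pder mult_ac)

lemma lder_lder: "lder s (lder t a) = - lder t (lder s a)"
proof (rule gpoly_eqI)
  fix S :: "nat set" and K :: "nat multiset" assume S: "finite S"
  show "gcoeff (lder s (lder t a)) (S, K) = gcoeff (- lder t (lder s a)) (S, K)"
  proof (cases "s = t \<or> s \<in> S \<or> t \<in> S")
    case False
    then have "sg {t} {s} = - (sg {s} {t} :: 'a)"
      using sg_swap[of "{s}" "{t}", where 'b='a] by simp
    then show ?thesis
      using S False by (simp add: gcoeff_lder sg_insert_right[of _ S] insert_commute[of s t] mult_ac)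
  qed (auto simp: gcoeff_lder)
qed

lemma sg_singleton_swap:
  "finite S \<Longrightarrow> s \<notin> S \<Longrightarrow> sg S {s} = sg {s} S * ((- 1) ^ card S :: 'b::comm_ring_1)"
  using sg_swap[of "{s}" S, where 'b='b] by simp

lemma lder_mult: "lder s (a * b) = lder s a * b + parity a * lder s b"
proof (rule gpoly_eqI)
  fix S :: "nat set" and K :: "nat multiset" assume S: "finite S"
  show "gcoeff (lder s (a * b)) (S, K) = gcoeff (lder s a * b + parity a * lder s b) (S, K)"
  proof (cases "s \<in> S")
    case False
    have "gcoeff (lder s (a * b)) (S, K) = 
      (\<Sum>(m1, m2)\<in>splits (S, K). sg {s} S * (sg (insert s (fst m1)) (fst m2) * (gcoeff a (insert s (fst m1), snd m1) * gcoeff b m2))) +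
      (\<Sum>(m1, m2)\<in>splits (S, K). sg {s} S * (sg (fst m1) (insert s (fst m2)) * (gcoeff a m1 * gcoeff b (insert s (fst m2), snd m2))))"
      using S False by (simp add: gcoeff_lder gcoeff_times splits_insert_cases sum_distrib_left algebra_simps case_prod_beta)
    also have "(\<Sum>(m1, m2)\<in>splits (S, K). sg {s} S * (sg (insert s (fst m1)) (fst m2) * (gcoeff a (insert s (fst m1), snd m1) * gcoeff b m2)))
       = gcoeff (lder s a * b) (S, K)"
      unfolding gcoeff_times[OF S]
    proof (intro sum.cong refl, clarify, goal_cases)
      case (1 S1 K1 S2 K2)
      then have h: "S = S1 \<union> S2" "S1 \<inter> S2 = {}" by (auto simp: splits_iff)
      then have "finite S1" "finite S2" "s \<notin> S1" using S False by auto
      then show ?case using h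
        by (simp add: gcoeff_lder sg_insert_left[of S1 S2 s] sg_Un_right[of "{s}" S1 S2] mult_ac)
    qed
    also have "(\<Sum>(m1, m2)\<in>splits (S, K). sg {s} S * (sg (fst m1) (insert s (fst m2)) * (gcoeff a m1 * gcoeff b (insert s (fst m2), snd m2))))
       = gcoeff (parity a * lder s b) (S, K)"
      unfolding gcoeff_times[OF S]
    proof (intro sum.cong refl, clarify, goal_cases)
      case (1 S1 K1 S2 K2)
      then have h: "S = S1 \<union> S2" "S1 \<inter> S2 = {}" by (auto simp: splits_iff)
      then have "finite S1" "finite S2" "s \<notin> S1" "s \<notin> S2" using S False by auto
      then show ?case using h
        by (simp add: gcoeff_lder sg_insert_right[of S1 S2 s] sg_Un_right[of "{s}" S1 S2] sg_singleton_swap mult_ac)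
    qed
    finally show ?thesis by simp
  next
    \<comment> \<open>A derivative along \<open>s\<close> has no monomial containing
      \<open>s\<close>, but each product on the right can still receive \<open>s\<close> from the
      factor that is not differentiated. These two contributions are \<open>X\<close> and
      \<open>- X\<close>.\<close>
    case True
    then obtain S' where S': "S = insert s S'" "s \<notin> S'" by (metis mk_disjoint_insert)
    then have fS': "finite S'" using S by simp
    define X where "X = (\<lambda>(m1, m2). (- 1) ^ card (fst m1) * sg (fst m1) (fst m2) *
           (gcoeff a (insert s (fst m1), snd m1) * gcoeff b (insert s (fst m2), snd m2)))"
    have "gcoeff (lder s a * b) (S, K) = sum X (splits (S', K))"
      unfolding gcoeff_times[OF S] unfolding S'(1) splits_insert_cases[OF fS' S'(2)]
    proof (subst sum.neutral, force simp: gcoeff_lder, simp only: add_0, intro sum.cong refl, clarify, goal_cases)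
      case (1 S1 K1 S2 K2)
      then have h: "S' = S1 \<union> S2" "S1 \<inter> S2 = {}" by (auto simp: splits_iff)
      then have "finite S1" "finite S2" "s \<notin> S1" "s \<notin> S2" using fS' S'(2) by auto
      then show ?case using h
        by (simp add: X_def gcoeff_lder sg_insert_right[of S1 S2 s] sg_singleton_swap mult_ac)
    qed
    moreover have "gcoeff (parity a * lder s b) (S, K) = sum (\<lambda>p. - X p) (splits (S', K))"
      unfolding gcoeff_times[OF S] unfolding S'(1) splits_insert_cases[OF fS' S'(2)]
    proof (subst (2) sum.neutral, force simp: gcoeff_lder, simp only: add_0_right, intro sum.cong refl, clarify, goal_cases)
      case (1 S1 K1 S2 K2)
      then have h: "S' = S1 \<union> S2" "S1 \<inter> S2 = {}" by (auto simp: splits_iff)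
      then have "finite S1" "finite S2" "s \<notin> S1" "s \<notin> S2" using fS' S'(2) by auto
      then show ?case using h
        by (simp add: X_def gcoeff_lder sg_insert_left[of S1 S2 s] mult_ac)
    qed
    ultimately show ?thesis using True by (simp add: gcoeff_lder sum_negf)
  qed
qed

text \<open>The exponent of \<open>p_i\<close> in a product is the sum of its exponents in the
  factors, and a factor with exponent 0 contributes nothing. Hence the differentiated sum breaks
  into the two derivatives.\<close>

lemma pder_mult: "pder i (a * b) = pder i a * b + a * pder i b"
proof (rule gpoly_eqI)
  fix S :: "nat set" and K :: "nat multiset" assume S: "finite S"
  define K' where "K' = add_mset i K"
  define f where "f = (\<lambda>(m1, m2). sg (fst m1) (fst m2) * (gcoeff a m1 * gcoeff b m2) :: 'a)"
  have "gcoeff (pder i (a * b)) (S, K) = (\<Sum>p\<in>splits (S, K'). of_nat (count K' i) * f p)"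
    by (simp add: gcoeff_pder gcoeff_times[OF S] sum_distrib_left K'_def f_def case_prod_beta)
  also have "\<dots> = (\<Sum>p\<in>splits (S, K'). of_nat (count (snd (fst p)) i) * f p + of_nat (count (snd (snd p)) i) * f p)"
    by (intro sum.cong refl) (auto simp: splits_def distrib_right[symmetric] simp flip: of_nat_add count_union)
  also have "\<dots> = (\<Sum>p\<in>splits (S, K'). of_nat (count (snd (fst p)) i) * f p) + (\<Sum>p\<in>splits (S, K'). of_nat (count (snd (snd p)) i) * f p)"
    by (rule sum.distrib)
  also have "(\<Sum>p\<in>splits (S, K'). of_nat (count (snd (fst p)) i) * f p) =
      (\<Sum>p\<in>{p \<in> splits (S, K'). i \<in># snd (fst p)}. of_nat (count (snd (fst p)) i) * f p)"
    by (rule sum.mono_neutral_right) (auto simp: finite_splits S not_in_iff)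
  also have "\<dots> = gcoeff (pder i a * b) (S, K)"
    unfolding gcoeff_times[OF S]
    by (rule sum.reindex_bij_witness[where
          i = "\<lambda>(m1, m2). ((fst m1, add_mset i (snd m1)), m2)" and
          j = "\<lambda>(m1, m2). ((fst m1, snd m1 - {#i#}), m2)"])
       (auto simp: splits_iff K'_def f_def gcoeff_pder mult_ac dest!: multi_member_split)
  also have "(\<Sum>p\<in>splits (S, K'). of_nat (count (snd (snd p)) i) * f p) =
      (\<Sum>p\<in>{p \<in> splits (S, K'). i \<in># snd (snd p)}. of_nat (count (snd (snd p)) i) * f p)"
    by (rule sum.mono_neutral_right) (auto simp: finite_splits S not_in_iff)
  also have "\<dots> = gcoeff (a * pder i b) (S, K)"
    unfolding gcoeff_times[OF S]
    by (rule sum.reindex_bij_witness[where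
          i = "\<lambda>(m1, m2). (m1, (fst m2, add_mset i (snd m2)))" and
          j = "\<lambda>(m1, m2). (m1, (fst m2, snd m2 - {#i#}))"])
       (auto simp: splits_iff K'_def f_def gcoeff_pder mult_ac dest!: multi_member_split)
  finally show "gcoeff (pder i (a * b)) (S, K) = gcoeff (pder i a * b + a * pder i b) (S, K)" by simp
qed

section \<open>Graded commutativity\<close>

lemma gcoeff_times_swap:
  "finite S \<Longrightarrow> gcoeff (a * b) (S, K) =
     (\<Sum>(m1, m2)\<in>splits (S, K). sg (fst m2) (fst m1) * (gcoeff a m2 * gcoeff b m1))"
  unfolding gcoeff_times
  by (rule sum.reindex_bij_witness[where i = prod.swap and j = prod.swap]) (auto simp: splits_iff add.commute)

text \<open>The ring may have 2-torsion, so evenness enters as an equation for the coefficients and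
  not as the vanishing of those with an odd number of generators. In the applications
  \<open>k\<close> is the number of odd generators in the other factor.\<close>

lemma parity_power:
  assumes "parity a = a"
  shows "(- 1) ^ (card S * k) * gcoeff a (S, K) = gcoeff a (S, K)"
proof -
  have "(- 1) ^ card S * gcoeff a (S, K) = gcoeff a (S, K)"
    using assms by (metis gcoeff_parity)
  then show ?thesis by (induction k) (simp_all add: power_add mult.assoc)
qed

lemma parity_power_odd:
  assumes "parity a = - a"
  shows "(- 1) ^ (card S * k) * gcoeff a (S, K) = (- 1) ^ k * gcoeff a (S, K)"
proof -
  have "(- 1) ^ card S * gcoeff a (S, K) = - gcoeff a (S, K)"
    using assms by (metis gcoeff_parity gcoeff_uminus)
  then show ?thesis
  proof (induction k)
    case (Suc k)
    have "(- 1) ^ (card S * Suc k) * gcoeff a (S, K) = (- 1) ^ card S * ((- 1) ^ (card S * k) * gcoeff a (S, K))"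
      by (simp add: power_add mult.assoc)
    also have "\<dots> = (- 1) ^ k * ((- 1) ^ card S * gcoeff a (S, K))"
      using Suc by (simp only: mult.left_commute)
    finally show ?case using Suc.prems by simp
  qed simp
qed

text \<open>Exchanging the factors costs the sign of \<open>sg_swap\<close>, and
  \<open>parity_power\<close> absorbs it into the coefficient of \<open>a\<close>.\<close>

lemma even_commute:
  assumes "parity a = a"
  shows "a * b = b * a"
proof (rule gpoly_eqI)
  fix S :: "nat set" and K :: "nat multiset" assume S: "finite S"
  show "gcoeff (a * b) (S, K) = gcoeff (b * a) (S, K)"
    unfolding gcoeff_times[OF S, of a b] gcoeff_times_swap[OF S, of b a]
  proof (intro sum.cong refl, clarify, goal_cases)
    case (1 S1 K1 S2 K2)
    then have "finite S1" "finite S2" "S1 \<inter> S2 = {}" using S by (auto simp: splits_iff)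
    then have "sg S2 S1 * (gcoeff b (S2, K2) * gcoeff a (S1, K1)) =
        sg S1 S2 * (((- 1) ^ (card S1 * card S2) * gcoeff a (S1, K1)) * gcoeff b (S2, K2))"
      by (simp add: sg_swap[of S1 S2] mult_ac)
    then show ?case
      unfolding parity_power[OF assms] by (simp add: mult_ac)
  qed
qed

text \<open>\<open>parity b\<close> carries the sign that an odd element acquires when it moves past
  \<open>b\<close>; this form covers inhomogeneous \<open>b\<close>.\<close>

lemma odd_commute:
  assumes "parity a = - a"
  shows "a * parity b = b * a"
proof (rule gpoly_eqI)
  fix S :: "nat set" and K :: "nat multiset" assume S: "finite S"
  show "gcoeff (a * parity b) (S, K) = gcoeff (b * a) (S, K)"
    unfolding gcoeff_times[OF S, of a] gcoeff_times_swap[OF S, of b a]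
  proof (intro sum.cong refl, clarify, goal_cases)
    case (1 S1 K1 S2 K2)
    then have "finite S1" "finite S2" "S1 \<inter> S2 = {}" using S by (auto simp: splits_iff)
    then have "sg S2 S1 * (gcoeff b (S2, K2) * gcoeff a (S1, K1)) =
        sg S1 S2 * (((- 1) ^ (card S1 * card S2) * gcoeff a (S1, K1)) * gcoeff b (S2, K2))"
      by (simp add: sg_swap[of S1 S2] mult_ac)
    then show ?case
      unfolding parity_power_odd[OF assms] by (simp add: mult_ac)
  qed
qed

section \<open>The canonical bracket over a differential ring\<close>

definition dual :: "nat \<Rightarrow> nat \<Rightarrow> nat" where
  "dual r s = (if s < r then s + r else s - r)"

lemma dual_dual: "s < 2 * r \<Longrightarrow> dual r (dual r s) = s"
  and dual_less: "s < 2 * r \<Longrightarrow> dual r s < 2 * r"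
  by (auto simp: dual_def)

lemma sum_dual: "(\<Sum>s<2 * r. f (dual r s)) = (\<Sum>s<2 * r. f s)"
  by (rule sum.reindex_bij_witness[where i = "dual r" and j = "dual r"]) (auto simp: dual_dual dual_less)

lemma parity_lder: "parity (lder s a) = - lder s (parity a)"
  by (simp add: lder_parity)

text \<open>\<open>C\<close> will be the smooth functions inside the ring of all functions. The
  rules for \<open>d\<close> are restricted to \<open>C\<close> because the derivative of a
  non-differentiable function is an unspecified value.\<close>

locale diff_ring =
  fixes C :: "'b::comm_ring_1 set" and d :: "nat \<Rightarrow> 'b \<Rightarrow> 'b" and n r :: nat
  assumes zero_C: "0 \<in> C"
    and add_C: "f \<in> C \<Longrightarrow> g \<in> C \<Longrightarrow> f + g \<in> C"
    and uminus_C: "f \<in> C \<Longrightarrow> - f \<in> C"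
    and mult_C: "f \<in> C \<Longrightarrow> g \<in> C \<Longrightarrow> f * g \<in> C"
    and d_C: "f \<in> C \<Longrightarrow> d i f \<in> C"
    and d_add: "f \<in> C \<Longrightarrow> g \<in> C \<Longrightarrow> d i (f + g) = d i f + d i g"
    and d_mult: "f \<in> C \<Longrightarrow> g \<in> C \<Longrightarrow> d i (f * g) = d i f * g + f * d i g"
    and d_commute: "f \<in> C \<Longrightarrow> d i (d j f) = d j (d i f)"
begin

lemma d_zero [simp]: "d i 0 = 0"
  using d_add[of 0 0] zero_C by simp

lemma d_uminus: "f \<in> C \<Longrightarrow> d i (- f) = - d i f"
  using d_add[of f "- f" i] uminus_C by (simp add: eq_neg_iff_add_eq_0 add.commute)

lemma sum_C: "(\<And>x. x \<in> I \<Longrightarrow> f x \<in> C) \<Longrightarrow> sum f I \<in> C"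
  by (induction I rule: infinite_finite_induct) (auto simp: zero_C add_C)

lemma d_sum: "(\<And>x. x \<in> I \<Longrightarrow> f x \<in> C) \<Longrightarrow> d i (sum f I) = (\<Sum>x\<in>I. d i (f x))"
  by (induction I rule: infinite_finite_induct) (auto simp: d_add sum_C)

text \<open>The unit is not assumed to lie in \<open>C\<close>, as the intended functions vanish
  outside a coordinate domain. Integers and signs therefore act on \<open>C\<close> without being
  elements of it.\<close>

lemma of_nat_C: "f \<in> C \<Longrightarrow> of_nat k * f \<in> C"
  and d_of_nat: "f \<in> C \<Longrightarrow> d i (of_nat k * f) = of_nat k * d i f"
  by (induction k) (auto simp: zero_C add_C d_add distrib_right)

lemma sign_C: "f \<in> C \<Longrightarrow> (- 1) ^ k * f \<in> C"
  and d_sign: "f \<in> C \<Longrightarrow> d i ((- 1) ^ k * f) = (- 1) ^ k * d i f"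
  by (induction k) (auto simp: uminus_C d_uminus)

lemma sg_C: "f \<in> C \<Longrightarrow> sg S T * f \<in> C"
  and d_sg: "f \<in> C \<Longrightarrow> d i (sg S T * f) = sg S T * d i f"
  unfolding sg_def by (fact sign_C d_sign)+

definition SM :: "'b gpoly set" where
  "SM = {a. \<forall>m. gcoeff a m \<in> C}"

text \<open>Not a lifted definition, since the coefficients at infinite index sets stay 0 only
  thanks to \<open>d_zero\<close>, a fact of the locale.\<close>

definition cder :: "nat \<Rightarrow> 'b gpoly \<Rightarrow> 'b gpoly" where
  "cder i a = Abs_gpoly (\<lambda>m. d i (gcoeff a m))"

lemma gcoeff_cder [simp]: "gcoeff (cder i a) m = d i (gcoeff a m)"
  unfolding cder_def by (subst Abs_gpoly_inverse) (auto simp: gcoeff_infinite)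

lemma SM_D: "a \<in> SM \<Longrightarrow> gcoeff a m \<in> C"
  by (cases m) (simp add: SM_def)

lemma SM_I: "(\<And>S K. finite S \<Longrightarrow> gcoeff a (S, K) \<in> C) \<Longrightarrow> a \<in> SM"
proof -
  assume a: "\<And>S K. finite S \<Longrightarrow> gcoeff a (S, K) \<in> C"
  have "gcoeff a (S, K) \<in> C" for S K
    using a[of S K] zero_C by (cases "finite S") (simp_all add: gcoeff_infinite)
  then show ?thesis by (simp add: SM_def)
qed

lemma SM_zero [simp]: "0 \<in> SM" by (simp add: SM_def zero_C)
lemma SM_add [simp]: "a \<in> SM \<Longrightarrow> b \<in> SM \<Longrightarrow> a + b \<in> SM" by (simp add: SM_def add_C)
lemma SM_uminus [simp]: "a \<in> SM \<Longrightarrow> - a \<in> SM" by (simp add: SM_def uminus_C)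
declare SM_D [simp]

lemma SM_minus [simp]: "a \<in> SM \<Longrightarrow> b \<in> SM \<Longrightarrow> a - b \<in> SM"
  using SM_add[of a "- b"] by simp
lemma SM_sum [simp]: "(\<And>x. x \<in> I \<Longrightarrow> f x \<in> SM) \<Longrightarrow> sum f I \<in> SM"
  by (induction I rule: infinite_finite_induct) auto
lemma SM_mult [simp]: "a \<in> SM \<Longrightarrow> b \<in> SM \<Longrightarrow> a * b \<in> SM"
  by (rule SM_I) (auto simp: gcoeff_times intro!: sum_C sg_C mult_C)
lemma SM_lder [simp]: "a \<in> SM \<Longrightarrow> lder s a \<in> SM"
  by (rule SM_I) (auto simp: gcoeff_lder intro!: sg_C zero_C)
lemma SM_pder [simp]: "a \<in> SM \<Longrightarrow> pder i a \<in> SM"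
  by (rule SM_I) (auto simp: gcoeff_pder intro!: of_nat_C simp del: of_nat_Suc)
lemma SM_parity [simp]: "a \<in> SM \<Longrightarrow> parity a \<in> SM"
  by (rule SM_I) (auto intro!: sign_C)
lemma SM_cder [simp]: "a \<in> SM \<Longrightarrow> cder i a \<in> SM"
  by (rule SM_I) (auto intro!: d_C)

lemma cder_zero [simp]: "cder i 0 = 0"
  by (rule gpoly_eqI) simp
lemma cder_add: "a \<in> SM \<Longrightarrow> b \<in> SM \<Longrightarrow> cder i (a + b) = cder i a + cder i b"
  by (rule gpoly_eqI) (simp add: d_add)
lemma cder_uminus: "a \<in> SM \<Longrightarrow> cder i (- a) = - cder i a"
  by (rule gpoly_eqI) (simp add: d_uminus)
lemma cder_minus: "a \<in> SM \<Longrightarrow> b \<in> SM \<Longrightarrow> cder i (a - b) = cder i a - cder i b"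
  using cder_add[of a "- b"] by (simp add: cder_uminus)
lemma cder_sum: "(\<And>x. x \<in> I \<Longrightarrow> f x \<in> SM) \<Longrightarrow> cder i (sum f I) = (\<Sum>x\<in>I. cder i (f x))"
  by (induction I rule: infinite_finite_induct) (auto simp: cder_add)
lemma cder_mult: "a \<in> SM \<Longrightarrow> b \<in> SM \<Longrightarrow> cder i (a * b) = cder i a * b + a * cder i b"
  by (rule gpoly_eqI)
    (auto simp: gcoeff_times d_sum d_sg d_mult sg_C mult_C case_prod_beta distrib_left sum.distrib[symmetric] intro!: sum.cong)
lemma cder_cder: "a \<in> SM \<Longrightarrow> cder i (cder j a) = cder j (cder i a)"
  by (rule gpoly_eqI) (simp add: d_commute)
lemma cder_lder: "a \<in> SM \<Longrightarrow> cder i (lder s a) = lder s (cder i a)"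
  by (rule gpoly_eqI) (simp add: gcoeff_lder d_sg)
lemma cder_pder: "a \<in> SM \<Longrightarrow> cder i (pder j a) = pder j (cder i a)"
  by (rule gpoly_eqI) (simp add: gcoeff_pder d_of_nat del: of_nat_Suc)
lemma cder_parity: "a \<in> SM \<Longrightarrow> cder i (parity a) = parity (cder i a)"
  by (rule gpoly_eqI) (simp add: d_sign)

text \<open>\<open>parity (lder s a)\<close> is the right derivative of \<open>a\<close>, and \<open>dual r\<close> exchanges \<open>\<tau>\<^sup>\<alpha>\<close> and \<open>\<theta>\<^sub>\<alpha>\<close>.\<close>

definition br :: "'b gpoly \<Rightarrow> 'b gpoly \<Rightarrow> 'b gpoly" where
  "br a b = (\<Sum>i<n. cder i a * pder i b - pder i a * cder i b) +
     (\<Sum>s<2 * r. parity (lder s a) * lder (dual r s) b)"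

lemma SM_br [simp]: "a \<in> SM \<Longrightarrow> b \<in> SM \<Longrightarrow> br a b \<in> SM"
  unfolding br_def by simp

lemma br_add_left: "a \<in> SM \<Longrightarrow> b \<in> SM \<Longrightarrow> br (a + b) c = br a c + br b c"
  by (simp add: br_def cder_add pder_add lder_add parity_add algebra_simps sum.distrib sum_subtractf)
lemma br_add_right: "b \<in> SM \<Longrightarrow> c \<in> SM \<Longrightarrow> br a (b + c) = br a b + br a c"
  by (simp add: br_def cder_add pder_add lder_add parity_add algebra_simps sum.distrib sum_subtractf)
lemma br_uminus_left: "a \<in> SM \<Longrightarrow> br (- a) b = - br a b"
  by (simp add: br_def cder_uminus pder_uminus lder_uminus parity_uminus sum_negf sum_subtractf)
lemma br_uminus_right: "b \<in> SM \<Longrightarrow> br a (- b) = - br a b"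
  by (simp add: br_def cder_uminus pder_uminus lder_uminus parity_uminus sum_negf sum_subtractf)
lemma br_minus_left: "a \<in> SM \<Longrightarrow> b \<in> SM \<Longrightarrow> br (a - b) c = br a c - br b c"
  using br_add_left[of a "- b" c] by (simp add: br_uminus_left)
lemma br_minus_right: "b \<in> SM \<Longrightarrow> c \<in> SM \<Longrightarrow> br a (b - c) = br a b - br a c"
  using br_add_right[of b "- c" a] by (simp add: br_uminus_right)
lemma br_zero_left [simp]: "br 0 b = 0"
  by (simp add: br_def)
lemma br_zero_right [simp]: "br a 0 = 0"
  by (simp add: br_def)

lemma parity_br: "a \<in> SM \<Longrightarrow> b \<in> SM \<Longrightarrow> parity (br a b) = br (parity a) (parity b)"
  by (simp add: br_def parity_add parity_sum parity_minus parity_mult cder_parity lder_parity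
      parity_uminus flip: parity_pder)

text \<open>The coordinate derivatives of an even \<open>a\<close> commute with everything and its
  odd derivatives are odd. Renaming the summation index by \<open>dual\<close> then matches the two
  odd sums up to sign.\<close>

lemma br_even_swap:
  assumes "a \<in> SM" "parity a = a"
  shows "br a b = - br b a"
proof -
  have 1: "cder i a * x = x * cder i a" "pder i a * x = x * pder i a" for i x
    using assms by (auto intro!: even_commute simp: parity_pder simp flip: cder_parity)
  have 2: "parity (lder s a) = - lder s a" for s
    by (simp only: parity_lder assms(2))
  have 3: "lder s a * x = parity x * lder s a" for s x
    using odd_commute[OF 2, of s "parity x"] by simp
  show ?thesis
    unfolding br_def
    by (subst (2) sum_dual[symmetric])
       (simp add: 1 2 3 dual_dual sum_negf sum_subtractf)
qed

text \<open>The roles are exchanged: coordinate derivatives are now odd and anticommute, while odd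
  derivatives are even and commute. The bracket of two odd elements is thus symmetric.\<close>

lemma br_odd_swap:
  assumes "a \<in> SM" "b \<in> SM" "parity a = - a" "parity b = - b"
  shows "br a b = br b a"
proof -
  have 1: "cder i a * pder i b = - (pder i b * cder i a)" "pder i a * cder i b = - (cder i b * pder i a)" for i
  proof -
    have "cder i a * parity (- pder i b) = - pder i b * cder i a"
      by (rule odd_commute) (use assms in \<open>simp add: cder_uminus flip: cder_parity\<close>)
    then show "cder i a * pder i b = - (pder i b * cder i a)"
      using assms(4) by (simp add: parity_uminus parity_pder pder_uminus)
  next
    have "pder i a * parity (cder i b) = cder i b * pder i a"
      by (rule odd_commute) (use assms in \<open>simp add: parity_pder pder_uminus\<close>)
    moreover have "parity (cder i b) = - cder i b"
      using assms by (simp add: cder_uminus flip: cder_parity)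
    ultimately show "pder i a * cder i b = - (cder i b * pder i a)" by (metis minus_minus mult_minus_right)
  qed
  have 2: "parity (lder s a) = lder s a" "parity (lder s b) = lder s b" for s
    by (simp_all only: parity_lder assms(3,4) lder_uminus minus_minus)
  have 3: "lder s a * x = x * lder s a" for s x
    by (rule even_commute) (rule 2)
  show ?thesis
    unfolding br_def
    by (subst (2) sum_dual[symmetric]) (simp add: 1 2 3 dual_dual sum_negf sum_subtractf)
qed

text \<open>The proof uses that \<open>D = {a, \<cdot>}\<close> is an even derivation whose commutator with each partial derivative
  \<open>\<partial>\<close> is the bracket with \<open>\<partial>a\<close>; what remains is a form in the second derivatives of \<open>a\<close>
  that cancels by symmetry.\<close>

lemma br_jacobi_even:
  assumes SM: "a \<in> SM" "b \<in> SM" "c \<in> SM" and even: "parity a = a" and P0: "\<And>i. pder i a = 0"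
  shows "br a (br b c) = br (br a b) c + br b (br a c)"
proof -
  let ?l = "dual r"
  define D where "D x = br a x" for x
  define e where "e i = cder i a" for i
  define l where "l s = lder s a" for s
  have SMe [simp]: "e i \<in> SM" "l s \<in> SM" for i s using SM by (auto simp: e_def l_def)
  have e: "parity (e i) = e i" for i using even SM by (simp add: e_def flip: cder_parity)
  have l: "parity (l s) = - l s" for s
    by (simp only: l_def parity_lder even)
  have ec: "e i * x = x * e i" for i x by (rule even_commute[OF e])
  have lc: "l s * parity x = x * l s" for s x by (rule odd_commute[OF l])
  have lc': "parity x * l s = l s * x" for s x using lc[of s "parity x"] by simp
  have ec2: "e i * (x * z) = x * (e i * z)" for i x z by (metis ec mult.assoc)
  have lc2: "l s * (parity x * z) = x * (l s * z)" for s x z by (metis lc mult.assoc)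
  have Pe: "pder j (e i) = 0" "pder j (l s) = 0" for i j s
    using SM P0 by (simp_all add: e_def l_def flip: cder_pder lder_pder)
  \<comment> \<open>As \<open>a\<close> is free of \<open>p\<close>, no derivative of the
    coefficients of \<open>x\<close> remains. So \<open>D\<close> is defined by products and formal
    derivatives alone, and the rules for it hold for every \<open>x\<close>, inside
    \<open>SM\<close> or not.\<close>
  have D: "D x = (\<Sum>i<n. e i * pder i x) - (\<Sum>s<2*r. l s * lder (?l s) x)" for x
    unfolding D_def br_def using P0 l by (simp add: e_def l_def sum_negf)
  have Dmult: "D (x * y) = D x * y + x * D y" for x y
  proof -
    have "e i * (pder i x * y + x * pder i y) = e i * pder i x * y + x * (e i * pder i y)" for i
      by (simp add: distrib_left ec2 mult.assoc)
    moreover have "l s * (lder t x * y + parity x * lder t y) = l s * lder t x * y + x * (l s * lder t y)" for s t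
      by (simp add: distrib_left lc2 mult.assoc)
    ultimately show ?thesis
      by (simp add: D pder_mult lder_mult sum.distrib sum_distrib_left sum_distrib_right algebra_simps)
  qed
  have Dadd: "D (x + y) = D x + D y" "D (x - y) = D x - D y" for x y
    by (simp_all add: D pder_add lder_add pder_minus lder_minus algebra_simps sum.distrib sum_subtractf)
  have D0: "D 0 = 0" by (simp add: D)
  have Dsum: "D (sum f I) = (\<Sum>i\<in>I. D (f i))" for f and I :: "nat set"
    by (induction I rule: infinite_finite_induct) (auto simp: Dadd D0)
  \<comment> \<open>\<open>E j\<close> and \<open>F t\<close> are the commutators of
    \<open>cder j\<close> and \<open>lder t\<close> with \<open>D\<close>; \<open>pder j\<close>
    commutes with \<open>D\<close>.\<close>
  define E where "E j x = (\<Sum>i<n. cder j (e i) * pder i x) - (\<Sum>s<2*r. cder j (l s) * lder (?l s) x)" for j x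
  define F where "F t x = (\<Sum>i<n. cder i (l t) * pder i x) - (\<Sum>s<2*r. lder t (l s) * lder (?l s) x)" for t x
  have dxD: "cder j (D x) = D (cder j x) + E j x" if "x \<in> SM" for j x
    using that by (simp add: D E_def cder_minus cder_sum cder_mult cder_pder cder_lder sum.distrib)
  have pD: "pder j (D x) = D (pder j x)" for j x
    by (simp add: D pder_minus pder_sum pder_mult Pe pder_pder[of j] lder_pder)
  have lD: "lder t (D x) = D (lder t x) + F t x" for t x
  proof -
    have 1: "lder t (e i * pder i x) = cder i (l t) * pder i x + e i * pder i (lder t x)" for i
      using SM by (simp add: lder_mult e lder_pder) (simp add: e_def l_def cder_lder)
    have 2: "lder t (l s * lder (?l s) x) = lder t (l s) * lder (?l s) x + l s * lder (?l s) (lder t x)" for s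
      by (simp add: lder_mult l lder_lder[of t "?l s" x])
    show ?thesis
      by (simp add: D F_def lder_minus lder_sum 1 2 sum.distrib)
  qed
  have sD: "parity (D x) = D (parity x)" for x
    by (simp add: D parity_minus parity_sum parity_mult e l parity_pder lder_parity)
  have lcx: "cder i (l s) * parity x = x * cder i (l s)" for i s x
    by (rule odd_commute) (use l[of s] in \<open>simp add: cder_uminus flip: cder_parity\<close>)
  have lcx': "parity x * cder i (l s) = cder i (l s) * x" for i s x using lcx[of i s "parity x"] by simp
  have ecx: "cder j (e i) * x = x * cder j (e i)" for i j x
    by (rule even_commute) (use e[of i] in \<open>simp flip: cder_parity\<close>)
  have ll: "parity (lder s (l t)) = lder s (l t)" for s t
    by (simp only: parity_lder l lder_uminus minus_minus)
  have llc: "lder s (l t) * x = x * lder s (l t)" for s t x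
    by (rule even_commute) (rule ll)
  have lls: "lder s (l t) = - lder t (l s)" for s t unfolding l_def by (rule lder_lder)
  have ecx2: "cder j (e i) * (x * z) = x * (cder j (e i) * z)" for i j x z by (metis ecx mult.assoc)
  have lcx2: "parity x * (cder i (l s) * z) = cder i (l s) * (x * z)" for i s x z by (metis lcx' mult.assoc)
  have llc2: "lder s (l t) * (x * z) = x * (lder s (l t) * z)" for s t x z by (metis llc mult.assoc)
  \<comment> \<open>The second derivatives of \<open>a\<close> come in four groups: base-base in
    \<open>A\<close>, base-odd with the two roles of \<open>b\<close> and \<open>c\<close> in
    \<open>B\<close> and \<open>C\<close>, odd-odd in \<open>G\<close>. Base derivatives commute,
    odd ones anticommute by \<open>lls\<close>, and \<open>dual\<close> renames the odd
    indices.\<close>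
  have A: "(\<Sum>j<n. \<Sum>i<n. cder j (e i) * pder i b * pder j c) = (\<Sum>j<n. \<Sum>i<n. pder j b * (cder j (e i) * pder i c))"
  proof -
    have "cder j (e i) = cder i (e j)" for i j using SM(1) unfolding e_def by (rule cder_cder)
    then have "cder j (e i) * pder i b * pder j c = pder i b * (cder i (e j) * pder j c)" for i j
      by (metis ecx2 mult.assoc)
    then show ?thesis by (subst sum.swap) simp
  qed
  have B: "(\<Sum>j<n. \<Sum>s<2*r. cder j (l s) * lder (?l s) b * pder j c) =
      (\<Sum>s<2*r. \<Sum>j<n. parity (lder s b) * (cder j (l (?l s)) * pder j c))"
  proof -
    have "(\<Sum>s<2*r. \<Sum>j<n. parity (lder s b) * (cder j (l (?l s)) * pder j c)) =
        (\<Sum>s<2*r. \<Sum>j<n. cder j (l (?l s)) * (lder s b * pder j c))"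
      by (simp add: lcx2)
    also have "\<dots> = (\<Sum>s<2*r. \<Sum>j<n. cder j (l (?l (?l s))) * (lder (?l s) b * pder j c))"
      by (rule sum_dual[symmetric])
    also have "\<dots> = (\<Sum>s<2*r. \<Sum>j<n. cder j (l s) * lder (?l s) b * pder j c)"
      by (simp add: dual_dual mult.assoc)
    finally show ?thesis by (subst sum.swap) simp
  qed
  have C: "(\<Sum>s<2*r. \<Sum>i<n. parity (cder i (l s) * pder i b) * lder (?l s) c) =
      - (\<Sum>j<n. \<Sum>s<2*r. pder j b * (cder j (l s) * lder (?l s) c))"
  proof -
    have "parity (cder i (l s)) = - cder i (l s)" for i s
      using l[of s] by (simp add: cder_uminus flip: cder_parity)
    then have "parity (cder i (l s) * pder i b) * lder (?l s) c = - (pder i b * (cder i (l s) * lder (?l s) c))" for i s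
      by (simp add: parity_mult lcx mult.assoc[symmetric])
    then show ?thesis
      by (subst sum.swap) (simp add: sum_negf)
  qed
  have G: "(\<Sum>s<2*r. \<Sum>t<2*r. parity (lder s (l t) * lder (?l t) b) * lder (?l s) c) =
      - (\<Sum>s<2*r. \<Sum>t<2*r. parity (lder s b) * (lder (?l s) (l t) * lder (?l t) c))"
  proof -
    have "(\<Sum>s<2*r. \<Sum>t<2*r. parity (lder s b) * (lder (?l s) (l t) * lder (?l t) c)) =
        (\<Sum>s<2*r. \<Sum>t<2*r. parity (lder (?l s) b) * (lder (?l (?l s)) (l t) * lder (?l t) c))"
      by (rule sum_dual[symmetric])
    also have "\<dots> = (\<Sum>s<2*r. \<Sum>t<2*r. parity (lder (?l s) b) * (lder s (l t) * lder (?l t) c))"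
      by (simp add: dual_dual)
    also have "\<dots> = (\<Sum>s<2*r. \<Sum>t<2*r. parity (lder (?l t) b) * (lder t (l s) * lder (?l s) c))"
      by (rule sum.swap)
    also have "\<dots> = (\<Sum>s<2*r. \<Sum>t<2*r. - (parity (lder s (l t) * lder (?l t) b) * lder (?l s) c))"
    proof (intro sum.cong refl)
      fix s t
      have "parity (lder (?l t) b) * (lder t (l s) * lder (?l s) c) = - (parity (lder (?l t) b) * (lder s (l t) * lder (?l s) c))"
        by (subst lls) simp
      also have "\<dots> = - (lder s (l t) * (parity (lder (?l t) b) * lder (?l s) c))"
        by (simp only: llc2)
      finally show "parity (lder (?l t) b) * (lder t (l s) * lder (?l s) c) = - (parity (lder s (l t) * lder (?l t) b) * lder (?l s) c)"
        by (simp add: parity_mult ll mult.assoc)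
    qed
    finally show ?thesis by (simp add: sum_negf)
  qed
  have rest: "(\<Sum>j<n. E j b * pder j c - pder j b * E j c) +
      (\<Sum>s<2*r. parity (F s b) * lder (?l s) c + parity (lder s b) * F (?l s) c) = 0"
    using A B C G
    by (simp add: E_def F_def sum_distrib_left sum_distrib_right algebra_simps sum.distrib sum_subtractf
        parity_minus parity_sum)
  let ?X = "(\<Sum>j<n. D (cder j b) * pder j c + cder j b * D (pder j c) - (D (pder j b) * cder j c + pder j b * D (cder j c)))
      + (\<Sum>s<2*r. D (parity (lder s b)) * lder (?l s) c + parity (lder s b) * D (lder (?l s) c))"
  have 1: "br a (br b c) = ?X"
    unfolding D_def[symmetric] by (simp add: br_def[of b c] Dadd Dsum Dmult)
  have 2: "br (D b) c = (\<Sum>j<n. D (cder j b) * pder j c - D (pder j b) * cder j c + E j b * pder j c)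
     + (\<Sum>s<2*r. D (parity (lder s b)) * lder (?l s) c + parity (F s b) * lder (?l s) c)"
    unfolding br_def[of "D b"] using SM by (simp add: dxD pD lD parity_add sD algebra_simps)
  have 3: "br b (D c) = (\<Sum>j<n. cder j b * D (pder j c) - pder j b * D (cder j c) - pder j b * E j c)
     + (\<Sum>s<2*r. parity (lder s b) * D (lder (?l s) c) + parity (lder s b) * F (?l s) c)"
    unfolding br_def[of b] using SM by (simp add: dxD pD lD algebra_simps)
  have "br (D b) c + br b (D c) = ?X + ((\<Sum>j<n. E j b * pder j c - pder j b * E j c) +
      (\<Sum>s<2*r. parity (F s b) * lder (?l s) c + parity (lder s b) * F (?l s) c))"
    unfolding 2 3 by (simp add: sum.distrib sum_subtractf algebra_simps)
  then show ?thesis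
    unfolding rest 1 unfolding D_def by simp
qed

end

section \<open>Weights and the range of the generators\<close>

context diff_ring
begin

text \<open>An odd generator \<open>s\<close> has weight \<open>w s\<close> and every
  \<open>p_i\<close> has weight \<open>g\<close>. Two weights are used: the degree, with
  \<open>w = 1\<close> and \<open>g = 2\<close>, and the number of momenta, with
  \<open>g = 1\<close>.\<close>

definition homogeneous :: "(nat \<Rightarrow> int) \<Rightarrow> int \<Rightarrow> int \<Rightarrow> 'b gpoly \<Rightarrow> bool" where
  "homogeneous w g k a \<longleftrightarrow> (\<forall>S K. gcoeff a (S, K) \<noteq> 0 \<longrightarrow> sum w S + g * int (size K) = k)"

lemma homogeneous_D: "homogeneous w g k a \<Longrightarrow> gcoeff a (S, K) \<noteq> 0 \<Longrightarrow> sum w S + g * int (size K) = k"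
  by (auto simp: homogeneous_def)

lemma homogeneous_zero [simp]: "homogeneous w g k 0" by (simp add: homogeneous_def)
lemma homogeneous_add: "homogeneous w g k a \<Longrightarrow> homogeneous w g k b \<Longrightarrow> homogeneous w g k (a + b)"
  unfolding homogeneous_def by (metis add_0 gcoeff_plus)
lemma homogeneous_minus: "homogeneous w g k a \<Longrightarrow> homogeneous w g k b \<Longrightarrow> homogeneous w g k (a - b)"
  unfolding homogeneous_def by (metis diff_self gcoeff_minus)
lemma homogeneous_sum: "(\<And>x. x \<in> I \<Longrightarrow> homogeneous w g k (f x)) \<Longrightarrow> homogeneous w g k (sum f I)"
  by (induction I rule: infinite_finite_induct) (auto simp: homogeneous_add)
lemma homogeneous_parity: "homogeneous w g k a \<Longrightarrow> homogeneous w g k (parity a)"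
  unfolding homogeneous_def by (metis gcoeff_parity mult_zero_right)
lemma homogeneous_cder: "homogeneous w g k a \<Longrightarrow> homogeneous w g k (cder i a)"
  unfolding homogeneous_def by (metis gcoeff_cder d_zero)
lemma homogeneous_pder: "homogeneous w g k a \<Longrightarrow> homogeneous w g (k - g) (pder i a)"
  unfolding homogeneous_def
proof (intro allI impI)
  fix S :: "nat set" and K :: "nat multiset"
  assume a: "\<forall>S K. gcoeff a (S, K) \<noteq> 0 \<longrightarrow> sum w S + g * int (size K) = k" and nz: "gcoeff (pder i a) (S, K) \<noteq> 0"
  then have "gcoeff a (S, add_mset i K) \<noteq> 0" by (auto simp: gcoeff_pder)
  then have "sum w S + g * int (size (add_mset i K)) = k" using a by blast
  then show "sum w S + g * int (size K) = k - g" by (simp add: algebra_simps)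
qed
lemma homogeneous_lder: "homogeneous w g k a \<Longrightarrow> homogeneous w g (k - w s) (lder s a)"
  unfolding homogeneous_def
proof (intro allI impI)
  fix S :: "nat set" and K :: "nat multiset"
  assume a: "\<forall>S K. gcoeff a (S, K) \<noteq> 0 \<longrightarrow> sum w S + g * int (size K) = k" and nz: "gcoeff (lder s a) (S, K) \<noteq> 0"
  then have "s \<notin> S" "gcoeff a (insert s S, K) \<noteq> 0" by (auto simp: gcoeff_lder split: if_splits)
  moreover from this have "finite S" by (metis gcoeff_infinite finite_insert)
  ultimately show "sum w S + g * int (size K) = k - w s" using a by fastforce
qed
lemma homogeneous_mult:
  assumes "homogeneous w g k a" "homogeneous w g l b"
  shows "homogeneous w g (k + l) (a * b)"
  unfolding homogeneous_def
proof (intro allI impI)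
  fix S :: "nat set" and K :: "nat multiset"
  assume nz: "gcoeff (a * b) (S, K) \<noteq> 0"
  then have S: "finite S" using gcoeff_infinite by blast
  from nz obtain p where "p \<in> splits (S, K)" "gcoeff a (fst p) * gcoeff b (snd p) \<noteq> 0"
    unfolding gcoeff_times[OF S] by (metis (no_types, lifting) case_prod_beta mult_zero_right sum.neutral)
  then obtain S1 K1 S2 K2 where p: "((S1, K1), (S2, K2)) \<in> splits (S, K)"
      and nz: "gcoeff a (S1, K1) * gcoeff b (S2, K2) \<noteq> 0" by (metis surj_pair prod.collapse)
  from nz have "gcoeff a (S1, K1) \<noteq> 0" "gcoeff b (S2, K2) \<noteq> 0" by auto
  with homogeneous_D[OF assms(1)] homogeneous_D[OF assms(2)]
  have "sum w S1 + g * int (size K1) = k" "sum w S2 + g * int (size K2) = l" by blast+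
  moreover have "S = S1 \<union> S2" "S1 \<inter> S2 = {}" "K = K1 + K2" using p by (auto simp: splits_iff)
  ultimately show "sum w S + g * int (size K) = k + l"
    using S by (simp add: sum.union_disjoint algebra_simps)
qed

text \<open>Each term of the bracket removes either one \<open>p_i\<close> or a dual pair of odd
  generators, and the hypothesis on \<open>w\<close> gives both the same weight
  \<open>g\<close>.\<close>

lemma homogeneous_br:
  assumes w: "\<And>s. s < 2 * r \<Longrightarrow> w s + w (dual r s) = g"
    and a: "homogeneous w g k a" and b: "homogeneous w g l b"
  shows "homogeneous w g (k + l - g) (br a b)"
proof -
  have "homogeneous w g (k + l - g) (cder i a * pder i b)" "homogeneous w g (k + l - g) (pder i a * cder i b)" for i
    using homogeneous_mult[OF homogeneous_cder[OF a] homogeneous_pder[OF b], of i i] homogeneous_mult[OF homogeneous_pder[OF a] homogeneous_cder[OF b], of i i]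
    by (simp_all add: algebra_simps)
  moreover have "homogeneous w g (k + l - g) (parity (lder s a) * lder (dual r s) b)" if "s < 2 * r" for s
    using homogeneous_mult[OF homogeneous_parity[OF homogeneous_lder[OF a]] homogeneous_lder[OF b], of s "dual r s"] w[OF that]
    by (simp add: algebra_simps)
  ultimately show ?thesis
    unfolding br_def by (intro homogeneous_add homogeneous_sum homogeneous_minus) auto
qed

text \<open>Monomials are built from all natural numbers, so the range of the generators that really
  occur has to be carried along.\<close>

definition in_vars :: "'b gpoly \<Rightarrow> bool" where
  "in_vars a \<longleftrightarrow> (\<forall>S K. gcoeff a (S, K) \<noteq> 0 \<longrightarrow> S \<subseteq> {..<2 * r} \<and> set_mset K \<subseteq> {..<n})"

lemma in_vars_D: "in_vars a \<Longrightarrow> gcoeff a (S, K) \<noteq> 0 \<Longrightarrow> S \<subseteq> {..<2 * r} \<and> set_mset K \<subseteq> {..<n}"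
  by (auto simp: in_vars_def)
lemma in_vars_zero [simp]: "in_vars 0" by (simp add: in_vars_def)
lemma in_vars_add: "in_vars a \<Longrightarrow> in_vars b \<Longrightarrow> in_vars (a + b)"
  unfolding in_vars_def by (metis add_0 gcoeff_plus)
lemma in_vars_minus: "in_vars a \<Longrightarrow> in_vars b \<Longrightarrow> in_vars (a - b)"
  unfolding in_vars_def by (metis diff_self gcoeff_minus)
lemma in_vars_sum: "(\<And>x. x \<in> I \<Longrightarrow> in_vars (f x)) \<Longrightarrow> in_vars (sum f I)"
  by (induction I rule: infinite_finite_induct) (auto simp: in_vars_add)
lemma in_vars_parity: "in_vars a \<Longrightarrow> in_vars (parity a)"
  unfolding in_vars_def by (metis gcoeff_parity mult_zero_right)
lemma in_vars_cder: "in_vars a \<Longrightarrow> in_vars (cder i a)"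
  unfolding in_vars_def by (metis gcoeff_cder d_zero)
lemma in_vars_pder: "in_vars a \<Longrightarrow> in_vars (pder i a)"
  unfolding in_vars_def gcoeff_pder by (metis insert_subset mult_zero_right set_mset_add_mset_insert)
lemma in_vars_lder: "in_vars a \<Longrightarrow> in_vars (lder s a)"
  unfolding in_vars_def gcoeff_lder by (metis insert_subset mult_zero_right)
lemma in_vars_mult:
  assumes "in_vars a" "in_vars b"
  shows "in_vars (a * b)"
  unfolding in_vars_def
proof (intro allI impI)
  fix S :: "nat set" and K :: "nat multiset"
  assume nz: "gcoeff (a * b) (S, K) \<noteq> 0"
  then have S: "finite S" using gcoeff_infinite by blast
  from nz obtain p where "p \<in> splits (S, K)" "gcoeff a (fst p) * gcoeff b (snd p) \<noteq> 0"
    unfolding gcoeff_times[OF S] by (metis (no_types, lifting) case_prod_beta mult_zero_right sum.neutral)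
  then obtain S1 K1 S2 K2 where p: "((S1, K1), (S2, K2)) \<in> splits (S, K)"
      and nz: "gcoeff a (S1, K1) * gcoeff b (S2, K2) \<noteq> 0" by (metis surj_pair prod.collapse)
  from nz have "gcoeff a (S1, K1) \<noteq> 0" "gcoeff b (S2, K2) \<noteq> 0" by auto
  with in_vars_D[OF assms(1)] in_vars_D[OF assms(2)]
  have "S1 \<subseteq> {..<2 * r}" "set_mset K1 \<subseteq> {..<n}" "S2 \<subseteq> {..<2 * r}" "set_mset K2 \<subseteq> {..<n}" by blast+
  moreover have "S = S1 \<union> S2" "S1 \<inter> S2 = {}" "K = K1 + K2" using p by (auto simp: splits_iff)
  ultimately show "S \<subseteq> {..<2 * r} \<and> set_mset K \<subseteq> {..<n}" by simp
qed
lemma in_vars_br: "in_vars a \<Longrightarrow> in_vars b \<Longrightarrow> in_vars (br a b)"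
  unfolding br_def
  by (intro in_vars_add in_vars_sum in_vars_minus in_vars_mult in_vars_parity in_vars_lder in_vars_pder in_vars_cder)

end

section \<open>Smooth functions on open subsets of \<open>\<real>\<^sup>n\<close>\<close>

abbreviation openRn :: "nat \<Rightarrow> (nat \<Rightarrow> real) set \<Rightarrow> bool" where
  "openRn n V \<equiv> openin (top_of_set (Rn n)) V"

lemma Rn_upd: "y \<in> Rn n \<Longrightarrow> i < n \<Longrightarrow> y(i := t) \<in> Rn n"
  by (auto simp: Rn_def)

lemma continuous_on_upd: "continuous_on UNIV (\<lambda>t::real. (y::nat \<Rightarrow> real)(i := t))"
proof (rule continuous_on_coordinatewise_then_product)
  show "continuous_on UNIV (\<lambda>t. (y(i := t)) k)" for k
    by (cases "k = i") auto
qed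

lemma continuous_on_upd2: "continuous_on UNIV (\<lambda>p::real \<times> real. (y::nat \<Rightarrow> real)(i := fst p, j := snd p))"
proof (rule continuous_on_coordinatewise_then_product)
  show "continuous_on UNIV (\<lambda>p. (y(i := fst p, j := snd p)) k)" for k
    by (cases "k = i"; cases "k = j") (auto intro!: continuous_intros)
qed

text \<open>\<open>V\<close> is open only relative to \<open>Rn n\<close>, so a point can be moved
  along the directions \<open>i < n\<close> alone. This is what makes partial derivatives depend on
  values in \<open>V\<close> only.\<close>

lemma eventually_upd_in:
  assumes "openRn n V" "y \<in> V" "i < n"
  shows "\<forall>\<^sub>F t in nhds (y i). y(i := t) \<in> V"
proof -
  obtain T where T: "open T" "V = Rn n \<inter> T" using assms(1) by (auto simp: openin_open)
  have "open ((\<lambda>t. y(i := t)) -` T)" using T(1) continuous_on_upd by (rule open_vimage)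
  moreover have "y i \<in> (\<lambda>t. y(i := t)) -` T" using assms(2) T(2) by simp
  ultimately have "\<forall>\<^sub>F t in nhds (y i). t \<in> (\<lambda>t. y(i := t)) -` T" by (rule eventually_nhds_in_open)
  then show ?thesis
    by eventually_elim (use assms T(2) Rn_upd in auto)
qed

lemma pderiv_at_cong:
  assumes "openRn n V" "y \<in> V" "i < n" "\<And>z. z \<in> V \<Longrightarrow> f z = g z"
  shows "pderiv_at i f y = pderiv_at i g y"
  unfolding pderiv_at_def
  by (rule deriv_cong_ev[OF _ refl]) (use eventually_upd_in[OF assms(1-3)] assms(4) in \<open>auto elim: eventually_mono\<close>)

lemma Ck_on_continuous: "Ck_on n k V f \<Longrightarrow> continuous_on V f"
  by (cases k) auto

lemma Ck_on_subset: "Ck_on n k V f \<Longrightarrow> W \<subseteq> V \<Longrightarrow> Ck_on n k W f"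
  by (induction k arbitrary: f) (auto intro: continuous_on_subset)

lemma Ck_on_Suc_D: "Ck_on n (Suc k) V f \<Longrightarrow> Ck_on n k V f"
  by (induction k arbitrary: f) auto

lemma Ck_on_cong:
  assumes "openRn n V" "\<And>z. z \<in> V \<Longrightarrow> f z = g z" "Ck_on n k V f"
  shows "Ck_on n k V g"
  using assms(2,3)
proof (induction k arbitrary: f g)
  case 0
  then show ?case using continuous_on_cong[of V V f g] by simp
next
  case (Suc k)
  have "continuous_on V g" using Suc.prems continuous_on_cong[of V V f g] by simp
  moreover have "(\<lambda>t. g (y(i := t))) field_differentiable at (y i)" if "y \<in> V" "i < n" for y i
  proof -
    have "(\<lambda>t. f (y(i := t))) field_differentiable at (y i)" using Suc.prems that by simp
    moreover have ev: "\<forall>\<^sub>F t in nhds (y i). f (y(i := t)) = g (y(i := t))"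
      using eventually_upd_in[OF assms(1) that] by eventually_elim (rule Suc.prems)
    ultimately show ?thesis
      unfolding field_differentiable_def using DERIV_cong_ev[OF refl ev refl] by simp
  qed
  moreover have "Ck_on n k V (pderiv_at i g)" if "i < n" for i
  proof (rule Suc.IH)
    show "pderiv_at i f z = pderiv_at i g z" if "z \<in> V" for z
      by (rule pderiv_at_cong[OF assms(1) that \<open>i < n\<close> Suc.prems(1)])
    show "Ck_on n k V (pderiv_at i f)" using Suc.prems(2) that by simp
  qed
  ultimately show ?case by simp
qed

lemma Ck_on_const: "Ck_on n k V (\<lambda>_. c)"
proof (induction k arbitrary: c)
  case (Suc k)
  have "pderiv_at i (\<lambda>_. c) = (\<lambda>_. 0)" for i by (auto simp: pderiv_at_def)
  then show ?case using Suc by simp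
qed simp

lemma continuous_on_coord: "continuous_on V (\<lambda>y::nat \<Rightarrow> real. y j)"
  by (rule continuous_on_subset[OF continuous_on_product_coordinates[of j]]) simp

lemma Ck_on_coord: "Ck_on n k V (\<lambda>y. y j)"
proof (cases k)
  case 0
  then show ?thesis by (simp add: continuous_on_coord)
next
  case (Suc k')
  have 1: "((\<lambda>t. (y(i := t)) j) has_field_derivative (if i = j then 1 else 0)) (at (y i))" for i and y :: "nat \<Rightarrow> real"
    by (auto intro!: derivative_eq_intros)
  then have 2: "pderiv_at i (\<lambda>y. y j) = (\<lambda>_. if i = j then 1 else 0)" for i
    unfolding pderiv_at_def using DERIV_imp_deriv by blast
  show ?thesis unfolding Suc using 1 2 by (auto simp: field_differentiable_def Ck_on_const continuous_on_coord)
qed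

lemma Ck_on_DERIV:
  assumes "Ck_on n (Suc k) V f" "y \<in> V" "i < n"
  shows "((\<lambda>t. f (y(i := t))) has_field_derivative pderiv_at i f y) (at (y i))"
  using assms DERIV_deriv_iff_field_differentiable unfolding pderiv_at_def by auto

text \<open>For functions whose derivatives are known as formulas on \<open>V\<close>: the values of
  \<open>pderiv_at\<close> elsewhere, which may be unspecified, never enter.\<close>

lemma Ck_on_SucI:
  assumes "openRn n V"
    and "\<And>y i. y \<in> V \<Longrightarrow> i < n \<Longrightarrow> ((\<lambda>t. f (y(i := t))) has_field_derivative D i y) (at (y i))"
    and "\<And>i. i < n \<Longrightarrow> Ck_on n k V (D i)" and "continuous_on V f"
  shows "Ck_on n (Suc k) V f"
proof -
  have "D i z = pderiv_at i f z" if "z \<in> V" "i < n" for i z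
    using assms(2)[OF that] unfolding pderiv_at_def by (metis DERIV_imp_deriv)
  then have "Ck_on n k V (pderiv_at i f)" if "i < n" for i
    using Ck_on_cong[OF assms(1) _ assms(3)[OF that]] that by blast
  moreover have "(\<lambda>t. f (y(i := t))) field_differentiable at (y i)" if "y \<in> V" "i < n" for y i
    using assms(2)[OF that] unfolding field_differentiable_def by (rule exI)
  ultimately show ?thesis using assms(4) unfolding Ck_on.simps by blast
qed

lemma Ck_on_add:
  assumes "openRn n V" "Ck_on n k V f" "Ck_on n k V g"
  shows "Ck_on n k V (\<lambda>y. f y + g y)"
  using assms(2,3)
proof (induction k arbitrary: f g)
  case (Suc k)
  show ?case
  proof (rule Ck_on_SucI[OF assms(1), where D = "\<lambda>i y. pderiv_at i f y + pderiv_at i g y"])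
    show "Ck_on n k V (\<lambda>y. pderiv_at i f y + pderiv_at i g y)" if "i < n" for i
      using Suc.prems that by (intro Suc.IH) simp_all
    show "continuous_on V (\<lambda>y. f y + g y)"
      using Suc.prems by (intro continuous_on_add) simp_all
  qed (intro DERIV_add Ck_on_DERIV[OF Suc.prems(1)] Ck_on_DERIV[OF Suc.prems(2)])
qed (auto intro: continuous_intros)

lemma Ck_on_mult:
  assumes "openRn n V" "Ck_on n k V f" "Ck_on n k V g"
  shows "Ck_on n k V (\<lambda>y. f y * g y)"
  using assms(2,3)
proof (induction k arbitrary: f g)
  case (Suc k)
  have 1: "((\<lambda>t. f (y(i := t)) * g (y(i := t))) has_field_derivative
      pderiv_at i f y * g y + f y * pderiv_at i g y) (at (y i))" if "y \<in> V" "i < n" for y i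
    using DERIV_mult[OF Ck_on_DERIV[OF Suc.prems(1) that] Ck_on_DERIV[OF Suc.prems(2) that]]
    unfolding fun_upd_triv by (simp only: mult.commute[of "pderiv_at i g y"])
  have 2: "Ck_on n k V f" "Ck_on n k V g" using Suc.prems Ck_on_Suc_D by blast+
  show ?case
  proof (rule Ck_on_SucI[OF assms(1) 1])
    show "Ck_on n k V (\<lambda>y. pderiv_at i f y * g y + f y * pderiv_at i g y)" if "i < n" for i
      using Suc.prems 2 that by (intro Ck_on_add[OF assms(1)] Suc.IH) simp_all
    show "continuous_on V (\<lambda>y. f y * g y)"
      using Suc.prems by (intro continuous_on_mult) simp_all
  qed
qed (auto intro: continuous_intros)

text \<open>Differentiability is a local property; this is the gluing used when functions are
  extended by zero.\<close>

lemma Ck_on_Un: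
  assumes "openRn n V" "openRn n W" "Ck_on n k V f" "Ck_on n k W f"
  shows "Ck_on n k (V \<union> W) f"
proof -
  have c: "continuous_on (V \<union> W) h" if "continuous_on V h" "continuous_on W h" for h :: "(nat \<Rightarrow> real) \<Rightarrow> real"
  proof (rule continuous_on_Un_local_open[OF _ _ that])
    show "openin (top_of_set (V \<union> W)) V" "openin (top_of_set (V \<union> W)) W"
      using assms(1,2) by (meson Un_upper1 Un_upper2 openin_subset_trans openin_imp_subset le_sup_iff)+
  qed
  show ?thesis using assms(3,4)
    by (induction k arbitrary: f) (auto intro: c)
qed

lemma smooth_Rn_Ck: "smooth_Rn n V f \<Longrightarrow> Ck_on n k V f"
  by (simp add: smooth_Rn_def)

lemma smooth_Rn_pderiv: "smooth_Rn n V f \<Longrightarrow> i < n \<Longrightarrow> smooth_Rn n V (pderiv_at i f)"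
  unfolding smooth_Rn_def by (metis Ck_on.simps(2))

lemma smooth_Rn_subset: "smooth_Rn n V f \<Longrightarrow> W \<subseteq> V \<Longrightarrow> smooth_Rn n W f"
  unfolding smooth_Rn_def using Ck_on_subset by blast
lemma smooth_Rn_cong: "openRn n V \<Longrightarrow> (\<And>z. z \<in> V \<Longrightarrow> f z = g z) \<Longrightarrow> smooth_Rn n V f \<Longrightarrow> smooth_Rn n V g"
  unfolding smooth_Rn_def using Ck_on_cong by blast
lemma smooth_Rn_const: "smooth_Rn n V (\<lambda>_. c)"
  unfolding smooth_Rn_def using Ck_on_const by blast
lemma smooth_Rn_coord: "smooth_Rn n V (\<lambda>y. y j)"
  unfolding smooth_Rn_def using Ck_on_coord by blast
lemma smooth_Rn_add: "openRn n V \<Longrightarrow> smooth_Rn n V f \<Longrightarrow> smooth_Rn n V g \<Longrightarrow> smooth_Rn n V (\<lambda>y. f y + g y)"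
  unfolding smooth_Rn_def using Ck_on_add by blast
lemma smooth_Rn_mult: "openRn n V \<Longrightarrow> smooth_Rn n V f \<Longrightarrow> smooth_Rn n V g \<Longrightarrow> smooth_Rn n V (\<lambda>y. f y * g y)"
  unfolding smooth_Rn_def using Ck_on_mult by blast
lemma smooth_Rn_uminus: "openRn n V \<Longrightarrow> smooth_Rn n V f \<Longrightarrow> smooth_Rn n V (\<lambda>y. - f y)"
  using smooth_Rn_mult[of n V "\<lambda>_. -1" f] smooth_Rn_const by simp
lemma smooth_Rn_Un: "openRn n V \<Longrightarrow> openRn n W \<Longrightarrow> smooth_Rn n V f \<Longrightarrow> smooth_Rn n W f \<Longrightarrow> smooth_Rn n (V \<union> W) f"
  unfolding smooth_Rn_def using Ck_on_Un by blast

section \<open>Rules for partial derivatives and symmetry of second derivatives\<close>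

lemma smooth_Rn_DERIV:
  "smooth_Rn n V f \<Longrightarrow> y \<in> V \<Longrightarrow> i < n \<Longrightarrow> ((\<lambda>t. f (y(i := t))) has_field_derivative pderiv_at i f y) (at (y i))"
  unfolding smooth_Rn_def using Ck_on_DERIV by blast

lemma pderiv_at_add:
  assumes "smooth_Rn n V f" "smooth_Rn n V g" "y \<in> V" "i < n"
  shows "pderiv_at i (\<lambda>y. f y + g y) y = pderiv_at i f y + pderiv_at i g y"
  using DERIV_add[OF smooth_Rn_DERIV[OF assms(1,3,4)] smooth_Rn_DERIV[OF assms(2,3,4)]]
  unfolding pderiv_at_def by (rule DERIV_imp_deriv)

lemma pderiv_at_mult:
  assumes "smooth_Rn n V f" "smooth_Rn n V g" "y \<in> V" "i < n"
  shows "pderiv_at i (\<lambda>y. f y * g y) y = pderiv_at i f y * g y + f y * pderiv_at i g y"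
  using DERIV_mult[OF smooth_Rn_DERIV[OF assms(1,3,4)] smooth_Rn_DERIV[OF assms(2,3,4)]]
  unfolding fun_upd_triv by (simp only: mult.commute[of "pderiv_at i g y"])
    (simp only: pderiv_at_def DERIV_imp_deriv)

text \<open>The mean value theorem twice: in direction \<open>i\<close> for the difference taken in
  direction \<open>j\<close>, then in direction \<open>j\<close> for the derivative so
  obtained.\<close>

lemma second_difference_mvt:
  assumes "smooth_Rn n V f" "i < n" "j < n" "i \<noteq> j" "h > 0"
    and in_V: "\<And>s t. y i \<le> s \<Longrightarrow> s \<le> y i + h \<Longrightarrow> y j \<le> t \<Longrightarrow> t \<le> y j + h \<Longrightarrow> y(i := s, j := t) \<in> V"
  shows "\<exists>s t. y i < s \<and> s < y i + h \<and> y j < t \<and> t < y j + h \<and>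
    f (y(i := y i + h, j := y j + h)) - f (y(i := y i + h)) - f (y(j := y j + h)) + f y
      = h * (h * pderiv_at j (pderiv_at i f) (y(i := s, j := t)))"
proof -
  define F where "F s t = f (y(i := s, j := t))" for s t
  define Fi where "Fi s t = pderiv_at i f (y(i := s, j := t))" for s t
  have Fi: "((\<lambda>s. F s t) has_field_derivative Fi s t) (at s)"
    if "y i \<le> s" "s \<le> y i + h" "y j \<le> t" "t \<le> y j + h" for s t
  proof -
    have "(y(i := s, j := t))(i := x) = y(i := x, j := t)" for x using assms(4) by (auto simp: fun_upd_def)
    then show ?thesis
      using smooth_Rn_DERIV[OF assms(1) in_V[OF that] assms(2)] assms(4) by (simp add: F_def Fi_def)
  qed
  have Fij: "((\<lambda>t. Fi s t) has_field_derivative pderiv_at j (pderiv_at i f) (y(i := s, j := t))) (at t)"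
    if "y i \<le> s" "s \<le> y i + h" "y j \<le> t" "t \<le> y j + h" for s t
    using smooth_Rn_DERIV[OF smooth_Rn_pderiv[OF assms(1,2)] in_V[OF that] assms(3)] by (simp add: Fi_def)
  have "\<exists>s>y i. s < y i + h \<and> (F (y i + h) (y j + h) - F (y i + h) (y j)) - (F (y i) (y j + h) - F (y i) (y j)) =
      (y i + h - y i) * (Fi s (y j + h) - Fi s (y j))"
    by (rule MVT2) (use assms(5) in \<open>auto intro!: DERIV_diff Fi\<close>)
  then obtain s where s: "y i < s" "s < y i + h" and 1:
    "(F (y i + h) (y j + h) - F (y i + h) (y j)) - (F (y i) (y j + h) - F (y i) (y j)) = h * (Fi s (y j + h) - Fi s (y j))"
    by auto
  have "\<exists>t>y j. t < y j + h \<and> Fi s (y j + h) - Fi s (y j) = (y j + h - y j) * pderiv_at j (pderiv_at i f) (y(i := s, j := t))"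
    by (rule MVT2) (use assms(5) s in \<open>auto intro!: Fij\<close>)
  then obtain t where t: "y j < t" "t < y j + h" and 2:
    "Fi s (y j + h) - Fi s (y j) = h * pderiv_at j (pderiv_at i f) (y(i := s, j := t))" by auto
  have "y(i := x, j := y j) = y(i := x)" for x using assms(4) by (auto simp: fun_upd_def)
  then have "f (y(i := y i + h, j := y j + h)) - f (y(i := y i + h)) - f (y(j := y j + h)) + f y =
     (F (y i + h) (y j + h) - F (y i + h) (y j)) - (F (y i) (y j + h) - F (y i) (y j))"
    by (simp add: F_def)
  then show ?thesis using s t 1 2 by metis
qed

text \<open>The second difference does not change when \<open>i\<close> and \<open>j\<close> are
  exchanged, so on every small square the two mixed derivatives share a value, attained at possibly
  different points. By continuity they agree at the corner.\<close>

lemma pderiv_at_commute: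
  assumes V: "openRn n V" "y \<in> V" and f: "smooth_Rn n V f" and ij: "i < n" "j < n"
  shows "pderiv_at i (pderiv_at j f) y = pderiv_at j (pderiv_at i f) y"
proof (cases "i = j")
  case False
  define A where "A = pderiv_at j (pderiv_at i f)"
  define B where "B = pderiv_at i (pderiv_at j f)"
  define u where "u p = y(i := fst p, j := snd p)" for p :: "real \<times> real"
  obtain T where T: "open T" "V = Rn n \<inter> T" using V(1) by (auto simp: openin_open)
  have "open (u -` T)"
    unfolding u_def using T(1) continuous_on_upd2 by (rule open_vimage)
  have uV: "u p \<in> V" if "p \<in> u -` T" for p
    using that V(2) ij T(2) by (auto simp: u_def Rn_def)
  have u0: "u (y i, y j) = y" by (auto simp: u_def)
  have p0: "(y i, y j) \<in> u -` T" using V(2) T(2) u0 by auto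
  have cont: "continuous_on V A" "continuous_on V B"
    using f ij by (auto simp: A_def B_def intro!: Ck_on_continuous[of n 0] smooth_Rn_Ck smooth_Rn_pderiv)
  have cu: "continuous_on (u -` T) u"
    unfolding u_def using continuous_on_upd2 continuous_on_subset by blast
  have uT: "u ` (u -` T) \<subseteq> V" using uV by blast
  have "continuous_on (u -` T) (\<lambda>p. A (u p))"
    by (rule continuous_on_compose2[OF cont(1) cu uT])
  moreover have "continuous_on (u -` T) (\<lambda>p. B (u p))"
    by (rule continuous_on_compose2[OF cont(2) cu uT])
  ultimately have isC: "isCont (\<lambda>p. A (u p)) (y i, y j)" "isCont (\<lambda>p. B (u p)) (y i, y j)"
    using \<open>open (u -` T)\<close> p0 by (simp_all add: continuous_on_eq_continuous_at)
  have "A y = B y"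
  proof (rule ccontr)
    assume "A y \<noteq> B y"
    \<comment> \<open>Half the gap: a common value within \<open>e\<close> of both numbers would
      contradict their distance \<open>2 * e\<close>.\<close>
    define e where "e = \<bar>A y - B y\<bar> / 2"
    have "e > 0" using \<open>A y \<noteq> B y\<close> by (simp add: e_def)
    have "\<forall>\<^sub>F p in nhds (y i, y j). dist (A (u p)) (A y) < e"
      using isC(1) \<open>e > 0\<close> u0 unfolding isCont_def tendsto_iff by (auto simp: eventually_nhds_conv_at)
    moreover have "\<forall>\<^sub>F p in nhds (y i, y j). dist (B (u p)) (B y) < e"
      using isC(2) \<open>e > 0\<close> u0 unfolding isCont_def tendsto_iff by (auto simp: eventually_nhds_conv_at)
    moreover have "\<forall>\<^sub>F p in nhds (y i, y j). p \<in> u -` T"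
      using \<open>open (u -` T)\<close> p0 by (rule eventually_nhds_in_open)
    ultimately have "\<forall>\<^sub>F p in nhds (y i, y j). dist (A (u p)) (A y) < e \<and> dist (B (u p)) (B y) < e \<and> p \<in> u -` T"
      by eventually_elim simp
    then obtain \<delta> where \<delta>: "\<delta> > 0" "\<And>p. dist p (y i, y j) < \<delta> \<Longrightarrow> dist (A (u p)) (A y) < e \<and> dist (B (u p)) (B y) < e \<and> p \<in> u -` T"
      unfolding eventually_nhds_metric by blast
    \<comment> \<open>The square of side \<open>h\<close> then lies within distance
      \<open>2 * h < \<delta>\<close> of its corner.\<close>
    define h where "h = \<delta> / 4"
    have h: "h > 0" using \<delta>(1) by (simp add: h_def)
    have near: "dist (s, t) (y i, y j) < \<delta>" if "y i \<le> s" "s \<le> y i + h" "y j \<le> t" "t \<le> y j + h" for s t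
    proof -
      have "dist (s, t) (y i, y j) \<le> \<bar>s - y i\<bar> + \<bar>t - y j\<bar>"
        by (simp add: dist_Pair_Pair dist_real_def sqrt_sum_squares_le_sum_abs)
      also have "\<dots> \<le> h + h" using that by auto
      also have "\<dots> < \<delta>" using \<delta>(1) by (simp add: h_def)
      finally show ?thesis .
    qed
    have inV: "y(i := s, j := t) \<in> V" if "y i \<le> s" "s \<le> y i + h" "y j \<le> t" "t \<le> y j + h" for s t
      using uV[of "(s, t)"] \<delta>(2)[OF near[OF that]] by (simp add: u_def)
    let ?\<Delta> = "f (y(i := y i + h, j := y j + h)) - f (y(i := y i + h)) - f (y(j := y j + h)) + f y"
    obtain s t where st: "y i < s" "s < y i + h" "y j < t" "t < y j + h" "?\<Delta> = h * (h * A (u (s, t)))"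
      using second_difference_mvt[OF f ij False h inV] unfolding A_def u_def by auto
    have swap: "y(j := t, i := s) = y(i := s, j := t)" for s t using False by (auto simp: fun_upd_def)
    have inV': "y(j := t, i := s) \<in> V" if "y j \<le> t" "t \<le> y j + h" "y i \<le> s" "s \<le> y i + h" for s t
      using inV[OF that(3,4,1,2)] by (simp only: swap)
    obtain s' t' where st': "y i < s'" "s' < y i + h" "y j < t'" "t' < y j + h" "?\<Delta> = h * (h * B (u (s', t')))"
      using second_difference_mvt[OF f ij(2,1) False[symmetric] h inV'] unfolding B_def u_def by (auto simp: swap algebra_simps)
    have "A (u (s, t)) = B (u (s', t'))" using st(5) st'(5) h by simp
    moreover have "dist (A (u (s, t))) (A y) < e" "dist (B (u (s', t'))) (B y) < e"
      using \<delta>(2)[OF near] st(1-4) st'(1-4) by (auto simp: less_imp_le)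
    ultimately show False unfolding e_def dist_real_def by (simp add: abs_if split: if_splits)
  qed
  then show ?thesis by (simp add: A_def B_def)
qed simp

section \<open>A flat function and compact boxes\<close>

definition flat :: "nat \<Rightarrow> real \<Rightarrow> real" where
  "flat k t = (if t > 0 then (1 / t) ^ k * exp (- (1 / t)) else 0)"

lemma flat_tendsto_0: "(flat k \<longlongrightarrow> 0) (at 0)"
proof -
  have "((\<lambda>u::real. u ^ k / exp u) \<longlongrightarrow> 0) at_top" for k
    by (rule tendsto_power_div_exp_0)
  then have "((\<lambda>t. (inverse t) ^ k / exp (inverse t)) \<longlongrightarrow> 0) (at_right (0::real))"
    using filterlim_inverse_at_top_right by (rule filterlim_compose)
  then have "(flat k \<longlongrightarrow> 0) (at_right 0)"
    by (rule Lim_transform_eventually)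
      (auto simp: eventually_at_right_less flat_def exp_minus divide_simps intro!: eventually_at_rightI[of 0 1])
  moreover have "(flat k \<longlongrightarrow> 0) (at_left 0)"
    by (rule Lim_transform_eventually[OF tendsto_const])
      (auto simp: flat_def intro!: eventually_at_leftI[of "-1" 0])
  ultimately show ?thesis by (simp add: filterlim_split_at)
qed

text \<open>The factors \<open>(1 / t) ^ k\<close> make the family closed under differentiation, so
  smoothness of \<open>flat 0\<close> follows from one induction for all \<open>k\<close> at
  once.\<close>

lemma DERIV_flat: "(flat k has_field_derivative (- real k * flat (Suc k) t + flat (Suc (Suc k)) t)) (at t)"
proof -
  consider "t > 0" | "t < 0" | "t = 0" by linarith
  then show ?thesis
  proof cases
    case 1
    have "((\<lambda>t. (1 / t) ^ k * exp (- (1 / t))) has_field_derivative (- real k * flat (Suc k) t + flat (Suc (Suc k)) t)) (at t)"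
    proof -
      define u where "u = 1 / t"
      have du: "((\<lambda>t. 1 / t) has_field_derivative - (u ^ 2)) (at t)"
        using 1 unfolding u_def by (auto intro!: derivative_eq_intros simp: power2_eq_square)
      have "((\<lambda>t. (1 / t) ^ k * exp (- (1 / t))) has_field_derivative
          (real k * (- (u ^ 2) * u ^ (k - Suc 0))) * exp (- u) + exp (- u) * - (- (u ^ 2)) * u ^ k) (at t)"
        using DERIV_mult[OF DERIV_power[OF du, of k] DERIV_fun_exp[OF DERIV_minus[OF du]]]
        unfolding u_def .
      moreover have "(real k * (- (u ^ 2) * u ^ (k - Suc 0))) * exp (- u) + exp (- u) * - (- (u ^ 2)) * u ^ k =
          - real k * (u ^ Suc k * exp (- u)) + u ^ Suc (Suc k) * exp (- u)"
        by (cases k) (simp_all add: power2_eq_square algebra_simps)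
      ultimately show ?thesis
        using 1 unfolding flat_def u_def by simp
    qed
    moreover have "\<forall>\<^sub>F x in nhds t. (1 / x) ^ k * exp (- (1 / x)) = flat k x"
      using eventually_nhds_in_open[of "{0<..}" t] 1 by (auto simp: flat_def elim: eventually_mono)
    ultimately show ?thesis using DERIV_cong_ev[OF refl _ refl] by fast
  next
    case 2
    have "((\<lambda>t. 0) has_field_derivative 0) (at t)" by simp
    moreover have "\<forall>\<^sub>F x in nhds t. 0 = flat k x"
      using eventually_nhds_in_open[of "{..<0}" t] 2 by (auto simp: flat_def elim!: eventually_mono)
    ultimately have "(flat k has_field_derivative 0) (at t)" using DERIV_cong_ev[OF refl _ refl] by fast
    then show ?thesis using 2 by (simp add: flat_def)
  next
    case 3
    \<comment> \<open>At 0 the difference quotient is again a member of the family, and the members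
      tend to 0.\<close>
    have "flat k h / h = flat (Suc k) h" for h
      by (simp add: flat_def)
    moreover have "flat j 0 = 0" for j by (simp add: flat_def)
    ultimately show ?thesis using flat_tendsto_0[of "Suc k"] 3 by (simp add: DERIV_def)
  qed
qed

lemma Ck_on_flat:
  assumes "openRn n V" "Ck_on n j V F"
  shows "Ck_on n j V (\<lambda>y. flat k (F y))"
  using assms(2)
proof (induction j arbitrary: k)
  case 0
  have "continuous_on UNIV (flat k)"
    by (intro continuous_at_imp_continuous_on ballI DERIV_isCont[OF DERIV_flat])
  then show ?case using 0 by (auto intro: continuous_on_compose2)
next
  case (Suc j)
  have "continuous_on UNIV (flat k)"
    by (intro continuous_at_imp_continuous_on ballI DERIV_isCont[OF DERIV_flat])
  then have c: "continuous_on V (\<lambda>y. flat k (F y))" using Suc.prems by (auto intro: continuous_on_compose2)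
  have F: "Ck_on n j V F" using Suc.prems by (rule Ck_on_Suc_D)
  have D: "((\<lambda>t. flat k (F (y(i := t)))) has_field_derivative
      (- real k * flat (Suc k) (F y) + flat (Suc (Suc k)) (F y)) * pderiv_at i F y) (at (y i))"
    if "y \<in> V" "i < n" for y i
    using DERIV_chain2[OF DERIV_flat[of k] Ck_on_DERIV[OF Suc.prems that]] by (simp only: fun_upd_triv)
  show ?case
  proof (rule Ck_on_SucI[OF assms(1) D _ c])
    fix i assume "i < n"
    then have "Ck_on n j V (pderiv_at i F)" using Suc.prems by simp
    then show "Ck_on n j V (\<lambda>y. (- real k * flat (Suc k) (F y) + flat (Suc (Suc k)) (F y)) * pderiv_at i F y)"
      by (intro Ck_on_mult[OF assms(1)] Ck_on_add[OF assms(1)] Ck_on_const Suc.IH F)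
  qed
qed

lemma smooth_Rn_flat: "openRn n V \<Longrightarrow> smooth_Rn n V F \<Longrightarrow> smooth_Rn n V (\<lambda>y. flat k (F y))"
  unfolding smooth_Rn_def using Ck_on_flat by blast

text \<open>Tychonoff for a product of closed intervals in the directions below \<open>n\<close> and
  of singletons \<open>{0}\<close> beyond.\<close>

lemma compact_box_Rn:
  "compact {y \<in> Rn n. \<forall>i<n. \<bar>y i - a i\<bar> \<le> e}"
proof -
  define B where "B i = (if i < n then {a i - e..a i + e} else {0})" for i
  have "compactin (product_topology (\<lambda>i. euclidean) UNIV) (PiE UNIV B)"
    by (subst compactin_PiE) (auto simp: B_def)
  then have "compact (PiE UNIV B)" by (simp add: euclidean_product_topology)
  moreover have "PiE UNIV B = {y \<in> Rn n. \<forall>i<n. \<bar>y i - a i\<bar> \<le> e}"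
    by (auto simp: B_def Rn_def PiE_iff abs_le_iff split: if_splits) (smt (verit))+
  ultimately show ?thesis by simp
qed

text \<open>A basic open set of the product topology contains a neighbourhood in each coordinate.
  From \<open>n\<close> on all points of \<open>Rn n\<close> agree with \<open>a\<close>, so only
  the finitely many radii below \<open>n\<close> matter.\<close>

lemma box_in_openRn:
  assumes "openRn n V" "a \<in> V"
  obtains e where "e > 0" "{y \<in> Rn n. \<forall>i<n. \<bar>y i - a i\<bar> \<le> e} \<subseteq> V"
proof -
  obtain T where T: "open T" "V = Rn n \<inter> T" using assms(1) by (auto simp: openin_open)
  have "openin (product_topology (\<lambda>i::nat. euclidean :: real topology) UNIV) T"
    using T(1) by (simp add: euclidean_product_topology)
  moreover have "a \<in> T" using assms(2) T(2) by simp
  ultimately obtain X where X: "a \<in> PiE UNIV X" "\<And>i. open (X i)" "finite {i. X i \<noteq> UNIV}" "PiE UNIV X \<subseteq> T"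
    using product_topology_open_contains_basis[of "\<lambda>i. euclidean" UNIV T a] by auto
  have "\<exists>e>0. \<forall>t. \<bar>t - a i\<bar> \<le> e \<longrightarrow> t \<in> X i" for i
  proof -
    have "a i \<in> X i" using X(1) by auto
    then obtain e where "e > 0" "cball (a i) e \<subseteq> X i" using X(2) open_contains_cball by blast
    then show ?thesis by (intro exI[of _ e]) (auto simp: subset_iff dist_real_def abs_minus_commute)
  qed
  then obtain E where E: "\<And>i. E i > 0" "\<And>i t. \<bar>t - a i\<bar> \<le> E i \<Longrightarrow> t \<in> X i" by metis
  \<comment> \<open>The extra 1 keeps the minimum meaningful for \<open>n = 0\<close>.\<close>
  define e where "e = Min (insert 1 (E ` {..<n}))"
  have "e > 0" unfolding e_def using E(1) by (subst Min_gr_iff) auto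
  moreover have "e \<le> E i" if "i < n" for i unfolding e_def using that by (intro Min_le) auto
  ultimately show ?thesis
  proof (intro that subsetI)
    fix y assume *: "\<And>i. i < n \<Longrightarrow> e \<le> E i" and "y \<in> {y \<in> Rn n. \<forall>i<n. \<bar>y i - a i\<bar> \<le> e}"
    then have y: "y \<in> Rn n" "\<And>i. i < n \<Longrightarrow> \<bar>y i - a i\<bar> \<le> e" by auto
    have "y i \<in> X i" for i
    proof (cases "i < n")
      case True
      then show ?thesis using E(2)[of "y i" i] y(2)[of i] *[of i] by simp
    next
      case False
      have "a \<in> Rn n" using assms(2) T(2) by simp
      then have "y i = a i" using False y(1) by (simp add: Rn_def)
      then show ?thesis using X(1) by (auto simp: PiE_iff)
    qed
    then show "y \<in> V" using X(4) y(1) T(2) by (auto simp: PiE_iff)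
  qed
qed

section \<open>Bump functions and frames\<close>

locale vbundle_ctx =
  fixes A :: "('m::{t2_space, second_countable_topology}, 'v::real_vector) vbundle"
  assumes vb: "vector_bundle A"
begin

abbreviation "nn \<equiv> base_dim A"
abbreviation "rk \<equiv> bundle_rank A"

section \<open>Charts and smooth functions on the base\<close>

lemma chart:
  assumes "(U, \<phi>) \<in> charts A"
  shows "open U" "openRn nn (\<phi> ` U)" "\<exists>\<psi>. homeomorphism U (\<phi> ` U) \<phi> \<psi>"
proof -
  have "smooth_atlas nn (charts A)" using vb unfolding vector_bundle_def by (elim conjE)
  then have "\<forall>(U, \<phi>)\<in>charts A. open U \<and> openRn nn (\<phi> ` U) \<and> (\<exists>\<psi>. homeomorphism U (\<phi> ` U) \<phi> \<psi>)"
    unfolding smooth_atlas_def by (elim conjE)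
  from bspec[OF this assms] show "open U" "openRn nn (\<phi> ` U)" "\<exists>\<psi>. homeomorphism U (\<phi> ` U) \<phi> \<psi>"
    by simp_all
qed

lemma chart_transition:
  assumes "(U, \<phi>) \<in> charts A" "(U', \<phi>') \<in> charts A" "i < nn"
  shows "smooth_Rn nn (\<phi> ` (U \<inter> U')) (\<lambda>y. \<phi>' (inv_into U \<phi> y) i)"
proof -
  have "smooth_atlas nn (charts A)" using vb unfolding vector_bundle_def by (elim conjE)
  then have "\<forall>(U, \<phi>)\<in>charts A. \<forall>(U', \<phi>')\<in>charts A. \<forall>i<nn.
        smooth_Rn nn (\<phi> ` (U \<inter> U')) (\<lambda>y. \<phi>' (inv_into U \<phi> y) i)"
    unfolding smooth_atlas_def by (elim conjE)
  from bspec[OF this assms(1)] have "\<forall>(U', \<phi>')\<in>charts A. \<forall>i<nn.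
        smooth_Rn nn (\<phi> ` (U \<inter> U')) (\<lambda>y. \<phi>' (inv_into U \<phi> y) i)" by simp
  from bspec[OF this assms(2)] show ?thesis using assms(3) by simp
qed

lemma chart_inj: "(U, \<phi>) \<in> charts A \<Longrightarrow> inj_on \<phi> U"
  using chart(3) homeomorphism_apply1 by (metis inj_on_inverseI)

lemma chart_inv: "(U, \<phi>) \<in> charts A \<Longrightarrow> x \<in> U \<Longrightarrow> inv_into U \<phi> (\<phi> x) = x"
  by (simp add: chart_inj)

lemma chart_openRn:
  assumes c: "(U, \<phi>) \<in> charts A" and "open W"
  shows "openRn nn (\<phi> ` (U \<inter> W))"
proof -
  obtain \<psi> where "homeomorphism U (\<phi> ` U) \<phi> \<psi>" using chart(3)[OF c] by blast
  moreover have "openin (top_of_set U) (U \<inter> W)" using assms(2) by (rule openin_open_Int)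
  ultimately have "openin (top_of_set (\<phi> ` U)) (\<phi> ` (U \<inter> W))" by (rule homeomorphism_imp_open_map)
  then show ?thesis using chart(2)[OF c] by (rule openin_trans)
qed

lemma chart_inv_continuous:
  assumes c: "(U, \<phi>) \<in> charts A"
  shows "continuous_on (\<phi> ` U) (inv_into U \<phi>)"
proof -
  obtain \<psi> where h: "homeomorphism U (\<phi> ` U) \<phi> \<psi>" using chart(3)[OF c] by blast
  then have "\<psi> y = inv_into U \<phi> y" if "y \<in> \<phi> ` U" for y
    using that chart_inj[OF c] by (auto simp: homeomorphism_apply1)
  then show ?thesis using homeomorphism_cont2[OF h] continuous_on_cong by (metis (no_types, lifting))
qed

lemma smooth_on_base_D:
  "smooth_on_base A W f \<Longrightarrow> (U, \<phi>) \<in> charts A \<Longrightarrow> smooth_Rn nn (\<phi> ` (U \<inter> W)) (f \<circ> inv_into U \<phi>)"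
  unfolding smooth_on_base_def by blast

lemma smooth_on_base_I:
  "(\<And>U \<phi>. (U, \<phi>) \<in> charts A \<Longrightarrow> smooth_Rn nn (\<phi> ` (U \<inter> W)) (f \<circ> inv_into U \<phi>)) \<Longrightarrow> smooth_on_base A W f"
  unfolding smooth_on_base_def by blast

lemma smooth_on_base_subset: "smooth_on_base A W f \<Longrightarrow> W' \<subseteq> W \<Longrightarrow> smooth_on_base A W' f"
  by (rule smooth_on_base_I, rule smooth_Rn_subset, erule (1) smooth_on_base_D) blast

lemma smooth_on_base_cong:
  assumes "open W" "\<And>x. x \<in> W \<Longrightarrow> f x = g x" "smooth_on_base A W f"
  shows "smooth_on_base A W g"
proof (rule smooth_on_base_I)
  fix U \<phi> assume c: "(U, \<phi>) \<in> charts A"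
  show "smooth_Rn nn (\<phi> ` (U \<inter> W)) (g \<circ> inv_into U \<phi>)"
    by (rule smooth_Rn_cong[OF chart_openRn[OF c assms(1)] _ smooth_on_base_D[OF assms(3) c]])
      (auto simp: chart_inv[OF c] assms(2))
qed

lemma smooth_on_base_Un:
  assumes "open W" "open W'" "smooth_on_base A W f" "smooth_on_base A W' f"
  shows "smooth_on_base A (W \<union> W') f"
proof (rule smooth_on_base_I)
  fix U \<phi> assume c: "(U, \<phi>) \<in> charts A"
  have "\<phi> ` (U \<inter> (W \<union> W')) = \<phi> ` (U \<inter> W) \<union> \<phi> ` (U \<inter> W')" by blast
  then show "smooth_Rn nn (\<phi> ` (U \<inter> (W \<union> W'))) (f \<circ> inv_into U \<phi>)"
    using smooth_Rn_Un[OF chart_openRn[OF c assms(1)] chart_openRn[OF c assms(2)]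
        smooth_on_base_D[OF assms(3) c] smooth_on_base_D[OF assms(4) c]] by simp
qed

lemma smooth_on_base_const: "smooth_on_base A W (\<lambda>_. k)"
  by (rule smooth_on_base_I) (simp add: comp_def smooth_Rn_const)

lemma smooth_on_base_add:
  assumes "open W" "smooth_on_base A W f" "smooth_on_base A W g"
  shows "smooth_on_base A W (\<lambda>x. f x + g x)"
  using smooth_Rn_add[OF chart_openRn[OF _ assms(1)] smooth_on_base_D[OF assms(2)] smooth_on_base_D[OF assms(3)]]
  by (intro smooth_on_base_I) (simp add: comp_def)

lemma smooth_on_base_mult:
  assumes "open W" "smooth_on_base A W f" "smooth_on_base A W g"
  shows "smooth_on_base A W (\<lambda>x. f x * g x)"
  using smooth_Rn_mult[OF chart_openRn[OF _ assms(1)] smooth_on_base_D[OF assms(2)] smooth_on_base_D[OF assms(3)]]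
  by (intro smooth_on_base_I) (simp add: comp_def)

lemma smooth_on_base_uminus:
  assumes "open W" "smooth_on_base A W f"
  shows "smooth_on_base A W (\<lambda>x. - f x)"
  using smooth_on_base_mult[OF assms(1) smooth_on_base_const[of _ "-1"] assms(2)] by simp

lemma smooth_on_base_diff:
  assumes "open W" "smooth_on_base A W f" "smooth_on_base A W g"
  shows "smooth_on_base A W (\<lambda>x. f x - g x)"
  using smooth_on_base_add[OF assms(1,2) smooth_on_base_uminus[OF assms(1,3)]] by simp

lemma smooth_on_base_sum:
  assumes "open W" "\<And>i. i \<in> I \<Longrightarrow> smooth_on_base A W (f i)"
  shows "smooth_on_base A W (\<lambda>x. \<Sum>i\<in>I. f i x)"
  using assms(2) by (induction I rule: infinite_finite_induct) (auto simp: smooth_on_base_const smooth_on_base_add[OF assms(1)])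

lemma smooth_on_base_flat:
  assumes "open W" "smooth_on_base A W f"
  shows "smooth_on_base A W (\<lambda>x. flat k (f x))"
  using smooth_Rn_flat[OF chart_openRn[OF _ assms(1)] smooth_on_base_D[OF assms(2)]]
  by (intro smooth_on_base_I) (simp add: comp_def)

lemma smooth_on_base_coord:
  assumes "(U, \<phi>) \<in> charts A" "j < nn"
  shows "smooth_on_base A U (\<lambda>x. \<phi> x j)"
  using chart_transition[OF _ assms] by (intro smooth_on_base_I) (simp add: comp_def)

text \<open>The open sets \<open>U\<close> and \<open>- K\<close> cover the base, and the function
  vanishes on the second.\<close>

lemma smooth_on_base_extend_zero:
  assumes "open U" "closed K" "K \<subseteq> U" "smooth_on_base A U f" "\<And>x. x \<notin> K \<Longrightarrow> f x = 0" "open W"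
  shows "smooth_on_base A W f"
proof -
  have "smooth_on_base A (- K) f"
    by (rule smooth_on_base_cong[OF _ _ smooth_on_base_const[of _ 0]]) (use assms in auto)
  then have "smooth_on_base A (U \<union> - K) f" using assms by (intro smooth_on_base_Un) auto
  then show ?thesis by (rule smooth_on_base_subset) (use assms(3) in blast)
qed

text \<open>The function is the flat function of \<open>e\<^sup>2\<close> minus the squared distance
  to \<open>x\<close> in the chart. The round ball where it is positive lies in a compact box; the
  preimage of the box is compact, hence closed because the base is Hausdorff, so extension by zero
  is smooth.\<close>

lemma bump:
  assumes c: "(U, \<phi>) \<in> charts A" and W: "open W" "W \<subseteq> U" "x \<in> W"
  obtains h :: "'m \<Rightarrow> real" and K where "closed K" "K \<subseteq> W" "\<And>z. z \<notin> K \<Longrightarrow> h z = 0" "h x = 1"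
    "smooth_on_base A UNIV h"
proof -
  have UW: "U \<inter> W = W" using W by blast
  have o: "openRn nn (\<phi> ` W)" using chart_openRn[OF c W(1)] by (simp add: UW)
  obtain e where e: "e > 0" "{y \<in> Rn nn. \<forall>i<nn. \<bar>y i - \<phi> x i\<bar> \<le> e} \<subseteq> \<phi> ` W"
    using box_in_openRn[OF o, of "\<phi> x"] W(3) by blast
  define B where "B = {y \<in> Rn nn. \<forall>i<nn. \<bar>y i - \<phi> x i\<bar> \<le> e}"
  define K where "K = inv_into U \<phi> ` B"
  have BU: "B \<subseteq> \<phi> ` W" using e(2) by (simp add: B_def)
  have "compact K" unfolding K_def
    using compact_box_Rn[of nn "\<phi> x" e] BU W(2) unfolding B_def[symmetric]
    by (intro compact_continuous_image continuous_on_subset[OF chart_inv_continuous[OF c]]) auto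
  then have K1: "closed K" by (rule compact_imp_closed)
  have K2: "K \<subseteq> W" using BU W(2) chart_inv[OF c] unfolding K_def by fastforce
  define F where "F z = e\<^sup>2 - (\<Sum>i<nn. (\<phi> z i - \<phi> x i) * (\<phi> z i - \<phi> x i))" for z
  \<comment> \<open>The divisor \<open>flat 0 (e\<^sup>2)\<close> is the value at \<open>x\<close>
    before normalisation.\<close>
  define h where "h z = (if z \<in> U then flat 0 (F z) * (1 / flat 0 (e\<^sup>2)) else 0)" for z
  have "smooth_on_base A U F" unfolding F_def
    by (intro smooth_on_base_diff smooth_on_base_const smooth_on_base_sum smooth_on_base_mult smooth_on_base_coord[OF c] chart(1)[OF c]) auto
  then have "smooth_on_base A U (\<lambda>z. flat 0 (F z) * (1 / flat 0 (e\<^sup>2)))"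
    by (intro smooth_on_base_mult smooth_on_base_flat smooth_on_base_const chart(1)[OF c])
  then have sU: "smooth_on_base A U h"
    by (rule smooth_on_base_cong[OF chart(1)[OF c], rotated]) (simp add: h_def)
  have z: "h z = 0" if "z \<notin> K" for z
  proof (cases "z \<in> U")
    case True
    have "\<phi> z \<in> Rn nn" using chart(2)[OF c] True openin_imp_subset by blast
    moreover have "\<phi> z \<notin> B" using that True chart_inv[OF c True] unfolding K_def by force
    ultimately obtain i where i: "i < nn" "\<bar>\<phi> z i - \<phi> x i\<bar> > e" unfolding B_def by force
    have "e\<^sup>2 < \<bar>\<phi> z i - \<phi> x i\<bar>\<^sup>2" using i e(1) by (intro power_strict_mono) auto
    also have "\<dots> = (\<phi> z i - \<phi> x i) * (\<phi> z i - \<phi> x i)" by (simp add: power2_eq_square)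
    also have "\<dots> \<le> (\<Sum>i<nn. (\<phi> z i - \<phi> x i) * (\<phi> z i - \<phi> x i))"
      using i by (intro member_le_sum) auto
    finally show ?thesis by (simp add: h_def flat_def F_def)
  qed (simp add: h_def)
  have "h x = 1" using W e(1) by (auto simp: h_def F_def flat_def)
  moreover have "smooth_on_base A UNIV h"
    using K2 W(2) by (intro smooth_on_base_extend_zero[OF chart(1)[OF c] K1 _ sU z]) auto
  ultimately show ?thesis using that K1 K2 z by blast
qed

section \<open>Frames and coframes\<close>

lemma frame:
  assumes "(V, e) \<in> frames A"
  shows "open V"
    and "x \<in> V \<Longrightarrow> inj_on (\<lambda>\<alpha>. e \<alpha> x) {..<rk}"
    and "x \<in> V \<Longrightarrow> independent ((\<lambda>\<alpha>. e \<alpha> x) ` {..<rk})"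
    and "x \<in> V \<Longrightarrow> span ((\<lambda>\<alpha>. e \<alpha> x) ` {..<rk}) = fibre A x"
proof -
  have "\<forall>(V, e)\<in>frames A. open V \<and>
        (\<forall>x\<in>V. inj_on (\<lambda>\<alpha>. e \<alpha> x) {..<rk} \<and> independent ((\<lambda>\<alpha>. e \<alpha> x) ` {..<rk}) \<and>
               span ((\<lambda>\<alpha>. e \<alpha> x) ` {..<rk}) = fibre A x)"
    using vb unfolding vector_bundle_def by (elim conjE)
  from bspec[OF this assms] show "open V" "x \<in> V \<Longrightarrow> inj_on (\<lambda>\<alpha>. e \<alpha> x) {..<rk}"
    "x \<in> V \<Longrightarrow> independent ((\<lambda>\<alpha>. e \<alpha> x) ` {..<rk})" "x \<in> V \<Longrightarrow> span ((\<lambda>\<alpha>. e \<alpha> x) ` {..<rk}) = fibre A x"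
    by simp_all
qed

lemma frame_transition:
  assumes "(V, e) \<in> frames A" "(V', e') \<in> frames A" "\<alpha> < rk" "\<beta> < rk"
  shows "smooth_on_base A (V \<inter> V') (\<lambda>x. coframe A e' \<alpha> x (e \<beta> x))"
proof -
  have "\<forall>(V, e)\<in>frames A. \<forall>(V', e')\<in>frames A. \<forall>\<alpha><rk. \<forall>\<beta><rk.
        smooth_on_base A (V \<inter> V') (\<lambda>x. coframe A e' \<alpha> x (e \<beta> x))"
    using vb unfolding vector_bundle_def by (elim conjE)
  from bspec[OF this assms(1)] have "\<forall>(V', e')\<in>frames A. \<forall>\<alpha><rk. \<forall>\<beta><rk.
        smooth_on_base A (V \<inter> V') (\<lambda>x. coframe A e' \<alpha> x (e \<beta> x))" by simp
  from bspec[OF this assms(2)] show ?thesis using assms(3,4) by simp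
qed

lemma fibre_subspace: "subspace (fibre A x)"
  using vb unfolding vector_bundle_def by (elim conjE) (rule spec)

lemma fibre_0 [simp]: "0 \<in> fibre A x"
  and fibre_add [simp]: "v \<in> fibre A x \<Longrightarrow> w \<in> fibre A x \<Longrightarrow> v + w \<in> fibre A x"
  and fibre_scale [simp]: "v \<in> fibre A x \<Longrightarrow> s *\<^sub>R v \<in> fibre A x"
  using fibre_subspace[of x] by (auto simp: subspace_0 subspace_add subspace_scale)

lemma fibre_sum: "(\<And>i. i \<in> I \<Longrightarrow> f i \<in> fibre A x) \<Longrightarrow> sum f I \<in> fibre A x"
  using fibre_subspace by (rule subspace_sum)

context
  fixes V e x
  assumes fr: "(V, e) \<in> frames A" and x: "x \<in> V"
begin

lemma frame_in_fibre: "\<alpha> < rk \<Longrightarrow> e \<alpha> x \<in> fibre A x"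
proof -
  assume "\<alpha> < rk"
  then have "e \<alpha> x \<in> span ((\<lambda>\<alpha>. e \<alpha> x) ` {..<rk})" by (intro span_base) simp
  then show ?thesis by (simp only: frame(4)[OF fr x])
qed

lemma coframe_frame: "\<alpha> < rk \<Longrightarrow> \<beta> < rk \<Longrightarrow> coframe A e \<alpha> x (e \<beta> x) = (if \<alpha> = \<beta> then 1 else 0)"
proof -
  assume a: "\<alpha> < rk" "\<beta> < rk"
  have "coframe A e \<alpha> x (e \<beta> x) = (if e \<alpha> x = e \<beta> x then 1 else 0)"
    unfolding coframe_def using a by (subst representation_basis[OF frame(3)[OF fr x]]) auto
  moreover have "e \<alpha> x = e \<beta> x \<longleftrightarrow> \<alpha> = \<beta>"
    using inj_on_eq_iff[OF frame(2)[OF fr x], of \<alpha> \<beta>] a by simp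
  ultimately show ?thesis by simp
qed

lemma coframe_add: "v \<in> fibre A x \<Longrightarrow> w \<in> fibre A x \<Longrightarrow> coframe A e \<alpha> x (v + w) = coframe A e \<alpha> x v + coframe A e \<alpha> x w"
  unfolding coframe_def using representation_add[OF frame(3)[OF fr x]] frame(4)[OF fr x] by simp

lemma coframe_scale: "v \<in> fibre A x \<Longrightarrow> coframe A e \<alpha> x (s *\<^sub>R v) = s * coframe A e \<alpha> x v"
  unfolding coframe_def using representation_scale[OF frame(3)[OF fr x]] frame(4)[OF fr x] by simp

lemma coframe_outside: "v \<notin> fibre A x \<Longrightarrow> coframe A e \<alpha> x v = 0"
  unfolding coframe_def using frame(4)[OF fr x] by (simp add: representation_def)

lemma coframe_zero [simp]: "coframe A e \<alpha> x 0 = 0"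
  unfolding coframe_def by (simp add: representation_zero)

lemma coframe_dual: "coframe A e \<alpha> x \<in> dual_fibre A x"
  unfolding dual_fibre_def by (auto simp: coframe_add coframe_scale coframe_outside)

lemma frame_expand:
  assumes "v \<in> fibre A x"
  shows "v = (\<Sum>\<alpha><rk. coframe A e \<alpha> x v *\<^sub>R e \<alpha> x)"
proof -
  have "(\<Sum>b\<in>(\<lambda>\<alpha>. e \<alpha> x) ` {..<rk}. representation ((\<lambda>\<alpha>. e \<alpha> x) ` {..<rk}) v b *\<^sub>R b) = v"
    using frame(3,4)[OF fr x] assms by (intro real_vector.sum_representation_eq) auto
  then show ?thesis
    using frame(2)[OF fr x] by (simp add: sum.reindex coframe_def)
qed

lemma dual_sum:
  assumes "\<xi> \<in> dual_fibre A x" "\<And>i. i \<in> I \<Longrightarrow> f i \<in> fibre A x"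
  shows "\<xi> (sum f I) = (\<Sum>i\<in>I. \<xi> (f i))"
proof -
  have z: "\<xi> 0 = 0"
  proof -
    have "\<xi> (0 *\<^sub>R 0) = 0 * \<xi> 0" using assms(1) fibre_0 unfolding dual_fibre_def by blast
    then show ?thesis by simp
  qed
  show ?thesis using assms(2)
    by (induction I rule: infinite_finite_induct)
      (use assms(1) z in \<open>auto simp: dual_fibre_def fibre_sum\<close>)
qed

text \<open>The equation is one of functions on the ambient space: outside the fibre both sides
  vanish, by the conventions of \<open>dual_fibre\<close> and \<open>representation\<close>.\<close>

lemma dual_expand:
  assumes "\<xi> \<in> dual_fibre A x"
  shows "\<xi> = (\<lambda>v. \<Sum>\<alpha><rk. \<xi> (e \<alpha> x) * coframe A e \<alpha> x v)"
proof
  fix v show "\<xi> v = (\<Sum>\<alpha><rk. \<xi> (e \<alpha> x) * coframe A e \<alpha> x v)"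
  proof (cases "v \<in> fibre A x")
    case True
    have "\<xi> v = \<xi> (\<Sum>\<alpha><rk. coframe A e \<alpha> x v *\<^sub>R e \<alpha> x)" using frame_expand[OF True] by simp
    also have "\<dots> = (\<Sum>\<alpha><rk. \<xi> (coframe A e \<alpha> x v *\<^sub>R e \<alpha> x))"
      using assms frame_in_fibre by (intro dual_sum) auto
    also have "\<dots> = (\<Sum>\<alpha><rk. \<xi> (e \<alpha> x) * coframe A e \<alpha> x v)"
      using assms frame_in_fibre by (intro sum.cong) (auto simp: dual_fibre_def)
    finally show ?thesis .
  next
    case False
    then show ?thesis using assms coframe_outside by (simp add: dual_fibre_def)
  qed
qed

end

end

section \<open>The big bracket in coordinates\<close>

lemma sg_apply: "(sg S T :: 'm \<Rightarrow> real) x = gsign S T"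
proof -
  have "((- 1) ^ k :: 'm \<Rightarrow> real) x = (- 1) ^ k" for k by (induction k) auto
  then show ?thesis by (simp add: sg_def gsign_def)
qed

lemma sum_apply: "(\<Sum>i\<in>I. f i) x = (\<Sum>i\<in>I. f i (x::'m) :: real)"
  by (induction I rule: infinite_finite_induct) auto

lemma sign_apply: "((- 1) ^ k :: 'm \<Rightarrow> real) x = (- 1) ^ k"
  by (induction k) auto

lemma sg_singleton: "sg {s} S = ((- 1) ^ card {t \<in> S. t < s} :: 'b::comm_ring_1)"
proof -
  have "card {(s', t). s' \<in> {s} \<and> t \<in> S \<and> t < s'} = card {t \<in> S. t < s}"
    by (rule bij_betw_same_card[of snd]) (auto simp: bij_betw_def inj_on_def image_iff)
  then show ?thesis by (simp add: sg_def)
qed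

text \<open>Evaluation at a point carries the product over the ring of functions to the pointwise
  product of the definitions. Together with the rules for derivatives below, this identifies
  \<open>big_bracket\<close> with \<open>br\<close>.\<close>

lemma gmult_gcoeff:
  "gmult (\<lambda>m. gcoeff p m x) (\<lambda>m. gcoeff q m x) m = gcoeff (p * q) m (x::'m)"
  for p q :: "('m \<Rightarrow> real) gpoly"
proof (cases m)
  case (Pair S K)
  show ?thesis
  proof (cases "finite S")
    case False
    then have "infinite (Pow S)" by simp
    then show ?thesis using False by (simp add: gmult_def Pair gcoeff_infinite)
  next
    case S: True
    have "gmult (\<lambda>m. gcoeff p m x) (\<lambda>m. gcoeff q m x) (S, K) =
       (\<Sum>(S1, K1)\<in>Pow S \<times> {K1. K1 \<subseteq># K}. gsign S1 (S - S1) * gcoeff p (S1, K1) x * gcoeff q (S - S1, K - K1) x)"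
      unfolding gmult_def by (simp add: sum.cartesian_product)
    also have "\<dots> = (\<Sum>(m1, m2)\<in>splits (S, K). gsign (fst m1) (fst m2) * (gcoeff p m1 x * gcoeff q m2 x))"
    proof (rule sum.reindex_bij_witness[where j = "\<lambda>(S1, K1). ((S1, K1), (S - S1, K - K1))" and i = fst], goal_cases)
      case (4 b)
      then show ?case by (auto simp: splits_def)
    next
      case (3 b)
      obtain S1 K1 S2 K2 where b: "b = ((S1, K1), (S2, K2))" by (metis surj_pair)
      have "S - S1 = S2" "K - K1 = K2" using 3 by (auto simp: b splits_iff)
      then show ?case by (simp add: b)
    qed (auto simp: splits_iff)
    also have "\<dots> = gcoeff (p * q) (S, K) x"
      by (simp add: gcoeff_times[OF S] sum_apply case_prod_beta sg_apply)
    finally show ?thesis by (simp add: Pair)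
  qed
qed

lemma dp_gcoeff: "dp i (\<lambda>m. gcoeff p m x) = (\<lambda>m. gcoeff (pder i p) m (x::'m))"
  for p :: "('m \<Rightarrow> real) gpoly"
  by (auto simp: dp_def gcoeff_pder)

lemma dleft_gcoeff: "dleft s (\<lambda>m. gcoeff p m x) = (\<lambda>m. gcoeff (lder s p) m (x::'m))"
  for p :: "('m \<Rightarrow> real) gpoly"
  by (auto simp: dleft_def gcoeff_lder sg_singleton sign_apply)

text \<open>Moving \<open>s\<close> to the left end passes the generators below it, moving it to the
  right end those above. Together they are all of \<open>S\<close>, so the two signs differ by that
  of \<open>parity\<close>.\<close>

lemma dright_gcoeff: "dright s (\<lambda>m. gcoeff p m x) = (\<lambda>m. gcoeff (parity (lder s p)) m (x::'m))"
  for p :: "('m \<Rightarrow> real) gpoly"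
proof (rule ext, clarify)
  fix S :: "nat set" and K :: "nat multiset"
  show "dright s (\<lambda>m. gcoeff p m x) (S, K) = gcoeff (parity (lder s p)) (S, K) x"
  proof (cases "finite S \<and> s \<notin> S")
    case True
    then have lt: "t < s \<or> s < t" if "t \<in> S" for t using that by (metis linorder_neqE_nat)
    have "card ({t \<in> S. t < s} \<union> {t \<in> S. s < t}) = card {t \<in> S. t < s} + card {t \<in> S. s < t}"
      using True by (intro card_Un_disjoint) auto
    moreover have "{t \<in> S. t < s} \<union> {t \<in> S. s < t} = S" using lt by blast
    ultimately have "card S = card {t \<in> S. t < s} + card {t \<in> S. s < t}" by simp
    then have "(- 1) ^ card S * (- 1) ^ card {t \<in> S. t < s} = ((- 1) ^ card {t \<in> S. s < t} :: real)"
      using minus_one_power_square[of "card {t \<in> S. t < s}", where 'b=real]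
      by (simp add: power_add)
    then show ?thesis using True
      by (simp add: dright_def gcoeff_lder sg_singleton sign_apply)
  next
    case False
    then show ?thesis by (auto simp: dright_def gcoeff_infinite gcoeff_lder)
  qed
qed

lemma sum_lessThan_double: "(\<Sum>s<2 * r. f s) = (\<Sum>\<alpha><r. f \<alpha> + f (r + \<alpha>))" for r :: nat
proof -
  have "(\<Sum>s<r + k. f s) = (\<Sum>s<r. f s) + (\<Sum>\<alpha><k. f (r + \<alpha>))" for k
    by (induction k) (auto simp: add.assoc)
  from this[of r] show ?thesis by (simp add: sum.distrib mult_2)
qed

lemma gfun_deg_support:
  assumes "a \<in> gfun_deg A k" "a c (S, K) x \<noteq> 0"
  shows "c \<in> coord_systems A" "x \<in> coord_dom c" "S \<subseteq> {..<2 * bundle_rank A}"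
    "set_mset K \<subseteq> {..<base_dim A}" "mono_deg (S, K) = k"
proof -
  have "\<forall>c S K x. a c (S, K) x \<noteq> 0 \<longrightarrow> c \<in> coord_systems A \<and> x \<in> coord_dom c \<and>
        S \<subseteq> {..<2 * bundle_rank A} \<and> set_mset K \<subseteq> {..<base_dim A} \<and> mono_deg (S, K) = k"
    using assms(1) unfolding gfun_deg_def mem_Collect_eq by (elim conjE)
  then show "c \<in> coord_systems A" "x \<in> coord_dom c" "S \<subseteq> {..<2 * bundle_rank A}"
    "set_mset K \<subseteq> {..<base_dim A}" "mono_deg (S, K) = k"
    using assms(2) by blast+
qed

section \<open>The differential ring of a coordinate system\<close>

locale coord_ctx = vbundle_ctx A for A :: "('m::{t2_space, second_countable_topology}, 'v::real_vector) vbundle" +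
  fixes U :: "'m set" and \<phi> :: "'m \<Rightarrow> nat \<Rightarrow> real" and V :: "'m set" and e :: "nat \<Rightarrow> 'm \<Rightarrow> 'v"
  assumes ch: "(U, \<phi>) \<in> charts A" and fr: "(V, e) \<in> frames A"
begin

definition "c = ((U, \<phi>), (V, e))"
definition "D = U \<inter> V"

lemma c_in: "c \<in> coord_systems A" by (simp add: c_def coord_systems_def ch fr)
lemma c_dom [simp]: "coord_dom c = D" by (simp add: c_def coord_dom_def D_def)
lemma c_frame [simp]: "coord_frame c = e" by (simp add: c_def coord_frame_def)
lemma open_D: "open D" using chart(1)[OF ch] frame(1)[OF fr] by (auto simp: D_def)
lemma D_U: "x \<in> D \<Longrightarrow> x \<in> U" and D_V: "x \<in> D \<Longrightarrow> x \<in> V" by (auto simp: D_def)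

text \<open>Vanishing outside \<open>D\<close> is the convention for functions on the graded
  manifold, so equality in this ring is equality of coefficients.\<close>

definition smooth_coeffs :: "('m \<Rightarrow> real) set" where
  "smooth_coeffs = {f. smooth_Rn nn (\<phi> ` D) (f \<circ> inv_into U \<phi>) \<and> (\<forall>x. x \<notin> D \<longrightarrow> f x = 0)}"

text \<open>Zero for \<open>i\<close> out of range and outside \<open>D\<close>, so that all indices
  \<open>i\<close> preserve \<open>smooth_coeffs\<close> and commute.\<close>

definition partial :: "nat \<Rightarrow> ('m \<Rightarrow> real) \<Rightarrow> 'm \<Rightarrow> real" where
  "partial i f x = (if i < nn \<and> x \<in> D then pderiv_at i (f \<circ> inv_into U \<phi>) (\<phi> x) else 0)"

lemma partial_dx: "i < nn \<Longrightarrow> x \<in> D \<Longrightarrow> Defs.dx c i f x = partial i f x"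
  by (simp add: partial_def Defs.dx_def c_def)

lemma open_image: "openRn nn (\<phi> ` D)"
  using chart_openRn[OF ch open_D] by (simp add: D_def Int_assoc[symmetric])

lemma partial_inv:
  assumes "y \<in> \<phi> ` D" "i < nn"
  shows "pderiv_at i (f \<circ> inv_into U \<phi>) y = (partial i f \<circ> inv_into U \<phi>) y"
  using assms chart_inv[OF ch] by (auto simp: partial_def D_def)

lemma smooth_coeffs_smooth: "f \<in> smooth_coeffs \<Longrightarrow> smooth_Rn nn (\<phi> ` D) (f \<circ> inv_into U \<phi>)"
  and smooth_coeffs_outside: "f \<in> smooth_coeffs \<Longrightarrow> x \<notin> D \<Longrightarrow> f x = 0"
  by (auto simp: smooth_coeffs_def)

lemma pderiv_partial:
  assumes "y \<in> \<phi> ` D" "i < nn"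
  shows "pderiv_at i (partial j f \<circ> inv_into U \<phi>) y =
    (if j < nn then pderiv_at i (pderiv_at j (f \<circ> inv_into U \<phi>)) y else 0)"
proof (cases "j < nn")
  case True
  then show ?thesis using assms
    by (simp add: pderiv_at_cong[OF open_image assms partial_inv[symmetric]])
next
  case False
  have "partial j f \<circ> inv_into U \<phi> = (\<lambda>_. 0)" using False by (auto simp: partial_def)
  then show ?thesis using False by (simp add: pderiv_at_def)
qed

lemma smooth_coeffs_partial: "f \<in> smooth_coeffs \<Longrightarrow> partial i f \<in> smooth_coeffs"
proof (cases "i < nn")
  case True
  assume "f \<in> smooth_coeffs"
  then have "smooth_Rn nn (\<phi> ` D) (pderiv_at i (f \<circ> inv_into U \<phi>))"
    using smooth_Rn_pderiv[OF smooth_coeffs_smooth True] by blast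
  then have "smooth_Rn nn (\<phi> ` D) (partial i f \<circ> inv_into U \<phi>)"
    by (rule smooth_Rn_cong[OF open_image, rotated]) (rule partial_inv[OF _ True])
  then show ?thesis by (simp add: smooth_coeffs_def partial_def)
next
  case False
  then have "partial i f \<circ> inv_into U \<phi> = (\<lambda>_. 0)" by (auto simp: partial_def)
  then show ?thesis by (simp add: smooth_coeffs_def partial_def smooth_Rn_const)
qed

lemma image_D: "x \<in> D \<Longrightarrow> \<phi> x \<in> \<phi> ` D" by blast

sublocale diff_ring smooth_coeffs partial nn rk
proof
  show "0 \<in> smooth_coeffs"
    by (simp add: smooth_coeffs_def comp_def smooth_Rn_const)
next
  fix f g assume *: "f \<in> smooth_coeffs" "g \<in> smooth_coeffs"
  show "f + g \<in> smooth_coeffs"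
    using * smooth_Rn_add[OF open_image smooth_coeffs_smooth smooth_coeffs_smooth]
    by (simp add: smooth_coeffs_def comp_def)
  show "f * g \<in> smooth_coeffs"
    using * smooth_Rn_mult[OF open_image smooth_coeffs_smooth smooth_coeffs_smooth]
    by (simp add: smooth_coeffs_def comp_def)
  fix i
  show "partial i (f + g) = partial i f + partial i g"
  proof
    fix x
    show "partial i (f + g) x = (partial i f + partial i g) x"
      using pderiv_at_add[OF *[THEN smooth_coeffs_smooth] image_D, of x i]
      by (simp add: partial_def comp_def)
  qed
  show "partial i (f * g) = partial i f * g + f * partial i g"
  proof
    fix x
    show "partial i (f * g) x = (partial i f * g + f * partial i g) x"
      using pderiv_at_mult[OF *[THEN smooth_coeffs_smooth] image_D, of x i] chart_inv[OF ch D_U, of x]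
      by (simp add: partial_def comp_def)
  qed
next
  fix f assume *: "f \<in> smooth_coeffs"
  show "- f \<in> smooth_coeffs"
    using * smooth_Rn_uminus[OF open_image smooth_coeffs_smooth]
    by (simp add: smooth_coeffs_def comp_def)
  fix i j
  show "partial i f \<in> smooth_coeffs" by (rule smooth_coeffs_partial[OF *])
  show "partial i (partial j f) = partial j (partial i f)"
  proof
    fix x
    show "partial i (partial j f) x = partial j (partial i f) x"
      using pderiv_at_commute[OF open_image image_D smooth_coeffs_smooth[OF *], of x i j]
        pderiv_partial[OF image_D, of x i j f] pderiv_partial[OF image_D, of x j i f]
      unfolding partial_def[of i "partial j f"] partial_def[of j "partial i f"] by (auto simp: partial_def)
  qed
qed

text \<open>What \<open>Abs_gpoly\<close> and \<open>SM\<close> ask of the coordinate expression in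
  the fixed system \<open>c\<close>; nothing is said about other systems.\<close>

definition good :: "('m, 'v) gfun \<Rightarrow> bool" where
  "good a \<longleftrightarrow> (\<forall>m. a c m \<in> smooth_coeffs) \<and> (\<forall>S K. infinite S \<longrightarrow> a c (S, K) = 0)"

definition pl :: "('m, 'v) gfun \<Rightarrow> ('m \<Rightarrow> real) gpoly" where
  "pl a = Abs_gpoly (a c)"

lemma gcoeff_pl: "good a \<Longrightarrow> gcoeff (pl a) m = a c m"
  unfolding pl_def by (subst Abs_gpoly_inverse) (auto simp: good_def)

lemma SM_pl [simp]: "good a \<Longrightarrow> pl a \<in> SM"
  by (rule SM_I) (simp add: gcoeff_pl, simp add: good_def)

lemma SM_outside: "p \<in> SM \<Longrightarrow> x \<notin> D \<Longrightarrow> gcoeff p m x = 0"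
  by (rule smooth_coeffs_outside[OF SM_D])

text \<open>The passage from brackets of functions to the differential ring of one coordinate
  system; outside \<open>D\<close> both sides are 0.\<close>

lemma big_bracket_gcoeff:
  assumes "good a" "good b"
  shows "big_bracket A a b c m = gcoeff (br (pl a) (pl b)) m"
proof
  fix x
  show "big_bracket A a b c m x = gcoeff (br (pl a) (pl b)) m x"
  proof (cases "x \<in> D")
    case False
    then show ?thesis
      using SM_outside[OF SM_br[OF SM_pl SM_pl, OF assms] False] by (simp add: big_bracket_def)
  next
    case True
    have a: "a c = gcoeff (pl a)" and b: "b c = gcoeff (pl b)"
      using assms by (auto simp: gcoeff_pl)
    have dxa: "(\<lambda>m'. Defs.dx c i (gcoeff p m') x) = (\<lambda>m'. gcoeff (cder i p) m' x)" if "i < nn" for i p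
      using that True by (simp add: partial_dx)
    have "big_bracket A a b c m x =
        (\<Sum>i<nn. gcoeff (cder i (pl a) * pder i (pl b)) m x - gcoeff (pder i (pl a) * cder i (pl b)) m x) +
        (\<Sum>\<alpha><rk. gcoeff (parity (lder \<alpha> (pl a)) * lder (rk + \<alpha>) (pl b)) m x +
           gcoeff (parity (lder (rk + \<alpha>) (pl a)) * lder \<alpha> (pl b)) m x)"
      using c_in True
      by (simp add: big_bracket_def Let_def a b dxa dp_gcoeff dleft_gcoeff dright_gcoeff gmult_gcoeff
          del: gcoeff_cder cong: sum.cong_simp)
    also have "\<dots> = gcoeff (br (pl a) (pl b)) m x"
      unfolding br_def sum_lessThan_double
      by (simp add: gcoeff_sum sum_apply dual_def add.commute del: gcoeff_cder cong: sum.cong_simp)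
    finally show ?thesis .
  qed
qed

lemma good_big_bracket [simp]: "good a \<Longrightarrow> good b \<Longrightarrow> good (big_bracket A a b)"
  unfolding good_def[of "big_bracket A a b"]
  by (auto simp: big_bracket_gcoeff gcoeff_infinite)

lemma pl_big_bracket [simp]: "good a \<Longrightarrow> good b \<Longrightarrow> pl (big_bracket A a b) = br (pl a) (pl b)"
  by (rule gpoly_eqI) (simp add: gcoeff_pl big_bracket_gcoeff)

lemma good_gadd [simp]: "good a \<Longrightarrow> good b \<Longrightarrow> good (gadd a b)"
proof -
  assume *: "good a" "good b"
  have "gadd a b c m = a c m + b c m" for m by (auto simp: gadd_def)
  then show ?thesis using * by (auto simp: good_def add_C)
qed

lemma pl_gadd [simp]: "good a \<Longrightarrow> good b \<Longrightarrow> pl (gadd a b) = pl a + pl b"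
  by (rule gpoly_eqI) (auto simp: gcoeff_pl, auto simp: gadd_def)

lemma good_gzero [simp]: "good gzero"
proof -
  have "gzero c m = 0" for m by (auto simp: gzero_def)
  then show ?thesis by (simp add: good_def zero_C)
qed

lemma pl_gzero [simp]: "pl gzero = 0"
  by (rule gpoly_eqI) (auto simp: gcoeff_pl, auto simp: gzero_def)

lemma smooth_coeffsI:
  assumes "smooth_on_base A D f" "\<And>x. x \<notin> D \<Longrightarrow> f x = 0"
  shows "f \<in> smooth_coeffs"
  using smooth_on_base_D[OF assms(1) ch] assms(2) by (simp add: smooth_coeffs_def D_def)

lemma good_gfun_deg:
  assumes "a \<in> gfun_deg A k"
  shows "good a"
proof -
  have 1: "\<forall>c S K x. a c (S, K) x \<noteq> 0 \<longrightarrow>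
        c \<in> coord_systems A \<and> x \<in> coord_dom c \<and>
        S \<subseteq> {..<2 * rk} \<and> set_mset K \<subseteq> {..<nn} \<and> mono_deg (S, K) = k"
    and 2: "\<forall>c\<in>coord_systems A. \<forall>m. smooth_on_base A (coord_dom c) (a c m)"
    using assms unfolding gfun_deg_def by blast+
  have "a c (S, K) \<in> smooth_coeffs" for S K
    using 2 c_in 1 by (intro smooth_coeffsI) (metis c_dom, metis c_dom)
  moreover have "a c (S, K) = 0" if "infinite S" for S K
  proof
    fix x show "a c (S, K) x = 0 x"
      using 1 that finite_subset[of S "{..<2 * rk}"] by (metis finite_lessThan zero_fun_apply)
  qed
  ultimately show ?thesis by (auto simp: good_def)
qed

lemma gfun_deg_in_vars:
  assumes "a \<in> gfun_deg A k"
  shows "in_vars (pl a)" "homogeneous (\<lambda>_. 1) 2 (int k) (pl a)"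
proof -
  have 1: "S \<subseteq> {..<2 * rk} \<and> set_mset K \<subseteq> {..<nn} \<and> mono_deg (S, K) = k" if nz: "a c (S, K) \<noteq> 0" for S K
  proof -
    have "\<exists>x. a c (S, K) x \<noteq> 0"
    proof (rule ccontr)
      assume "\<nexists>x. a c (S, K) x \<noteq> 0"
      then have "a c (S, K) = 0" by (intro ext) simp
      with nz show False by contradiction
    qed
    then obtain x where x: "a c (S, K) x \<noteq> 0" ..
    show ?thesis using gfun_deg_support(3-5)[OF assms x] by simp
  qed
  have "int (card S) + 2 * int (size K) = int k" if "a c (S, K) \<noteq> 0" for S K
    using 1[OF that] by (auto simp: mono_deg_def)
  with 1 show "in_vars (pl a)" "homogeneous (\<lambda>_. 1) 2 (int k) (pl a)"
    by (auto simp: in_vars_def homogeneous_def gcoeff_pl[OF good_gfun_deg[OF assms]])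
qed

end

section \<open>Skew endomorphisms as functions of degree 2\<close>

lemma E_add_plus: "E_add u v = u + v"
  by (simp add: E_add_def plus_prod_def plus_fun_def)

lemma E_pair_commute: "E_pair u v = E_pair v u"
  by (simp add: E_pair_def)

context vbundle_ctx
begin

lemma dual_0: "(0::'v \<Rightarrow> real) \<in> dual_fibre A x"
  and dual_add: "\<xi> \<in> dual_fibre A x \<Longrightarrow> \<eta> \<in> dual_fibre A x \<Longrightarrow> \<xi> + \<eta> \<in> dual_fibre A x"
  and dual_scale: "\<xi> \<in> dual_fibre A x \<Longrightarrow> (\<lambda>w. s * \<xi> w) \<in> dual_fibre A x"
  by (auto simp: dual_fibre_def algebra_simps)

lemma E_fibre_0: "0 \<in> E_fibre A x"
  and E_fibre_add: "u \<in> E_fibre A x \<Longrightarrow> v \<in> E_fibre A x \<Longrightarrow> u + v \<in> E_fibre A x"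
  and E_fibre_scale: "u \<in> E_fibre A x \<Longrightarrow> E_scale s u \<in> E_fibre A x"
  by (auto simp: E_fibre_def zero_prod_def dual_0 dual_add dual_scale E_scale_def)

lemma E_fibre_sum: "(\<And>i. i \<in> I \<Longrightarrow> f i \<in> E_fibre A x) \<Longrightarrow> sum f I \<in> E_fibre A x"
  by (induction I rule: infinite_finite_induct) (auto simp: E_fibre_0 E_fibre_add)

lemma dual_at_0: "\<xi> \<in> dual_fibre A x \<Longrightarrow> \<xi> 0 = 0"
proof -
  assume "\<xi> \<in> dual_fibre A x"
  then have "\<xi> (0 *\<^sub>R 0) = 0 * \<xi> 0" using fibre_0 unfolding dual_fibre_def by blast
  then show ?thesis by simp
qed

lemma E_pair_add_left:
  "u \<in> E_fibre A x \<Longrightarrow> v \<in> E_fibre A x \<Longrightarrow> w \<in> E_fibre A x \<Longrightarrow> E_pair (u + v) w = E_pair u w + E_pair v w"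
  by (auto simp: E_pair_def E_fibre_def dual_fibre_def)

lemma E_pair_scale_left:
  "u \<in> E_fibre A x \<Longrightarrow> w \<in> E_fibre A x \<Longrightarrow> E_pair (E_scale s u) w = s * E_pair u w"
  by (auto simp: E_pair_def E_fibre_def dual_fibre_def E_scale_def algebra_simps)

lemma E_pair_zero_left: "w \<in> E_fibre A x \<Longrightarrow> E_pair 0 w = 0"
  using dual_at_0 by (auto simp: E_pair_def E_fibre_def)

lemma E_pair_sum_left:
  assumes "\<And>i. i \<in> I \<Longrightarrow> f i \<in> E_fibre A x" "w \<in> E_fibre A x"
  shows "E_pair (sum f I) w = (\<Sum>i\<in>I. E_pair (f i) w)"
  using assms(1)
  by (induction I rule: infinite_finite_induct)
    (auto simp: E_pair_zero_left[OF assms(2)] E_pair_add_left[OF _ _ assms(2)] E_fibre_sum)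

lemma fst_E_scale [simp]: "fst (E_scale s u) = s *\<^sub>R fst u"
  and snd_E_scale [simp]: "snd (E_scale s u) = (\<lambda>w. s * snd u w)"
  by (auto simp: E_scale_def)

lemma fst_sum': "fst (sum f I) = (\<Sum>i\<in>I. fst (f i))" for f :: "_ \<Rightarrow> 'v gvec"
  by (induction I rule: infinite_finite_induct) auto

lemma snd_sum': "snd (sum f I) w = (\<Sum>i\<in>I. snd (f i) w)" for f :: "_ \<Rightarrow> 'v gvec"
  by (induction I rule: infinite_finite_induct) auto

context
  fixes V e x
  assumes fr: "(V, e) \<in> frames A" and x: "x \<in> V"
begin

lemma E_frame_in: "s < 2 * rk \<Longrightarrow> E_frame A e s x \<in> E_fibre A x"
  using frame_in_fibre[OF fr x] coframe_dual[OF fr x] dual_0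
  by (auto simp: E_frame_def E_fibre_def zero_fun_def)

lemma E_frame_pair:
  assumes "s < 2 * rk" "t < 2 * rk"
  shows "E_pair (E_frame A e s x) (E_frame A e t x) = (if t = dual rk s then 1 else 0)"
  using assms coframe_frame[OF fr x] coframe_zero[OF fr x] by (auto simp: E_frame_def E_pair_def dual_def)

text \<open>The induced frame is hyperbolic: by \<open>E_frame_pair\<close> its dual basis for the
  pairing is the same frame with indices exchanged by \<open>dual\<close>.\<close>

lemma E_expand:
  assumes "u \<in> E_fibre A x"
  shows "u = (\<Sum>s<2*rk. E_scale (E_pair u (E_frame A e s x)) (E_frame A e (dual rk s) x))"
proof -
  have u: "fst u \<in> fibre A x" "snd u \<in> dual_fibre A x" using assms by (auto simp: E_fibre_def)
  let ?f = "\<lambda>s. E_scale (E_pair u (E_frame A e s x)) (E_frame A e (dual rk s) x)"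
  have "fst (\<Sum>s<2*rk. ?f s) = (\<Sum>\<alpha><rk. coframe A e \<alpha> x (fst u) *\<^sub>R e \<alpha> x)"
    unfolding sum_lessThan_double
    using dual_at_0[OF u(2)] by (simp add: fst_sum' E_frame_def dual_def E_pair_def)
  then have 1: "fst (\<Sum>s<2*rk. ?f s) = fst u" using frame_expand[OF fr x u(1)] by simp
  have "snd (\<Sum>s<2*rk. ?f s) w = (\<Sum>\<alpha><rk. snd u (e \<alpha> x) * coframe A e \<alpha> x w)" for w
    unfolding sum_lessThan_double
    by (simp add: snd_sum' E_frame_def dual_def E_pair_def)
  then have 2: "snd (\<Sum>s<2*rk. ?f s) = snd u"
    by (intro trans[OF _ dual_expand[OF fr x u(2), symmetric]] ext)
  show ?thesis using 1 2 by (simp add: prod_eq_iff)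
qed

lemma of_section_component:
  assumes c: "(U, \<phi>) \<in> charts A" "x \<in> U" and u: "u x \<in> E_fibre A x" and t: "t < 2 * rk"
  shows "of_section A u ((U, \<phi>), (V, e)) ({t}, {#}) x = E_pair (u x) (E_frame A e t x)"
proof -
  have c': "((U, \<phi>), V, e) \<in> coord_systems A" "x \<in> coord_dom ((U, \<phi>), V, e)"
    using c fr x by (auto simp: coord_systems_def coord_dom_def)
  have z: "snd (u x) 0 = 0" using u dual_at_0 by (auto simp: E_fibre_def)
  show ?thesis
  proof (cases "t < rk")
    case True
    have "of_section A u ((U, \<phi>), (V, e)) ({t}, {#}) x = (\<Sum>\<alpha><rk. if \<alpha> = t then snd (u x) (e \<alpha> x) else 0)"
      unfolding of_section_def using c' True by (simp add: coord_frame_def single_def if_distrib[of "\<lambda>z. _ * z"] cong: if_cong)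
    then show ?thesis using True z by (simp add: E_frame_def E_pair_def)
  next
    case False
    have "of_section A u ((U, \<phi>), (V, e)) ({t}, {#}) x = (\<Sum>\<alpha><rk. if \<alpha> = t - rk then coframe A e \<alpha> x (fst (u x)) else 0)"
      unfolding of_section_def if_P[OF conjI[OF c']]
    proof (rule sum.cong[OF refl])
      fix \<alpha> assume "\<alpha> \<in> {..<rk}"
      then have "t = rk + \<alpha> \<longleftrightarrow> \<alpha> = t - rk" "t \<noteq> \<alpha>" using False by auto
      then show "coframe A (coord_frame ((U, \<phi>), V, e)) \<alpha> x (fst (u x)) * single ({rk + \<alpha>}, {#}) ({t}, {#}) +
          snd (u x) (coord_frame ((U, \<phi>), V, e) \<alpha> x) * single ({\<alpha>}, {#}) ({t}, {#}) =
          (if \<alpha> = t - rk then coframe A e \<alpha> x (fst (u x)) else 0)"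
        by (simp add: single_def coord_frame_def)
    qed
    then show ?thesis using False z t by (auto simp: E_frame_def E_pair_def)
  qed
qed

end

lemma of_section_other:
  assumes "\<not> (\<exists>t<2*rk. m = ({t}, {#}))"
  shows "of_section A u c m x = 0"
proof -
  have "m \<noteq> ({rk + \<alpha>}, {#})" "m \<noteq> ({\<alpha>}, {#})" if "\<alpha> < rk" for \<alpha>
    using assms that by force+
  then show ?thesis by (simp add: of_section_def single_def)
qed

end

section \<open>The quadratic function of a skew endomorphism\<close>

locale skew_ctx = vbundle_ctx A for A :: "('m::{t2_space, second_countable_topology}, 'v::real_vector) vbundle" +
  fixes NN :: "'m \<Rightarrow> 'v gvec \<Rightarrow> 'v gvec"
  assumes skew: "skew_endomorphism A NN"
begin

lemma NN_in: "u \<in> E_fibre A x \<Longrightarrow> NN x u \<in> E_fibre A x"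
  using skew unfolding skew_endomorphism_def by (elim conjE) blast

lemma NN_add: "u \<in> E_fibre A x \<Longrightarrow> v \<in> E_fibre A x \<Longrightarrow> NN x (u + v) = NN x u + NN x v"
  using skew unfolding skew_endomorphism_def E_add_plus by (elim conjE) blast

lemma NN_scale: "u \<in> E_fibre A x \<Longrightarrow> NN x (E_scale s u) = E_scale s (NN x u)"
  using skew unfolding skew_endomorphism_def by (elim conjE) blast

lemma NN_skew: "u \<in> E_fibre A x \<Longrightarrow> v \<in> E_fibre A x \<Longrightarrow> E_pair (NN x u) v = - E_pair (NN x v) u"
proof -
  assume a: "u \<in> E_fibre A x" "v \<in> E_fibre A x"
  have "\<forall>x. \<forall>u\<in>E_fibre A x. \<forall>v\<in>E_fibre A x. E_pair (NN x u) v + E_pair u (NN x v) = 0"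
    using skew unfolding skew_endomorphism_def by (elim conjE)
  then have "E_pair (NN x u) v + E_pair u (NN x v) = 0" using a by blast
  then show ?thesis using E_pair_commute[of u "NN x v"] by simp
qed

lemma NN_smooth:
  assumes "(V, e) \<in> frames A" "a < 2 * rk" "b < 2 * rk"
  shows "smooth_on_base A V (\<lambda>x. E_pair (NN x (E_frame A e a x)) (E_frame A e b x))"
proof -
  have "\<forall>(V, e)\<in>frames A. \<forall>a<2 * bundle_rank A. \<forall>b<2 * bundle_rank A.
        smooth_on_base A V (\<lambda>x. E_pair (NN x (E_frame A e a x)) (E_frame A e b x))"
    using skew unfolding skew_endomorphism_def by (elim conjE)
  from bspec[OF this assms(1)] show ?thesis using assms(2,3) by simp
qed

lemma NN_zero: "NN x 0 = 0"
  using NN_scale[OF E_fibre_0, of x 0] by (simp add: E_scale_def zero_prod_def zero_fun_def)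

lemma NN_sum: "(\<And>i. i \<in> I \<Longrightarrow> f i \<in> E_fibre A x) \<Longrightarrow> NN x (sum f I) = (\<Sum>i\<in>I. NN x (f i))"
  by (induction I rule: infinite_finite_induct) (auto simp: NN_zero NN_add E_fibre_sum)

lemma pair_NN_expand:
  assumes fr: "(V, e) \<in> frames A" "x \<in> V" and u: "u \<in> E_fibre A x" and w: "w \<in> E_fibre A x"
  shows "E_pair (NN x u) w = (\<Sum>s<2*rk. E_pair u (E_frame A e s x) * E_pair (NN x (E_frame A e (dual rk s) x)) w)"
proof -
  let ?f = "\<lambda>s. E_scale (E_pair u (E_frame A e s x)) (E_frame A e (dual rk s) x)"
  have f: "?f s \<in> E_fibre A x" if "s < 2 * rk" for s
    using that by (intro E_fibre_scale E_frame_in[OF fr] dual_less)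
  have "NN x u = (\<Sum>s<2*rk. NN x (?f s))"
    by (subst E_expand[OF fr u]) (auto intro!: NN_sum f)
  then have "E_pair (NN x u) w = (\<Sum>s<2*rk. E_pair (NN x (?f s)) w)"
    using f w by (simp only:) (rule E_pair_sum_left[where x = x], auto intro: NN_in)
  also have "\<dots> = (\<Sum>s<2*rk. E_pair u (E_frame A e s x) * E_pair (NN x (E_frame A e (dual rk s) x)) w)"
    using w by (intro sum.cong refl)
      (simp add: NN_scale E_pair_scale_left[where x = x] NN_in E_frame_in[OF fr] dual_less)
  finally show ?thesis .
qed

text \<open>The coefficient of \<open>\<zeta>\<^sub>j \<zeta>\<^sub>t\<close>, \<open>j < t\<close>, is forced by \<open>\<N>(u) = {u, \<N>}\<close>: the frame element \<open>d\<^sub>j\<close>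
  corresponds to the generator dual to \<open>\<zeta>\<^sub>j\<close>, so \<open>{d\<^sub>j, \<cdot>}\<close> is the left derivative along \<open>\<zeta>\<^sub>j\<close>.\<close>

definition quad :: "('m, 'v) gfun" where
  "quad c m x = (if c \<in> coord_systems A \<and> x \<in> coord_dom c \<and> snd m = {#} \<and>
      (\<exists>j t. j < t \<and> t < 2 * rk \<and> fst m = {j, t})
    then E_pair (NN x (E_frame A (coord_frame c) (Min (fst m)) x)) (E_frame A (coord_frame c) (Max (fst m)) x) else 0)"

lemma quad_pair:
  assumes "c \<in> coord_systems A" "x \<in> coord_dom c" "j < t" "t < 2 * rk"
  shows "quad c ({j, t}, {#}) x = E_pair (NN x (E_frame A (coord_frame c) j x)) (E_frame A (coord_frame c) t x)"
  using assms by (auto simp: quad_def)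

end

text \<open>The coefficients of a product of two linear forms in odd variables are the 2-by-2 minors
  of their coefficient matrix, one for each ordered pair.\<close>

lemma gmult_linear:
  fixes f g :: "nat \<Rightarrow> real"
  assumes a: "\<And>S K. a (S, K) = (if \<exists>v<N. S = {v} \<and> K = {#} then f (the_elem S) else 0)"
    and b: "\<And>S K. b (S, K) = (if \<exists>v<N. S = {v} \<and> K = {#} then g (the_elem S) else 0)"
  shows "gmult a b (S, K) = (if K = {#} \<and> (\<exists>u v. u < v \<and> v < N \<and> S = {u, v})
    then f (Min S) * g (Max S) - f (Max S) * g (Min S) else 0)"
proof (cases "K = {#} \<and> (\<exists>u v. u < v \<and> v < N \<and> S = {u, v})")
  case True
  then obtain u v where uv: "u < v" "v < N" "S = {u, v}" "K = {#}" by blast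
  have P: "Pow S = {{}, {u}, {v}, {u, v}}" using uv(3) by (auto simp: Pow_insert)
  have K: "{K1. K1 \<subseteq># K} = {{#}}" using uv(4) by auto
  have d: "S - {u} = {v}" "S - {v} = {u}" using uv by auto
  have z: "a ({}, K') = 0" "b ({}, K') = 0" for K' by (auto simp: a b)
  have z2: "a ({u, v}, {#}) = 0" using uv by (auto simp: a)
  have "{(s, t). s \<in> {u} \<and> t \<in> {v} \<and> t < s} = {}" "{(s, t). s \<in> {v} \<and> t \<in> {u} \<and> t < s} = {(v, u)}"
    using uv(1) by auto
  then have g: "gsign {u} {v} = 1" "gsign {v} {u} = - 1" unfolding gsign_def by (simp_all only:) simp_all
  have "gmult a b (S, K) = gsign {u} {v} * a ({u}, {#}) * b ({v}, {#}) + gsign {v} {u} * a ({v}, {#}) * b ({u}, {#})"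
    unfolding gmult_def prod.case P K using uv(1,4) d z z2 uv(3)
    by (simp add: doubleton_eq_iff)
  also have "\<dots> = f u * g v - f v * g u" using uv g by (simp add: a b)
  finally show ?thesis using True uv(1,3) by simp
next
  case False
  have "gsign S1 (S - S1) * a (S1, K1) * b (S - S1, K - K1) = 0" if "S1 \<in> Pow S" "K1 \<in> {K1. K1 \<subseteq># K}" for S1 K1
  proof (rule ccontr)
    assume "gsign S1 (S - S1) * a (S1, K1) * b (S - S1, K - K1) \<noteq> 0"
    then have "a (S1, K1) \<noteq> 0" "b (S - S1, K - K1) \<noteq> 0" by auto
    then obtain u v where uv: "u < N" "S1 = {u}" "K1 = {#}" "v < N" "S - S1 = {v}" "K - K1 = {#}"
      by (auto simp: a b split: if_splits)
    then have "S = {u, v}" "K = {#}" "u \<noteq> v" using that by auto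
    then have "S = {min u v, max u v}" "min u v < max u v" "max u v < N" using uv by (auto simp: min_def max_def)
    with \<open>K = {#}\<close> False show False by blast
  qed
  then show ?thesis unfolding if_not_P[OF False] gmult_def prod.case by (intro sum.neutral ballI)
qed

text \<open>Folds a sum over a square onto its upper triangle, because \<open>quad\<close> records
  each pair of generators once.\<close>

lemma sum_pairs_skew:
  fixes F :: "nat \<Rightarrow> nat \<Rightarrow> real"
  assumes "\<And>j. j < N \<Longrightarrow> F j j = 0"
  shows "(\<Sum>j<N. \<Sum>t<N. F j t) = (\<Sum>(j, t)\<in>{(j, t). j < t \<and> t < N}. F j t + F t j)"
proof -
  let ?L = "{(j, t). j < t \<and> t < N}" and ?G = "{(j, t). t < j \<and> j < N}" and ?E = "{(j, t). j = t \<and> t < N}"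
  have f: "finite ?L" "finite ?G" "finite ?E"
    by (rule finite_subset[of _ "{..<N} \<times> {..<N}"]; auto)+
  have "(\<Sum>j<N. \<Sum>t<N. F j t) = (\<Sum>(j, t)\<in>{..<N} \<times> {..<N}. F j t)" by (simp add: sum.cartesian_product)
  also have "{..<N} \<times> {..<N} = ?L \<union> (?G \<union> ?E)" by auto
  also have "(\<Sum>(j, t)\<in>?L \<union> (?G \<union> ?E). F j t) = (\<Sum>(j, t)\<in>?L. F j t) + ((\<Sum>(j, t)\<in>?G. F j t) + (\<Sum>(j, t)\<in>?E. F j t))"
    using f by (subst sum.union_disjoint; (subst sum.union_disjoint)?) auto
  also have "(\<Sum>(j, t)\<in>?E. F j t) = 0" using assms by (intro sum.neutral) auto
  also have "(\<Sum>(j, t)\<in>?G. F j t) = (\<Sum>(j, t)\<in>?L. F t j)"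
    by (rule sum.reindex_bij_witness[where i = prod.swap and j = prod.swap]) auto
  finally show ?thesis by (simp only: split_def sum.distrib add_0_right)
qed

lemma gmult_one_right:
  assumes "\<And>S K. infinite S \<Longrightarrow> a (S, K) = 0"
  shows "gmult a (single ({}, {#})) = a"
proof (rule ext, clarify)
  fix S :: "nat set" and K :: "nat multiset"
  show "gmult a (single ({}, {#})) (S, K) = a (S, K)"
  proof (cases "finite S")
    case False
    then show ?thesis using assms by (simp add: gmult_def)
  next
    case True
    have "gmult a (single ({}, {#})) (S, K) =
       (\<Sum>(S1, K1)\<in>Pow S \<times> {K1. K1 \<subseteq># K}. gsign S1 (S - S1) * a (S1, K1) * single ({}, {#}) (S - S1, K - K1))"
      by (simp add: gmult_def sum.cartesian_product)
    also have "\<dots> = (\<Sum>(S1, K1)\<in>{(S, K)}. gsign S1 (S - S1) * a (S1, K1) * single ({}, {#}) (S - S1, K - K1))"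
    proof (rule sum.mono_neutral_right)
      show "finite (Pow S \<times> {K1. K1 \<subseteq># K})" using True finite_sub_msets by blast
      show "\<forall>i\<in>Pow S \<times> {K1. K1 \<subseteq># K} - {(S, K)}.
         (case i of (S1, K1) \<Rightarrow> gsign S1 (S - S1) * a (S1, K1) * single ({}, {#}) (S - S1, K - K1)) = 0"
        by (auto simp: single_def Diff_eq_empty_iff_mset intro: subset_mset.antisym split: if_splits)
    qed auto
    moreover have "gsign S {} = 1" by (simp add: gsign_def)
    ultimately show ?thesis by (simp add: single_def)
  qed
qed

lemma card_2_ordered: "card S = 2 \<Longrightarrow> \<exists>j t. j < t \<and> S = {j, t}" for S :: "nat set"
  by (metis card_2_iff insert_commute linorder_neqE_nat)

section \<open>Change of coordinates for quadratic functions\<close>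

context vbundle_ctx
begin

text \<open>The transition matrix of the odd generators. Writing its entries as pairings of frame
  elements treats the \<tau> and the \<theta> in one formula.\<close>

definition Q :: "(nat \<Rightarrow> 'm \<Rightarrow> 'v) \<Rightarrow> (nat \<Rightarrow> 'm \<Rightarrow> 'v) \<Rightarrow> 'm \<Rightarrow> nat \<Rightarrow> nat \<Rightarrow> real" where
  "Q e e' x s v = E_pair (E_frame A e v x) (E_frame A e' (dual rk s) x)"

lemma odd_image_Q:
  assumes c: "c \<in> coord_systems A" "x \<in> coord_dom c" and c': "c' \<in> coord_systems A" "x \<in> coord_dom c'"
    and s: "s < 2 * rk"
  shows "odd_image A c c' x s (S, K) =
    (if \<exists>v<2*rk. S = {v} \<and> K = {#} then Q (coord_frame c) (coord_frame c') x s (the_elem S) else 0)"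
proof -
  obtain U \<phi> V e where ce: "c = ((U, \<phi>), (V, e))" by (metis surj_pair)
  obtain U' \<phi>' V' e' where ce': "c' = ((U', \<phi>'), (V', e'))" by (metis surj_pair)
  have fr: "(V, e) \<in> frames A" "x \<in> V" using c by (auto simp: ce coord_systems_def coord_dom_def)
  have fr': "(V', e') \<in> frames A" "x \<in> V'" using c' by (auto simp: ce' coord_systems_def coord_dom_def)
  have F [simp]: "coord_frame c = e" "coord_frame c' = e'" by (auto simp: ce ce' coord_frame_def)
  show ?thesis
  proof (cases "s < rk")
    case True
    have "odd_image A c c' x s (S, K) = (\<Sum>\<beta><rk. coframe A e' s x (e \<beta> x) * (if S = {\<beta>} \<and> K = {#} then 1 else 0))"
      using True by (simp add: odd_image_def Let_def single_def)
    also have "\<dots> = (\<Sum>v<2*rk. Q e e' x s v * (if S = {v} \<and> K = {#} then 1 else 0))"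
      unfolding sum_lessThan_double using True coframe_zero[OF fr'] coframe_zero[OF fr]
      by (auto simp: Q_def E_frame_def E_pair_def dual_def intro!: sum.cong)
    finally have *: "odd_image A c c' x s (S, K) = (\<Sum>v<2*rk. Q e e' x s v * (if S = {v} \<and> K = {#} then 1 else 0))" .
    show ?thesis
    proof (cases "\<exists>v<2*rk. S = {v} \<and> K = {#}")
      case True
      then obtain v where "v < 2 * rk" "S = {v}" "K = {#}" by blast
      then show ?thesis unfolding * by (simp add: if_distrib[of "\<lambda>z. _ * z"] cong: if_cong)
    qed (auto simp: * intro!: sum.neutral)
  next
    case False
    have "odd_image A c c' x s (S, K) = (\<Sum>\<beta><rk. coframe A e \<beta> x (e' (s - rk) x) * (if S = {rk + \<beta>} \<and> K = {#} then 1 else 0))"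
      using False by (simp add: odd_image_def Let_def single_def)
    also have "\<dots> = (\<Sum>v<2*rk. Q e e' x s v * (if S = {v} \<and> K = {#} then 1 else 0))"
      unfolding sum_lessThan_double using False s coframe_zero[OF fr'] coframe_zero[OF fr]
      by (auto simp: Q_def E_frame_def E_pair_def dual_def intro!: sum.cong)
    finally have *: "odd_image A c c' x s (S, K) = (\<Sum>v<2*rk. Q e e' x s v * (if S = {v} \<and> K = {#} then 1 else 0))" .
    show ?thesis
    proof (cases "\<exists>v<2*rk. S = {v} \<and> K = {#}")
      case True
      then obtain v where "v < 2 * rk" "S = {v}" "K = {#}" by blast
      then show ?thesis unfolding * by (simp add: if_distrib[of "\<lambda>z. _ * z"] cong: if_cong)
    qed (auto simp: * intro!: sum.neutral)
  qed
qed

end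

context skew_ctx
begin

lemma quad_nz:
  assumes "quad c m x \<noteq> 0"
  obtains j t where "c \<in> coord_systems A" "x \<in> coord_dom c" "j < t" "t < 2 * rk" "m = ({j, t}, {#})"
proof -
  have "c \<in> coord_systems A \<and> x \<in> coord_dom c \<and> snd m = {#} \<and> (\<exists>j t. j < t \<and> t < 2 * rk \<and> fst m = {j, t})"
    using assms unfolding quad_def by presburger
  then show ?thesis using that by (metis prod.collapse)
qed

text \<open>No \<open>p\<close> occurs, so only \<open>Q\<close> acts, and a matrix of pairings
  transforms by \<open>Q\<close> in both arguments. Skewness folds the resulting double sum into the
  minors that \<open>gmult_linear\<close> produces from the product of two transformed
  generators.\<close>

lemma quad_transform:
  assumes c: "c \<in> coord_systems A" "x \<in> coord_dom c" and c': "c' \<in> coord_systems A" "x \<in> coord_dom c'"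
  shows "quad c m x = (\<Sum>m'\<in>{m'. quad c' m' x \<noteq> 0}. quad c' m' x * mono_image A c c' x m' m)"
proof -
  obtain U \<phi> V e where ce: "c = ((U, \<phi>), (V, e))" by (metis surj_pair)
  obtain U' \<phi>' V' e' where ce': "c' = ((U', \<phi>'), (V', e'))" by (metis surj_pair)
  have fr: "(V, e) \<in> frames A" "x \<in> V" using c by (auto simp: ce coord_systems_def coord_dom_def)
  have fr': "(V', e') \<in> frames A" "x \<in> V'" using c' by (auto simp: ce' coord_systems_def coord_dom_def)
  have F [simp]: "coord_frame c = e" "coord_frame c' = e'" by (auto simp: ce ce' coord_frame_def)
  define q where "q = Q e e' x"
  define M' where "M' j t = E_pair (NN x (E_frame A e' j x)) (E_frame A e' t x)" for j t
  have M'_skew: "M' t j = - M' j t" if "j < 2 * rk" "t < 2 * rk" for j t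
    unfolding M'_def using NN_skew[OF E_frame_in[OF fr'] E_frame_in[OF fr']] that by blast
  have M'_diag: "M' j j = 0" if "j < 2 * rk" for j
    using M'_skew[OF that that] by simp
  obtain S K where m: "m = (S, K)" by (cases m)
  let ?P = "\<lambda>S K. K = {#} \<and> (\<exists>u v. u < v \<and> v < 2 * rk \<and> S = {u, v})"
  have mi: "mono_image A c c' x ({j, t}, {#}) (S, K) =
      (if ?P S K then q j (Min S) * q t (Max S) - q j (Max S) * q t (Min S) else 0)" if "j < t" "t < 2 * rk" for j t
  proof -
    have sl: "sorted_list_of_set {j, t} = [j, t]"
      using that by (subst sorted_list_of_set_insert_remove) auto
    have "odd_image A c c' x t (S, K) = 0" if "infinite S" for S K
      using that \<open>t < 2 * rk\<close> by (auto simp: odd_image_Q[OF c c'])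
    then have mi': "mono_image A c c' x ({j, t}, {#}) = gmult (odd_image A c c' x j) (odd_image A c c' x t)"
      by (simp add: mono_image_def sl gmult_one_right)
    have j: "j < 2 * rk" using that by simp
    show ?thesis unfolding mi'
      by (rule gmult_linear)
        (simp_all only: odd_image_Q[OF c c' j] odd_image_Q[OF c c' that(2)] q_def F)
  qed
  let ?I = "{(j, t). j < t \<and> t < 2 * rk}"
  have finI: "finite ?I" by (rule finite_subset[of _ "{..<2*rk} \<times> {..<2*rk}"]) auto
  have inj: "inj_on (\<lambda>(j, t). ({j, t}, {#} :: nat multiset)) ?I"
    by (auto simp: inj_on_def doubleton_eq_iff)
  have "(\<Sum>m'\<in>{m'. quad c' m' x \<noteq> 0}. quad c' m' x * mono_image A c c' x m' m) =
      (\<Sum>m'\<in>(\<lambda>(j, t). ({j, t}, {#})) ` ?I. quad c' m' x * mono_image A c c' x m' m)"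
    by (rule sum.mono_neutral_left) (use finI in \<open>auto elim!: quad_nz\<close>)
  also have "\<dots> = (\<Sum>(j, t)\<in>?I. quad c' ({j, t}, {#}) x * mono_image A c c' x ({j, t}, {#}) m)"
    by (subst sum.reindex[OF inj]) (simp add: case_prod_beta)
  also have "\<dots> = (\<Sum>(j, t)\<in>?I. M' j t * (if ?P S K then q j (Min S) * q t (Max S) - q j (Max S) * q t (Min S) else 0))"
    by (intro sum.cong refl) (auto simp: mi m quad_pair[OF c'] M'_def)
  finally have R: "(\<Sum>m'\<in>{m'. quad c' m' x \<noteq> 0}. quad c' m' x * mono_image A c c' x m' m) =
    (\<Sum>(j, t)\<in>?I. M' j t * (if ?P S K then q j (Min S) * q t (Max S) - q j (Max S) * q t (Min S) else 0))" .
  show ?thesis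
  proof (cases "?P S K")
    case False
    then have "quad c m x = 0" unfolding m quad_def by auto
    then show ?thesis unfolding R if_not_P[OF False] by simp
  next
    case True
    then obtain u v where uv: "u < v" "v < 2 * rk" "S = {u, v}" "K = {#}" by blast
    then have mm: "Min S = u" "Max S = v" by auto
    have d: "E_frame A e u x \<in> E_fibre A x" "E_frame A e v x \<in> E_fibre A x"
      using uv by (auto intro!: E_frame_in[OF fr])
    have exp: "E_pair (NN x (E_frame A e a x)) w = (\<Sum>j<2*rk. q j a * E_pair (NN x (E_frame A e' j x)) w)"
      if "a < 2 * rk" "w \<in> E_fibre A x" for a w
    proof -
      have "E_pair (NN x (E_frame A e a x)) w = (\<Sum>s<2*rk. q (dual rk s) a * E_pair (NN x (E_frame A e' (dual rk s) x)) w)"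
        using pair_NN_expand[OF fr' E_frame_in[OF fr that(1)] that(2)]
        by (simp add: q_def Q_def dual_dual)
      then show ?thesis
        using sum_dual[of "\<lambda>s. q s a * E_pair (NN x (E_frame A e' s x)) w" rk] by simp
    qed
    have "quad c m x = E_pair (NN x (E_frame A e u x)) (E_frame A e v x)"
      using quad_pair[OF c uv(1,2)] by (simp add: m uv)
    also have "\<dots> = (\<Sum>j<2*rk. q j u * E_pair (NN x (E_frame A e' j x)) (E_frame A e v x))"
      using exp[OF _ d(2)] uv by simp
    also have "\<dots> = (\<Sum>j<2*rk. q j u * (\<Sum>t<2*rk. q t v * M' j t))"
    proof (intro sum.cong refl)
      fix j assume j: "j \<in> {..<2*rk}"
      have "E_pair (NN x (E_frame A e' j x)) (E_frame A e v x) = - E_pair (NN x (E_frame A e v x)) (E_frame A e' j x)"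
        using j by (intro NN_skew E_frame_in[OF fr'] d) auto
      also have "\<dots> = - (\<Sum>t<2*rk. q t v * M' t j)"
        unfolding M'_def using exp[OF uv(2) E_frame_in[OF fr', of j]] j by simp
      also have "\<dots> = (\<Sum>t<2*rk. q t v * M' j t)"
        unfolding sum_negf[symmetric]
      proof (intro sum.cong refl)
        fix t assume "t \<in> {..<2*rk}"
        then have "M' t j = - M' j t" using j by (intro M'_skew) auto
        then show "- (q t v * M' t j) = q t v * M' j t" by simp
      qed
      finally show "q j u * E_pair (NN x (E_frame A e' j x)) (E_frame A e v x) = q j u * (\<Sum>t<2*rk. q t v * M' j t)" by simp
    qed
    also have "\<dots> = (\<Sum>j<2*rk. \<Sum>t<2*rk. M' j t * (q j u * q t v))"
      by (simp add: sum_distrib_left mult_ac)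
    also have "\<dots> = (\<Sum>(j, t)\<in>?I. M' j t * (q j u * q t v) + M' t j * (q t u * q j v))"
      using M'_diag by (intro sum_pairs_skew) simp
    also have "\<dots> = (\<Sum>(j, t)\<in>?I. M' j t * (if ?P S K then q j (Min S) * q t (Max S) - q j (Max S) * q t (Min S) else 0))"
      unfolding if_P[OF True] mm
    proof (intro sum.cong refl, clarify)
      fix j t assume "j < t" "t < 2 * rk"
      then have "M' t j = - M' j t" by (intro M'_skew) auto
      then show "M' j t * (q j u * q t v) + M' t j * (q t u * q j v) = M' j t * (q j u * q t v - q j v * q t u)"
        by (simp add: algebra_simps)
    qed
    finally show ?thesis unfolding R .
  qed
qed

lemma quad_deg: "quad \<in> gfun_deg A 2"
  unfolding gfun_deg_def mem_Collect_eq
proof (intro conjI allI impI ballI)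
  fix c :: "('m, 'v) coords" and S :: "nat set" and K :: "nat multiset" and x
  assume "quad c (S, K) x \<noteq> 0"
  then obtain j t where h: "c \<in> coord_systems A" "x \<in> coord_dom c" "j < t" "t < 2 * rk" "(S, K) = ({j, t}, {#})"
    by (rule quad_nz)
  then show "c \<in> coord_systems A" "x \<in> coord_dom c" "S \<subseteq> {..<2 * rk}" "set_mset K \<subseteq> {..<nn}" "mono_deg (S, K) = 2"
    by (auto simp: mono_deg_def)
next
  fix c :: "('m, 'v) coords" and m assume c: "c \<in> coord_systems A"
  obtain U \<phi> V e where ce: "c = ((U, \<phi>), (V, e))" by (metis surj_pair)
  have ch: "(U, \<phi>) \<in> charts A" and fr: "(V, e) \<in> frames A" using c by (auto simp: ce coord_systems_def)
  have dom: "coord_dom c = U \<inter> V" and op: "open (U \<inter> V)"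
    using chart(1)[OF ch] frame(1)[OF fr] by (auto simp: ce coord_dom_def)
  show "smooth_on_base A (coord_dom c) (quad c m)"
  proof (cases "\<exists>j t. j < t \<and> t < 2 * rk \<and> m = ({j, t}, {#})")
    case True
    then obtain j t where h: "j < t" "t < 2 * rk" "m = ({j, t}, {#})" by blast
    have "smooth_on_base A (U \<inter> V) (\<lambda>x. E_pair (NN x (E_frame A e j x)) (E_frame A e t x))"
      using h by (intro smooth_on_base_subset[OF NN_smooth[OF fr]]) auto
    then have "smooth_on_base A (U \<inter> V) (quad c m)"
      by (rule smooth_on_base_cong[OF op, rotated]) (use h c in \<open>auto simp: quad_def ce coord_dom_def coord_frame_def\<close>)
    then show ?thesis by (simp add: dom)
  next
    case False
    have "quad c m x = 0" for x
    proof (rule ccontr)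
      assume "quad c m x \<noteq> 0"
      then show False by (rule quad_nz) (use False in blast)
    qed
    then have "quad c m = (\<lambda>_. 0)" by (rule ext)
    then show ?thesis by (simp add: smooth_on_base_const)
  qed
next
  fix c c' :: "('m, 'v) coords" and x m
  assume "c \<in> coord_systems A" "c' \<in> coord_systems A" "x \<in> coord_dom c \<inter> coord_dom c'"
  then show "quad c m x = (\<Sum>m'\<in>{m'. quad c' m' x \<noteq> 0}. quad c' m' x * mono_image A c c' x m' m)"
    by (intro quad_transform) auto
qed

end

section \<open>Brackets of linear with quadratic elements\<close>

lemma gcoeff_scalar_left:
  assumes p: "\<And>m. m \<noteq> ({}, {#}) \<Longrightarrow> gcoeff p m = 0" and S: "finite S"
  shows "gcoeff (p * z) (S, K) = gcoeff p ({}, {#}) * gcoeff z (S, K)"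
proof -
  have "gcoeff (p * z) (S, K) =
    (\<Sum>(m1, m2)\<in>{(({}, {#}), (S, K))}. sg (fst m1) (fst m2) * (gcoeff p m1 * gcoeff z m2))"
    unfolding gcoeff_times[OF S]
  proof (rule sum.mono_neutral_right[OF finite_splits[OF S]])
    show "\<forall>q\<in>splits (S, K) - {(({}, {#}), (S, K))}. (case q of (m1, m2) \<Rightarrow> sg (fst m1) (fst m2) * (gcoeff p m1 * gcoeff z m2)) = 0"
    proof
      fix q assume q: "q \<in> splits (S, K) - {(({}, {#}), (S, K))}"
      obtain S1 K1 S2 K2 where [simp]: "q = ((S1, K1), (S2, K2))" by (metis surj_pair)
      have "(S1, K1) \<noteq> ({}, {#})" using q by (auto simp: splits_iff)
      then show "(case q of (m1, m2) \<Rightarrow> sg (fst m1) (fst m2) * (gcoeff p m1 * gcoeff z m2)) = 0"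
        using p by simp
    qed
  qed (auto simp: splits_iff)
  then show ?thesis by (simp add: sg_def)
qed

lemma gcoeff_scalar_right:
  assumes p: "\<And>m. m \<noteq> ({}, {#}) \<Longrightarrow> gcoeff p m = 0" and S: "finite S"
  shows "gcoeff (z * p) (S, K) = gcoeff z (S, K) * gcoeff p ({}, {#})"
proof -
  have "gcoeff (z * p) (S, K) =
    (\<Sum>(m1, m2)\<in>{((S, K), ({}, {#}))}. sg (fst m1) (fst m2) * (gcoeff z m1 * gcoeff p m2))"
    unfolding gcoeff_times[OF S]
  proof (rule sum.mono_neutral_right[OF finite_splits[OF S]])
    show "\<forall>q\<in>splits (S, K) - {((S, K), ({}, {#}))}. (case q of (m1, m2) \<Rightarrow> sg (fst m1) (fst m2) * (gcoeff z m1 * gcoeff p m2)) = 0"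
    proof
      fix q assume q: "q \<in> splits (S, K) - {((S, K), ({}, {#}))}"
      obtain S1 K1 S2 K2 where [simp]: "q = ((S1, K1), (S2, K2))" by (metis surj_pair)
      have "(S2, K2) \<noteq> ({}, {#})" using q by (auto simp: splits_iff)
      then show "(case q of (m1, m2) \<Rightarrow> sg (fst m1) (fst m2) * (gcoeff z m1 * gcoeff p m2)) = 0"
        using p by simp
    qed
  qed (auto simp: splits_iff)
  then show ?thesis by (simp add: sg_def)
qed

lemma gcoeff_parity_lder_linear:
  assumes y: "\<And>m. \<not> (\<exists>s. m = ({s}, {#})) \<Longrightarrow> gcoeff y m = 0"
  shows "gcoeff (parity (lder s y)) m = (if m = ({}, {#}) then gcoeff y ({s}, {#}) else 0)"
proof (cases m)
  case (Pair S K)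
  show ?thesis
  proof (cases "m = ({}, {#})")
    case True
    then show ?thesis by (simp add: gcoeff_lder sg_def)
  next
    case False
    have "gcoeff y (insert s S, K) = 0" if "s \<notin> S"
    proof (rule y, rule notI, elim exE)
      fix s' assume "(insert s S, K) = ({s'}, {#})"
      then have h: "insert s S = {s'}" "K = {#}" by auto
      then have "S = {}" using that by blast
      then show False using False Pair h by simp
    qed
    then show ?thesis using False Pair by (auto simp: gcoeff_lder)
  qed
qed

context diff_ring
begin

lemma homogeneous_degree: "homogeneous (\<lambda>_. 1) 2 (int k) a \<Longrightarrow> gcoeff a (S, K) \<noteq> 0 \<Longrightarrow> finite S \<and> card S + 2 * size K = k"
  using homogeneous_D[of "\<lambda>_. 1" 2 "int k" a S K] gcoeff_infinite[of S a K] by auto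

text \<open>\<open>y\<close> is free of \<open>p\<close>, and the derivative of a quadratic element
  along \<open>p_i\<close> is a function. So the bracket consists of a derivative of
  \<open>y\<close> along the \<open>p\<close>-coefficients of \<open>b\<close> and of a matrix
  acting on the values of \<open>y\<close>.\<close>

lemma br_linear_quadratic:
  assumes y: "\<And>m. \<not> (\<exists>s. m = ({s}, {#})) \<Longrightarrow> gcoeff y m = 0"
    and b: "homogeneous (\<lambda>_. 1) 2 2 b"
  shows "gcoeff (br y b) ({t}, {#}) =
    (\<Sum>i<n. d i (gcoeff y ({t}, {#})) * gcoeff b ({}, {#i#})) +
    (\<Sum>s<2 * r. gcoeff y ({s}, {#}) * gcoeff (lder (dual r s) b) ({t}, {#}))"
proof -
  have py: "pder i y = 0" for i
    by (rule gpoly_eqI) (auto simp: gcoeff_pder y)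
  have pb: "gcoeff (pder i b) m = 0" if "m \<noteq> ({}, {#})" for i m
  proof (rule ccontr)
    obtain S K where m: "m = (S, K)" by (cases m)
    assume nz: "gcoeff (pder i b) m \<noteq> 0"
    then have "gcoeff b (S, add_mset i K) \<noteq> 0" by (auto simp: m gcoeff_pder)
    then have "finite S" "card S + 2 * size (add_mset i K) = 2"
      using homogeneous_degree[of 2 b S "add_mset i K"] b by auto
    then have "S = {}" "K = {#}" by auto
    then show False using that m by simp
  qed
  have "gcoeff (cder i y * pder i b) ({t}, {#}) = d i (gcoeff y ({t}, {#})) * gcoeff b ({}, {#i#})" for i
    using gcoeff_scalar_right[of "pder i b" "{t}" "cder i y" "{#}", OF pb] by (simp add: gcoeff_pder)
  moreover have "gcoeff (parity (lder s y) * lder (dual r s) b) ({t}, {#}) =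
      gcoeff y ({s}, {#}) * gcoeff (lder (dual r s) b) ({t}, {#})" for s
    using gcoeff_scalar_left[of "parity (lder s y)" "{t}" "lder (dual r s) b" "{#}"] gcoeff_parity_lder_linear[OF y, of s]
    by (simp del: gcoeff_parity)
  ultimately show ?thesis by (simp add: br_def gcoeff_sum py del: gcoeff_cder gcoeff_parity)
qed

end

lemma E_sections_D:
  assumes "u \<in> E_sections A" 
  shows "u x \<in> E_fibre A x"
    and "(V, e) \<in> frames A \<Longrightarrow> \<alpha> < bundle_rank A \<Longrightarrow> smooth_on_base A V (\<lambda>x. coframe A e \<alpha> x (fst (u x)))"
    and "(V, e) \<in> frames A \<Longrightarrow> \<alpha> < bundle_rank A \<Longrightarrow> smooth_on_base A V (\<lambda>x. snd (u x) (e \<alpha> x))"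
proof -
  have 1: "\<forall>x. u x \<in> E_fibre A x" and 2: "\<forall>(V, e)\<in>frames A. \<forall>\<alpha><bundle_rank A.
        smooth_on_base A V (\<lambda>x. coframe A e \<alpha> x (fst (u x))) \<and>
        smooth_on_base A V (\<lambda>x. snd (u x) (e \<alpha> x))"
    using assms unfolding E_sections_def mem_Collect_eq by simp_all
  show "u x \<in> E_fibre A x" using 1 by blast
  show "smooth_on_base A V (\<lambda>x. coframe A e \<alpha> x (fst (u x)))" "smooth_on_base A V (\<lambda>x. snd (u x) (e \<alpha> x))"
    if "(V, e) \<in> frames A" "\<alpha> < bundle_rank A"
    using bspec[OF 2 that(1)] that(2) by simp_all
qed

context coord_ctx
begin

lemma of_section_c:
  assumes "\<And>x. u x \<in> E_fibre A x" "t < 2 * rk"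
  shows "of_section A u c ({t}, {#}) x = (if x \<in> D then E_pair (u x) (E_frame A e t x) else 0)"
proof (cases "x \<in> D")
  case True
  then show ?thesis
    using of_section_component[OF fr D_V[OF True] ch D_U[OF True], of u t] assms by (simp add: c_def)
next
  case False
  then show ?thesis by (simp add: of_section_def)
qed

lemma E_pair_frame:
  assumes "u \<in> E_fibre A x" "x \<in> V"
  shows "E_pair u (E_frame A e t x) = (if t < rk then snd u (e t x) else coframe A e (t - rk) x (fst u))"
  using assms dual_at_0 by (auto simp: E_pair_def E_frame_def E_fibre_def coframe_zero[OF fr])

lemma good_of_section:
  assumes u: "u \<in> E_sections A"
  shows "good (of_section A u)"
  unfolding good_def
proof (intro conjI allI impI)
  fix m :: mono
  show "of_section A u c m \<in> smooth_coeffs"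
  proof (cases "\<exists>t<2*rk. m = ({t}, {#})")
    case True
    then obtain t where t: "t < 2 * rk" "m = ({t}, {#})" by blast
    let ?f = "\<lambda>x. if t < rk then snd (u x) (e t x) else coframe A e (t - rk) x (fst (u x))"
    have uE: "u x \<in> E_fibre A x" for x by (rule E_sections_D(1)[OF u])
    have eq: "of_section A u c m x = (if x \<in> D then ?f x else 0)" for x
      unfolding t(2) of_section_c[of u, OF uE t(1)] using E_pair_frame[OF uE D_V, of x t] by auto
    have "smooth_on_base A D ?f"
    proof (cases "t < rk")
      case True
      then have "smooth_on_base A V ?f" using E_sections_D(3)[OF u fr True] by simp
      then show ?thesis by (rule smooth_on_base_subset) (auto simp: D_def)
    next
      case False
      then have "smooth_on_base A V ?f" using E_sections_D(2)[OF u fr, of "t - rk"] t(1) by simp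
      then show ?thesis by (rule smooth_on_base_subset) (auto simp: D_def)
    qed
    then have "smooth_on_base A D (of_section A u c m)"
      by (rule smooth_on_base_cong[OF open_D, rotated]) (simp only: eq if_True)
    then show ?thesis
      by (rule smooth_coeffsI) (simp only: eq if_False)
  next
    case False
    then have "of_section A u c m = 0" using of_section_other[OF False, of u c] by (intro ext) simp
    then show ?thesis by (simp add: zero_C)
  qed
next
  fix S :: "nat set" and K :: "nat multiset" assume "infinite S"
  then show "of_section A u c (S, K) = 0"
    by (intro ext) (auto intro!: of_section_other)
qed

lemma pl_of_section_other:
  assumes u: "u \<in> E_sections A" and m: "\<not> (\<exists>t<2*rk. m = ({t}, {#}))"
  shows "gcoeff (pl (of_section A u)) m = 0"
  using of_section_other[OF m, of u c] by (simp add: gcoeff_pl[OF good_of_section[OF u]] fun_eq_iff)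

lemma homogeneous_of_section:
  assumes u: "u \<in> E_sections A"
  shows "homogeneous (\<lambda>_. 1) 2 1 (pl (of_section A u))" "in_vars (pl (of_section A u))"
proof -
  have *: "\<exists>t<2*rk. S = {t} \<and> K = {#}" if "gcoeff (pl (of_section A u)) (S, K) \<noteq> 0" for S K
    using pl_of_section_other[OF u, of "(S, K)"] that by (metis prod.inject)
  show "homogeneous (\<lambda>_. 1) 2 1 (pl (of_section A u))"
    unfolding homogeneous_def using * by fastforce
  show "in_vars (pl (of_section A u))"
    unfolding in_vars_def using * by fastforce
qed

lemma bracket_section_component:
  assumes u: "u \<in> E_sections A" and a: "a \<in> gfun_deg A 2" and x: "x \<in> D" and t: "t < 2 * rk"
  shows "big_bracket A (of_section A u) a c ({t}, {#}) x =
    (\<Sum>i<nn. partial i (of_section A u c ({t}, {#})) x * a c ({}, {#i#}) x) +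
    (\<Sum>s<2 * rk. E_pair (u x) (E_frame A e s x) * gcoeff (lder (dual rk s) (pl a)) ({t}, {#}) x)"
proof -
  note gu = good_of_section[OF u] and ga = good_gfun_deg[OF a]
  have "big_bracket A (of_section A u) a c ({t}, {#}) =
    (\<Sum>i<nn. partial i (gcoeff (pl (of_section A u)) ({t}, {#})) * gcoeff (pl a) ({}, {#i#})) +
    (\<Sum>s<2 * rk. gcoeff (pl (of_section A u)) ({s}, {#}) * gcoeff (lder (dual rk s) (pl a)) ({t}, {#}))"
    unfolding big_bracket_gcoeff[OF gu ga]
    by (rule br_linear_quadratic) (use pl_of_section_other[OF u] gfun_deg_in_vars(2)[OF a] in auto)
  then show ?thesis
    by (simp add: sum_apply gcoeff_pl[OF gu] gcoeff_pl[OF ga] of_section_c[OF E_sections_D(1)[OF u]] x cong: sum.cong_simp)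
qed

text \<open>The bracket has degree 1 and involves only generators in range, which leaves the single
  odd generators.\<close>

lemma bracket_section_other:
  assumes u: "u \<in> E_sections A" and a: "a \<in> gfun_deg A 2" and m: "\<not> (\<exists>t<2*rk. m = ({t}, {#}))"
  shows "big_bracket A (of_section A u) a c m = 0"
proof (rule ccontr)
  note gu = good_of_section[OF u] and ga = good_gfun_deg[OF a]
  obtain S K where mm: "m = (S, K)" by (cases m)
  assume "big_bracket A (of_section A u) a c m \<noteq> 0"
  then have nz: "gcoeff (br (pl (of_section A u)) (pl a)) (S, K) \<noteq> 0"
    by (simp add: big_bracket_gcoeff[OF gu ga] mm)
  have "homogeneous (\<lambda>_. 1) 2 (1 + int 2 - 2) (br (pl (of_section A u)) (pl a))"
    by (rule homogeneous_br[OF _ homogeneous_of_section(1)[OF u] gfun_deg_in_vars(2)[OF a]]) simp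
  then have 1: "finite S \<and> card S + 2 * size K = 1" using homogeneous_degree[of 1] nz by simp
  have "in_vars (br (pl (of_section A u)) (pl a))"
    by (rule in_vars_br[OF homogeneous_of_section(2)[OF u] gfun_deg_in_vars(1)[OF a]])
  then have 2: "S \<subseteq> {..<2 * rk}" using in_vars_D nz by blast
  from 1 have c: "card S + 2 * size K = 1" by simp
  then have "size K = 0" by presburger
  then have "card S = 1" "K = {#}" using c by simp_all
  then show False using 2 m mm by (auto simp: card_1_singleton_iff)
qed

section \<open>Global sections from cut-off frame elements, and uniqueness of the quadratic
  function\<close>

definition glob :: "nat \<Rightarrow> ('m \<Rightarrow> real) \<Rightarrow> 'm \<Rightarrow> 'v gvec" where
  "glob s g x = (if x \<in> V then E_scale (g x) (E_frame A e s x) else 0)"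

text \<open>\<open>V'\<close> is covered by \<open>V \<inter> V'\<close>, where the component is a
  product of smooth functions, and by \<open>V' - K\<close>, where it is 0.\<close>

lemma glob_smooth:
  assumes V': "(V', e') \<in> frames A" and g: "smooth_on_base A UNIV g" "closed K" "K \<subseteq> V" "\<And>x. x \<notin> K \<Longrightarrow> g x = 0"
    and h: "smooth_on_base A (V \<inter> V') h" and F: "\<And>x. x \<in> V \<inter> V' \<Longrightarrow> F x = g x * h x" "\<And>x. x \<in> V' - V \<Longrightarrow> F x = 0"
  shows "smooth_on_base A V' F"
proof -
  have o: "open (V \<inter> V')" "open (V' - K)" using frame(1)[OF fr] frame(1)[OF V'] g(2) by auto
  have "smooth_on_base A (V \<inter> V') (\<lambda>x. g x * h x)" by (intro smooth_on_base_mult o h smooth_on_base_subset[OF g(1)]) auto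
  then have 1: "smooth_on_base A (V \<inter> V') F"
    by (rule smooth_on_base_cong[OF o(1), rotated]) (simp add: F(1))
  have 2: "smooth_on_base A (V' - K) F"
  proof (rule smooth_on_base_cong[OF o(2) _ smooth_on_base_const[of _ 0]])
    fix x assume "x \<in> V' - K"
    then show "0 = F x" using F g(4) by (cases "x \<in> V") auto
  qed
  have "V' = (V \<inter> V') \<union> (V' - K)" using g(3) by blast
  then show ?thesis using smooth_on_base_Un[OF o 1 2] by simp
qed

lemma glob_E_sections:
  assumes g: "smooth_on_base A UNIV g" "closed K" "K \<subseteq> V" "\<And>x. x \<notin> K \<Longrightarrow> g x = 0" and s: "s < 2 * rk"
  shows "glob s g \<in> E_sections A"
  unfolding E_sections_def mem_Collect_eq
proof (intro conjI allI ballI, goal_cases)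
  case (1 x)
  then show ?case using E_frame_in[OF fr _ s] by (auto simp: glob_def E_fibre_0 intro!: E_fibre_scale)
next
  case (2 p)
  obtain V' e' where p: "p = (V', e')" by (cases p)
  have fr': "(V', e') \<in> frames A" using 2 by (simp add: p)
  have fib: "fst (E_frame A e s x) \<in> fibre A x" if "x \<in> V" for x
    using E_frame_in[OF fr that s] by (auto simp: E_fibre_def)
  show ?case unfolding p prod.case
  proof (intro allI impI conjI)
    fix \<alpha> assume \<alpha>: "\<alpha> < rk"
    have "smooth_on_base A (V \<inter> V') (\<lambda>x. coframe A e' \<alpha> x (fst (E_frame A e s x)))"
    proof (cases "s < rk")
      case True
      then show ?thesis using frame_transition[OF fr fr' \<alpha> True] by (simp add: E_frame_def)
    next
      case False
      have "smooth_on_base A (V \<inter> V') (\<lambda>x. 0)" by (rule smooth_on_base_const)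
      then show ?thesis
        by (rule smooth_on_base_cong[rotated 2]) (use False frame(1)[OF fr] frame(1)[OF fr'] in \<open>auto simp: E_frame_def coframe_zero[OF fr']\<close>)
    qed
    from glob_smooth[OF fr' g(1-3) _ this, of "\<lambda>x. coframe A e' \<alpha> x (fst (glob s g x))"]
    show "smooth_on_base A V' (\<lambda>x. coframe A e' \<alpha> x (fst (glob s g x)))"
      using g(4) by (auto simp: glob_def coframe_scale[OF fr' _ fib] coframe_zero[OF fr'])
    have "smooth_on_base A (V \<inter> V') (\<lambda>x. snd (E_frame A e s x) (e' \<alpha> x))"
    proof (cases "s < rk")
      case False
      then have "smooth_on_base A (V' \<inter> V) (\<lambda>x. coframe A e (s - rk) x (e' \<alpha> x))"
        using frame_transition[OF fr' fr _ \<alpha>] s by simp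
      then show ?thesis using False by (simp add: E_frame_def Int_commute)
    qed (simp add: E_frame_def smooth_on_base_const)
    from glob_smooth[OF fr' g(1-3) _ this, of "\<lambda>x. snd (glob s g x) (e' \<alpha> x)"]
    show "smooth_on_base A V' (\<lambda>x. snd (glob s g x) (e' \<alpha> x))"
      using g(4) by (auto simp: glob_def)
  qed
qed

lemma glob_pair:
  assumes "x \<in> V" "s < 2 * rk" "t < 2 * rk"
  shows "E_pair (glob s g x) (E_frame A e t x) = (if t = dual rk s then g x else 0)"
  using assms E_frame_in[OF fr assms(1)] E_frame_pair[OF fr assms(1)]
  by (simp add: glob_def E_pair_scale_left[where x = x])

text \<open>A section that vanishes at \<open>x\<close> shows only its first derivatives there, and
  so isolates the \<open>p\<close>-coefficients. Once these agree, a section that equals a frame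
  element at \<open>x\<close> isolates a row of the odd coefficients. Positive rank provides the
  frame element.\<close>

lemma bracket_determines:
  assumes rk: "rk > 0" and a: "a \<in> gfun_deg A 2" and b: "b \<in> gfun_deg A 2" and x: "x \<in> D"
    and eq: "\<And>u. u \<in> E_sections A \<Longrightarrow> big_bracket A (of_section A u) a = big_bracket A (of_section A u) b"
  shows "a c m x = b c m x"
proof -
  have DU: "D \<subseteq> U" by (auto simp: D_def)
  obtain g K where g: "closed K" "K \<subseteq> D" "\<And>z. z \<notin> K \<Longrightarrow> g z = 0" "g x = 1" "smooth_on_base A UNIV g"
    using bump[OF ch open_D DU x] by metis
  have KV: "K \<subseteq> V" using g(2) D_V by blast
  have E: "(\<Sum>i<nn. partial i (of_section A (glob s h) c ({t}, {#})) x * (a c ({}, {#i#}) x - b c ({}, {#i#}) x)) +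
    (\<Sum>s'<2 * rk. E_pair (glob s h x) (E_frame A e s' x) * (gcoeff (lder (dual rk s') (pl a)) ({t}, {#}) x - gcoeff (lder (dual rk s') (pl b)) ({t}, {#}) x)) = 0"
    if h: "smooth_on_base A UNIV h" "\<And>z. z \<notin> K \<Longrightarrow> h z = 0" and st: "s < 2 * rk" "t < 2 * rk" for h s t
  proof -
    have u: "glob s h \<in> E_sections A" by (rule glob_E_sections[OF h(1) g(1) KV h(2) st(1)])
    have "big_bracket A (of_section A (glob s h)) a c ({t}, {#}) x = big_bracket A (of_section A (glob s h)) b c ({t}, {#}) x"
      by (simp only: eq[OF u])
    then show ?thesis
      unfolding bracket_section_component[OF u a x st(2)] bracket_section_component[OF u b x st(2)]
      by (simp only: right_diff_distrib sum_subtractf)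
  qed
  have p: "a c ({}, {#i#}) x = b c ({}, {#i#}) x" if i: "i < nn" for i
  proof -
    \<comment> \<open>This function vanishes at \<open>x\<close>, and its partial derivatives there
      are those of the coordinate \<open>i\<close>, because \<open>g x = 1\<close>.\<close>
    define h where "h z = g z * (\<phi> z i - \<phi> x i)" for z
    have hz: "h z = 0" if "z \<notin> K" for z using g(3)[OF that] by (simp add: h_def)
    have oU: "open U" by (rule chart(1)[OF ch])
    have gU: "smooth_on_base A U g" by (rule smooth_on_base_subset[OF g(5)]) simp
    have hU: "smooth_on_base A U h" unfolding h_def
      by (rule smooth_on_base_mult[OF oU gU smooth_on_base_diff[OF oU smooth_on_base_coord[OF ch i] smooth_on_base_const]])
    have KU: "K \<subseteq> U" using g(2) DU by (rule subset_trans)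
    have hs: "smooth_on_base A UNIV h"
      by (rule smooth_on_base_extend_zero[OF oU g(1) KU hU hz open_UNIV])
    \<comment> \<open>The section is \<open>h\<close> times the frame element 0 of \<open>A\<close>;
      its coefficient stands at the generator \<open>dual rk 0\<close>, which is
      \<open>rk\<close>.\<close>
    have co: "of_section A (glob 0 h) c ({rk}, {#}) = h"
    proof
      fix z
      have in_E: "glob 0 h z \<in> E_fibre A z" for z
        by (rule E_sections_D(1)[OF glob_E_sections[OF hs g(1) KV hz]]) (use rk in simp_all)
      have "of_section A (glob 0 h) c ({rk}, {#}) z = (if z \<in> D then E_pair (glob 0 h z) (E_frame A e rk z) else 0)"
        by (rule of_section_c[OF in_E]) (use rk in simp)
      also have "\<dots> = h z"
        using rk glob_pair[OF D_V, of z 0 rk h] hz[of z] g(2) by (auto simp: dual_def)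
      finally show "of_section A (glob 0 h) c ({rk}, {#}) z = h z" .
    qed
    have hd: "partial j h x = (if j = i then 1 else 0)" if j: "j < nn" for j
    proof -
      have s1: "smooth_Rn nn (\<phi> ` D) (g \<circ> inv_into U \<phi>)"
        by (rule smooth_Rn_subset[OF smooth_on_base_D[OF g(5) ch]]) (auto simp: D_def)
      have s2: "smooth_Rn nn (\<phi> ` D) (\<lambda>y. y i + - \<phi> x i)"
        by (intro smooth_Rn_add open_image smooth_Rn_coord smooth_Rn_const)
      have d2: "pderiv_at j (\<lambda>y. y i + - \<phi> x i) y = (if j = i then 1 else 0)" for y
        unfolding pderiv_at_def by (rule DERIV_imp_deriv) (auto intro!: derivative_eq_intros)
      have "partial j h x = pderiv_at j (\<lambda>y. (g \<circ> inv_into U \<phi>) y * (y i + - \<phi> x i)) (\<phi> x)"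
        unfolding partial_def using j x
        by (simp, intro pderiv_at_cong[OF open_image image_D[OF x] j]) (auto simp: h_def chart_inv[OF ch] D_def)
      also have "\<dots> = (if j = i then 1 else 0)"
        using pderiv_at_mult[OF s1 s2 image_D[OF x] j] chart_inv[OF ch D_U[OF x]] g(4)
        unfolding d2 by simp
      finally show ?thesis .
    qed
    have hx: "h x = 0" by (simp add: h_def)
    have "(\<Sum>j<nn. (if j = i then 1 else 0) * (a c ({}, {#j#}) x - b c ({}, {#j#}) x)) = 0"
    proof -
      have "E_pair (glob 0 h x) (E_frame A e t x) = 0" if "t < 2 * rk" for t
        using glob_pair[OF D_V[OF x] _ that, of 0 h] rk hx by simp
      then show ?thesis
        using E[OF hs hz, of 0 rk] rk by (simp add: co hd cong: sum.cong_simp)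
    qed
    then show ?thesis using i by (simp add: if_distrib[of "\<lambda>z. z * _"] cong: if_cong)
  qed
  have l: "gcoeff (lder s (pl a)) ({t}, {#}) x = gcoeff (lder s (pl b)) ({t}, {#}) x" if st: "s < 2 * rk" "t < 2 * rk" for s t
  proof -
    have "(\<Sum>s'<2 * rk. (if s' = dual rk s then 1 else 0) *
        (gcoeff (lder (dual rk s') (pl a)) ({t}, {#}) x - gcoeff (lder (dual rk s') (pl b)) ({t}, {#}) x)) = 0"
    proof -
      have "E_pair (glob s g x) (E_frame A e t x) = (if t = dual rk s then 1 else 0)" if "t < 2 * rk" for t
        using glob_pair[OF D_V[OF x] st(1) that, of g] g(4) by simp
      then show ?thesis
        using E[OF g(5,3) st] by (simp add: p cong: sum.cong_simp)
    qed
    then show ?thesis using st dual_less[of s rk] by (simp add: if_distrib[of "\<lambda>z. z * _"] dual_dual cong: if_cong)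
  qed
  have q: "a c ({s, t}, {#}) x = b c ({s, t}, {#}) x" if "s < t" "t < 2 * rk" for s t
  proof -
    have "(sg {s} {t} :: 'm \<Rightarrow> real) x \<noteq> 0" by (simp add: sg_apply gsign_def)
    then show ?thesis using l[of s t] that
      by (auto simp: gcoeff_lder gcoeff_pl[OF good_gfun_deg[OF a]] gcoeff_pl[OF good_gfun_deg[OF b]])
  qed
  obtain S K where m: "m = (S, K)" by (cases m)
  show ?thesis
  proof (cases "S \<subseteq> {..<2 * rk} \<and> set_mset K \<subseteq> {..<nn} \<and> mono_deg (S, K) = 2")
    case False
    then have "a c (S, K) x = 0" using gfun_deg_support(3-5)[OF a, of c S K x] by blast
    moreover have "b c (S, K) x = 0" using False gfun_deg_support(3-5)[OF b, of c S K x] by blast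
    ultimately show ?thesis by (simp add: m)
  next
    case True
    then have "card S + 2 * size K = 2" and S: "finite S" by (auto simp: mono_deg_def intro: finite_subset)
    then consider "card S = 2" "K = {#}" | "S = {}" "size K = 1" by (cases "size K") auto
    then show ?thesis
    proof cases
      case 1
      obtain j t where "j < t" "S = {j, t}" using card_2_ordered[OF 1(1)] by blast
      then show ?thesis using q[of j t] True 1 by (simp add: m)
    next
      case 2
      then obtain i where "K = {#i#}" by (metis size_1_singleton_mset)
      then show ?thesis using p[of i] True 2 by (simp add: m)
    qed
  qed
qed

end

section \<open>Evaluation of \<open>tilde\<close>\<close>

context skew_ctx
begin

text \<open>The sign of the left derivative restores the full skew matrix from the upper triangle
  stored in \<open>quad\<close>.\<close>

lemma lder_quad:
  assumes co: "coord_ctx A U \<phi> V e" and x: "x \<in> U" "x \<in> V" and jt: "j < 2 * rk" "t < 2 * rk"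
  shows "gcoeff (lder j (coord_ctx.pl U \<phi> V e quad)) ({t}, {#}) x = E_pair (NN x (E_frame A e j x)) (E_frame A e t x)"
proof -
  interpret coord_ctx A U \<phi> V e by (rule co)
  have cx: "c \<in> coord_systems A" "x \<in> coord_dom c" using c_in x by (auto simp: D_def)
  let ?M = "\<lambda>j t. E_pair (NN x (E_frame A e j x)) (E_frame A e t x)"
  have sk: "?M t j = - ?M j t" using NN_skew[OF E_frame_in[OF fr x(2)] E_frame_in[OF fr x(2)]] jt by blast
  have g: "gcoeff (pl quad) m = quad c m" for m by (rule gcoeff_pl[OF good_gfun_deg[OF quad_deg]])
  consider "j = t" | "j < t" | "t < j" by linarith
  then show ?thesis
  proof cases
    case 1
    then show ?thesis using sk by (simp add: gcoeff_lder)
  next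
    case 2
    then have "{u \<in> {t}. u < j} = {}" by auto
    then have "sg {j} {t} = (1 :: 'm \<Rightarrow> real)" unfolding sg_singleton by (simp only: card.empty power_0)
    then show ?thesis using 2 quad_pair[OF cx 2 jt(2)] by (simp add: gcoeff_lder g)
  next
    case 3
    then have "{u \<in> {t}. u < j} = {t}" by auto
    then have "sg {j} {t} = (- 1 :: 'm \<Rightarrow> real)" unfolding sg_singleton by (simp only:) simp
    then show ?thesis using 3 quad_pair[OF cx 3 jt(1)] sk by (simp add: gcoeff_lder g insert_commute)
  qed
qed

lemma quad_pder: "quad c (S, add_mset i K) x = 0"
  by (simp add: quad_def)

lemma section_bracket_quad:
  assumes u: "u \<in> E_sections A"
  shows "of_section A (\<lambda>x. NN x (u x)) = big_bracket A (of_section A u) quad"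
proof (intro ext)
  fix c :: "('m, 'v) coords" and m x
  show "of_section A (\<lambda>x. NN x (u x)) c m x = big_bracket A (of_section A u) quad c m x"
  proof (cases "c \<in> coord_systems A \<and> x \<in> coord_dom c")
    case False
    then show ?thesis by (auto simp: of_section_def big_bracket_def)
  next
    case True
    obtain U \<phi> V e where ce: "c = ((U, \<phi>), (V, e))" by (metis surj_pair)
    have mem: "(U, \<phi>) \<in> charts A" "(V, e) \<in> frames A" "x \<in> U" "x \<in> V"
      using True by (auto simp: ce coord_systems_def coord_dom_def)
    have co: "coord_ctx A U \<phi> V e" using mem by unfold_locales
    interpret co: coord_ctx A U \<phi> V e by (rule co)
    have cc: "co.c = c" by (simp add: co.c_def ce)
    have xD: "x \<in> co.D" using mem by (simp add: co.D_def)
    note uE = E_sections_D(1)[OF u, of x]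
    show ?thesis
    proof (cases "\<exists>t<2*rk. m = ({t}, {#})")
      case False
      have "big_bracket A (of_section A u) quad c m = 0"
        using co.bracket_section_other[OF u quad_deg False] by (simp add: cc)
      then show ?thesis using of_section_other[OF False] by simp
    next
      case True
      then obtain t where t: "t < 2 * rk" "m = ({t}, {#})" by blast
      have "big_bracket A (of_section A u) quad c ({t}, {#}) x =
        (\<Sum>s<2 * rk. E_pair (u x) (E_frame A e s x) * gcoeff (lder (dual rk s) (co.pl quad)) ({t}, {#}) x)"
        using co.bracket_section_component[OF u quad_deg xD t(1)] by (simp add: cc quad_pder)
      also have "\<dots> = (\<Sum>s<2*rk. E_pair (u x) (E_frame A e s x) * E_pair (NN x (E_frame A e (dual rk s) x)) (E_frame A e t x))"
        by (intro sum.cong refl) (simp add: lder_quad[OF co mem(3,4) dual_less t(1)])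
      also have "\<dots> = E_pair (NN x (u x)) (E_frame A e t x)"
        by (rule pair_NN_expand[OF mem(2,4) uE E_frame_in[OF mem(2,4) t(1)], symmetric])
      also have "\<dots> = of_section A (\<lambda>x. NN x (u x)) c ({t}, {#}) x"
        unfolding ce using of_section_component[OF mem(2,4,1,3), of "\<lambda>x. NN x (u x)" t] NN_in[OF uE] t(1) by simp
      finally show ?thesis by (simp add: t)
    qed
  qed
qed

text \<open>Existence is \<open>section_bracket_quad\<close>, uniqueness is
  \<open>bracket_determines\<close>. From here on \<open>tilde\<close> can be replaced by an
  explicit element.\<close>

lemma tilde_quad:
  assumes rk: "rk > 0"
  shows "tilde A NN = quad"
  unfolding tilde_def
proof (rule the_equality)
  show "quad \<in> gfun_deg A 2 \<and> (\<forall>u\<in>E_sections A. of_section A (\<lambda>x. NN x (u x)) = big_bracket A (of_section A u) quad)"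
    using quad_deg section_bracket_quad by blast
next
  fix a assume a: "a \<in> gfun_deg A 2 \<and> (\<forall>u\<in>E_sections A. of_section A (\<lambda>x. NN x (u x)) = big_bracket A (of_section A u) a)"
  show "a = quad"
  proof (intro ext)
    fix c :: "('m, 'v) coords" and m x
    show "a c m x = quad c m x"
    proof (cases "c \<in> coord_systems A \<and> x \<in> coord_dom c")
      case False
      then have "a c m x = 0" using a gfun_deg_support(1,2)[of a A 2 c "fst m" "snd m" x] by auto
      moreover have "quad c m x = 0" using False by (auto simp: quad_def)
      ultimately show ?thesis by simp
    next
      case True
      obtain U \<phi> V e where ce: "c = ((U, \<phi>), (V, e))" by (metis surj_pair)
      have mem: "(U, \<phi>) \<in> charts A" "(V, e) \<in> frames A" "x \<in> U" "x \<in> V"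
        using True by (auto simp: ce coord_systems_def coord_dom_def)
      interpret co: coord_ctx A U \<phi> V e using mem by unfold_locales
      have cc: "co.c = c" by (simp add: co.c_def ce)
      have xD: "x \<in> co.D" using mem by (simp add: co.D_def)
      have "a co.c m x = quad co.c m x"
        by (rule co.bracket_determines[OF rk _ quad_deg xD]) (use a section_bracket_quad in auto)
      then show ?thesis by (simp add: cc)
    qed
  qed
qed

end

section \<open>Block endomorphisms\<close>

context vbundle_ctx
begin

lemma endomorphism_D:
  assumes "endomorphism A N"
  shows "v \<in> fibre A x \<Longrightarrow> N x v \<in> fibre A x"
    and "v \<in> fibre A x \<Longrightarrow> w \<in> fibre A x \<Longrightarrow> N x (v + w) = N x v + N x w"
    and "v \<in> fibre A x \<Longrightarrow> N x (s *\<^sub>R v) = s *\<^sub>R N x v"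
    and "(V, e) \<in> frames A \<Longrightarrow> \<alpha> < rk \<Longrightarrow> \<beta> < rk \<Longrightarrow> smooth_on_base A V (\<lambda>x. coframe A e \<alpha> x (N x (e \<beta> x)))"
proof -
  note a = assms[unfolded endomorphism_def]
  have 1: "\<forall>x. \<forall>v\<in>fibre A x. N x v \<in> fibre A x"
    and 2: "\<forall>x. \<forall>v\<in>fibre A x. \<forall>w\<in>fibre A x. N x (v + w) = N x v + N x w"
    and 3: "\<forall>x s. \<forall>v\<in>fibre A x. N x (s *\<^sub>R v) = s *\<^sub>R N x v"
    and 4: "\<forall>(V, e)\<in>frames A. \<forall>\<alpha><rk. \<forall>\<beta><rk. smooth_on_base A V (\<lambda>x. coframe A e \<alpha> x (N x (e \<beta> x)))"
    using a by simp_all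
  show "v \<in> fibre A x \<Longrightarrow> N x v \<in> fibre A x" using 1 by blast
  show "v \<in> fibre A x \<Longrightarrow> w \<in> fibre A x \<Longrightarrow> N x (v + w) = N x v + N x w" using 2 by blast
  show "v \<in> fibre A x \<Longrightarrow> N x (s *\<^sub>R v) = s *\<^sub>R N x v" using 3 by blast
  assume "(V, e) \<in> frames A" "\<alpha> < rk" "\<beta> < rk"
  then show "smooth_on_base A V (\<lambda>x. coframe A e \<alpha> x (N x (e \<beta> x)))" using bspec[OF 4] by fastforce
qed

lemma endomorphism_0: "endomorphism A N \<Longrightarrow> N x 0 = 0"
  using endomorphism_D(3)[of N 0 x 0] by simp

lemma bivector_D:
  assumes "bivector A \<pi>"
  shows "\<xi> \<in> dual_fibre A x \<Longrightarrow> \<pi> x \<xi> \<in> fibre A x"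
    and "\<xi> \<in> dual_fibre A x \<Longrightarrow> \<eta> \<in> dual_fibre A x \<Longrightarrow> \<pi> x (\<lambda>w. \<xi> w + \<eta> w) = \<pi> x \<xi> + \<pi> x \<eta>"
    and "\<xi> \<in> dual_fibre A x \<Longrightarrow> \<pi> x (\<lambda>w. s * \<xi> w) = s *\<^sub>R \<pi> x \<xi>"
    and "(V, e) \<in> frames A \<Longrightarrow> \<alpha> < rk \<Longrightarrow> \<beta> < rk \<Longrightarrow>
      smooth_on_base A V (\<lambda>x. coframe A e \<alpha> x (\<pi> x (coframe A e \<beta> x)))"
    and "\<xi> \<in> dual_fibre A x \<Longrightarrow> \<eta> \<in> dual_fibre A x \<Longrightarrow> \<xi> (\<pi> x \<eta>) + \<eta> (\<pi> x \<xi>) = 0"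
proof -
  note a = assms[unfolded bivector_def]
  have 1: "\<forall>x. \<forall>\<xi>\<in>dual_fibre A x. \<pi> x \<xi> \<in> fibre A x"
    and 2: "\<forall>x. \<forall>\<xi>\<in>dual_fibre A x. \<forall>\<eta>\<in>dual_fibre A x. \<pi> x (\<lambda>w. \<xi> w + \<eta> w) = \<pi> x \<xi> + \<pi> x \<eta>"
    and 3: "\<forall>x s. \<forall>\<xi>\<in>dual_fibre A x. \<pi> x (\<lambda>w. s * \<xi> w) = s *\<^sub>R \<pi> x \<xi>"
    and 4: "\<forall>(V, e)\<in>frames A. \<forall>\<alpha><rk. \<forall>\<beta><rk.
        smooth_on_base A V (\<lambda>x. coframe A e \<alpha> x (\<pi> x (coframe A e \<beta> x)))"
    and 5: "\<forall>x. \<forall>\<xi>\<in>dual_fibre A x. \<forall>\<eta>\<in>dual_fibre A x. \<xi> (\<pi> x \<eta>) + \<eta> (\<pi> x \<xi>) = 0"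
    using a by simp_all
  show "\<xi> \<in> dual_fibre A x \<Longrightarrow> \<pi> x \<xi> \<in> fibre A x" using 1 by blast
  show "\<xi> \<in> dual_fibre A x \<Longrightarrow> \<eta> \<in> dual_fibre A x \<Longrightarrow> \<pi> x (\<lambda>w. \<xi> w + \<eta> w) = \<pi> x \<xi> + \<pi> x \<eta>" using 2 by blast
  show "\<xi> \<in> dual_fibre A x \<Longrightarrow> \<pi> x (\<lambda>w. s * \<xi> w) = s *\<^sub>R \<pi> x \<xi>" using 3 by blast
  show "\<xi> \<in> dual_fibre A x \<Longrightarrow> \<eta> \<in> dual_fibre A x \<Longrightarrow> \<xi> (\<pi> x \<eta>) + \<eta> (\<pi> x \<xi>) = 0" using 5 by blast
  assume "(V, e) \<in> frames A" "\<alpha> < rk" "\<beta> < rk"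
  then show "smooth_on_base A V (\<lambda>x. coframe A e \<alpha> x (\<pi> x (coframe A e \<beta> x)))" using bspec[OF 4] by fastforce
qed

lemma bivector_0: "bivector A \<pi> \<Longrightarrow> \<pi> x (\<lambda>_. 0) = 0"
  using bivector_D(3)[of \<pi> "\<lambda>_. 0" x 0] dual_0[of x] by (simp add: zero_fun_def)

lemma dual_D:
  assumes "\<xi> \<in> dual_fibre A x"
  shows "v \<in> fibre A x \<Longrightarrow> w \<in> fibre A x \<Longrightarrow> \<xi> (v + w) = \<xi> v + \<xi> w"
    and "v \<in> fibre A x \<Longrightarrow> \<xi> (s *\<^sub>R v) = s * \<xi> v"
    and "v \<notin> fibre A x \<Longrightarrow> \<xi> v = 0"
  using assms unfolding dual_fibre_def by blast+

lemma transp_dual: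
  assumes "endomorphism A N" "\<xi> \<in> dual_fibre A x"
  shows "(\<lambda>w. - transp A N x \<xi> w) \<in> dual_fibre A x"
  unfolding dual_fibre_def transp_def
  by (auto simp: endomorphism_D[OF assms(1)] dual_D(1,2)[OF assms(2)])

lemma smooth_zero:
  assumes "open W" "\<And>x. x \<in> W \<Longrightarrow> f x = 0"
  shows "smooth_on_base A W f"
  by (rule smooth_on_base_cong[OF assms(1) _ smooth_on_base_const[of _ 0]]) (simp add: assms(2))

lemma endomorphism_zero: "endomorphism A (\<lambda>x v. 0)"
proof -
  have "smooth_on_base A V (\<lambda>x. coframe A e \<alpha> x 0)" if "(V, e) \<in> frames A" for V e \<alpha>
    by (rule smooth_zero[OF frame(1)[OF that] coframe_zero[OF that]])
  then show ?thesis by (auto simp: endomorphism_def)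
qed

lemma bivector_zero: "bivector A (\<lambda>x \<xi>. 0)"
proof -
  have "smooth_on_base A V (\<lambda>x. coframe A e \<alpha> x 0)" if "(V, e) \<in> frames A" for V e \<alpha>
    by (rule smooth_zero[OF frame(1)[OF that] coframe_zero[OF that]])
  then show ?thesis by (auto simp: bivector_def dual_at_0)
qed

text \<open>Makes N^2 available as an endomorphism with its own quadratic function; its smoothness
  is that of a product of matrices.\<close>

lemma endomorphism_square:
  assumes N: "endomorphism A N"
  shows "endomorphism A (\<lambda>x v. N x (N x v))"
proof -
  have "smooth_on_base A V (\<lambda>x. coframe A e \<alpha> x (N x (N x (e \<beta> x))))"
    if fr: "(V, e) \<in> frames A" and ab: "\<alpha> < rk" "\<beta> < rk" for V e \<alpha> \<beta>
  proof -
    have o: "open V" by (rule frame(1)[OF fr])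
    have "smooth_on_base A V (\<lambda>x. \<Sum>\<gamma><rk. coframe A e \<gamma> x (N x (e \<beta> x)) * coframe A e \<alpha> x (N x (e \<gamma> x)))"
      by (intro smooth_on_base_sum[OF o] smooth_on_base_mult[OF o] endomorphism_D(4)[OF N fr]) (use ab in auto)
    then show ?thesis
    proof (rule smooth_on_base_cong[OF o, rotated])
      fix x assume x: "x \<in> V"
      have in1: "e \<gamma> x \<in> fibre A x" if "\<gamma> < rk" for \<gamma> by (rule frame_in_fibre[OF fr x that])
      have exp: "N x (N x (e \<beta> x)) = (\<Sum>\<gamma><rk. coframe A e \<gamma> x (N x (e \<beta> x)) *\<^sub>R N x (e \<gamma> x))"
      proof -
        have sumN: "N x (sum f I) = (\<Sum>i\<in>I. N x (f i))" if "finite I" "\<And>i. i \<in> I \<Longrightarrow> f i \<in> fibre A x" for f and I :: "nat set"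
          using that by (induction I) (auto simp: endomorphism_0[OF N] endomorphism_D(2)[OF N] fibre_sum)
        have "N x (e \<beta> x) = (\<Sum>\<gamma><rk. coframe A e \<gamma> x (N x (e \<beta> x)) *\<^sub>R e \<gamma> x)"
          by (rule frame_expand[OF fr x endomorphism_D(1)[OF N in1[OF ab(2)]]])
        then have "N x (N x (e \<beta> x)) = N x (\<Sum>\<gamma><rk. coframe A e \<gamma> x (N x (e \<beta> x)) *\<^sub>R e \<gamma> x)" by simp
        also have "\<dots> = (\<Sum>\<gamma><rk. N x (coframe A e \<gamma> x (N x (e \<beta> x)) *\<^sub>R e \<gamma> x))"
          by (rule sumN) (auto simp: in1)
        also have "\<dots> = (\<Sum>\<gamma><rk. coframe A e \<gamma> x (N x (e \<beta> x)) *\<^sub>R N x (e \<gamma> x))"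
          by (intro sum.cong refl endomorphism_D(3)[OF N]) (auto simp: in1)
        finally show ?thesis .
      qed
      have "coframe A e \<alpha> x (N x (N x (e \<beta> x))) = (\<Sum>\<gamma><rk. coframe A e \<alpha> x (coframe A e \<gamma> x (N x (e \<beta> x)) *\<^sub>R N x (e \<gamma> x)))"
        unfolding exp by (rule dual_sum[OF fr x coframe_dual[OF fr x]]) (auto simp: endomorphism_D(1)[OF N] in1)
      then show "(\<Sum>\<gamma><rk. coframe A e \<gamma> x (N x (e \<beta> x)) * coframe A e \<alpha> x (N x (e \<gamma> x))) = coframe A e \<alpha> x (N x (N x (e \<beta> x)))"
        by (simp add: coframe_scale[OF fr x endomorphism_D(1)[OF N in1]])
    qed
  qed
  then show ?thesis
    unfolding endomorphism_def by (auto simp: endomorphism_D(1-3)[OF N])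
qed

lemma block_endo_pair_frame:
  assumes N: "endomorphism A N" and \<pi>: "bivector A \<pi>" and fr: "(V, e) \<in> frames A" and x: "x \<in> V"
    and ab: "a < 2 * rk" "b < 2 * rk"
  shows "E_pair (block_endo A N \<pi> x (E_frame A e a x)) (E_frame A e b x) =
    (if a < rk then if b < rk then 0 else coframe A e (b - rk) x (N x (e a x))
     else if b < rk then - coframe A e (a - rk) x (N x (e b x)) else coframe A e (b - rk) x (\<pi> x (coframe A e (a - rk) x)))"
  using ab frame_in_fibre[OF fr x] endomorphism_0[OF N] bivector_0[OF \<pi>] coframe_zero[OF fr x]
  by (auto simp: E_pair_def block_endo_def E_frame_def transp_def)

text \<open>In the skewness condition the terms of \<open>N\<close> cancel against those of its
  negative transpose, and those of \<open>\<pi>\<close> cancel by the skewness of the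
  bivector.\<close>

lemma block_endo_skew:
  assumes N: "endomorphism A N" and \<pi>: "bivector A \<pi>"
  shows "skew_endomorphism A (block_endo A N \<pi>)"
  unfolding skew_endomorphism_def
proof (intro conjI)
  note ND = endomorphism_D[OF N] and pD = bivector_D[OF \<pi>]
  show "\<forall>x. \<forall>u\<in>E_fibre A x. block_endo A N \<pi> x u \<in> E_fibre A x"
    by (auto simp: E_fibre_def block_endo_def ND pD transp_dual[OF N])
  show "\<forall>x. \<forall>u\<in>E_fibre A x. \<forall>v\<in>E_fibre A x.
       block_endo A N \<pi> x (E_add u v) = E_add (block_endo A N \<pi> x u) (block_endo A N \<pi> x v)"
    by (auto simp: E_fibre_def block_endo_def E_add_def ND(2) pD(2) transp_def fun_eq_iff)
  show "\<forall>x s. \<forall>u\<in>E_fibre A x. block_endo A N \<pi> x (E_scale s u) = E_scale s (block_endo A N \<pi> x u)"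
    by (auto simp: E_fibre_def block_endo_def E_scale_def ND(3) pD(3) transp_def fun_eq_iff algebra_simps)
  show "\<forall>x. \<forall>u\<in>E_fibre A x. \<forall>v\<in>E_fibre A x. E_pair (block_endo A N \<pi> x u) v + E_pair u (block_endo A N \<pi> x v) = 0"
  proof (intro allI ballI)
    fix x u v assume "u \<in> E_fibre A x" "v \<in> E_fibre A x"
    then have h: "fst u \<in> fibre A x" "snd u \<in> dual_fibre A x" "fst v \<in> fibre A x" "snd v \<in> dual_fibre A x"
      by (auto simp: E_fibre_def)
    show "E_pair (block_endo A N \<pi> x u) v + E_pair u (block_endo A N \<pi> x v) = 0"
      using pD(5)[OF h(2,4)] h
      by (simp add: E_pair_def block_endo_def transp_def dual_D(1)[OF h(2)] dual_D(1)[OF h(4)] ND(1) pD(1))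
  qed
  show "\<forall>(V, e)\<in>frames A. \<forall>a<2 * rk. \<forall>b<2 * rk.
       smooth_on_base A V (\<lambda>x. E_pair (block_endo A N \<pi> x (E_frame A e a x)) (E_frame A e b x))"
  proof (clarify)
    fix V e a b assume fr: "(V, e) \<in> frames A" and ab: "a < 2 * rk" "b < 2 * rk"
    have o: "open V" by (rule frame(1)[OF fr])
    have "smooth_on_base A V (\<lambda>x. if a < rk then if b < rk then 0 else coframe A e (b - rk) x (N x (e a x))
     else if b < rk then - coframe A e (a - rk) x (N x (e b x)) else coframe A e (b - rk) x (\<pi> x (coframe A e (a - rk) x)))"
      using ND(4)[OF fr, of "b - rk" a] ND(4)[OF fr, of "a - rk" b] pD(4)[OF fr, of "b - rk" "a - rk"] ab
      by (cases "a < rk"; cases "b < rk") (simp_all add: smooth_on_base_const smooth_on_base_uminus[OF o])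
    then show "smooth_on_base A V (\<lambda>x. E_pair (block_endo A N \<pi> x (E_frame A e a x)) (E_frame A e b x))"
      by (rule smooth_on_base_cong[OF o, rotated]) (simp only: block_endo_pair_frame[OF N \<pi> fr _ ab])
  qed
qed

end

section \<open>Degree 1 elements and the Nijenhuis torsion\<close>

context diff_ring
begin

text \<open>Translation of the momenta preserves the bracket, whose structure constants in these
  coordinates are constant.\<close>

lemma pder_br:
  assumes "a \<in> SM" "b \<in> SM"
  shows "pder j (br a b) = br (pder j a) b + br a (pder j b)"
  using assms
  by (simp add: br_def pder_add pder_sum pder_minus pder_mult cder_pder lder_pder pder_pder[of j] sum.distrib
      sum_subtractf algebra_simps flip: parity_pder)

text \<open>Each \<open>p_i\<close> has degree 2, so the parity of the degree is that of the number
  of odd generators.\<close>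

lemma parity_homogeneous: "homogeneous (\<lambda>_. 1) 2 (int k) a \<Longrightarrow> parity a = (if even k then a else - a)"
proof (rule gpoly_eqI)
  fix S :: "nat set" and K :: "nat multiset"
  assume h: "homogeneous (\<lambda>_. 1) 2 (int k) a"
  show "gcoeff (parity a) (S, K) = gcoeff (if even k then a else - a) (S, K)"
  proof (cases "gcoeff a (S, K) = 0")
    case False
    then have "card S + 2 * size K = k" using homogeneous_degree[OF h] by blast
    then have "even (card S) = even k" by auto
    then show ?thesis by (cases "even k") simp_all
  qed simp
qed

text \<open>The coordinate form of a section of E, without any condition of smoothness, which is
  recorded separately by \<open>SM\<close>.\<close>

definition lin :: "'b gpoly \<Rightarrow> bool" where
  "lin y \<longleftrightarrow> homogeneous (\<lambda>_. 1) 2 1 y \<and> in_vars y"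

lemma lin_other:
  assumes "lin y" "\<not> (\<exists>s<2 * r. m = ({s}, {#}))"
  shows "gcoeff y m = 0"
proof (rule ccontr)
  assume nz: "gcoeff y m \<noteq> 0"
  obtain S K where m: "m = (S, K)" by (cases m)
  have "card S + 2 * size K = 1" "S \<subseteq> {..<2 * r}"
    using assms(1) nz homogeneous_degree[of 1 y S K] in_vars_D[of y S K] by (auto simp: lin_def m)
  then have "size K = 0" by presburger
  then have "K = {#}" "card S = 1" using \<open>card S + 2 * size K = 1\<close> by simp_all
  then show False using assms(2) \<open>S \<subseteq> {..<2 * r}\<close> by (auto simp: m card_1_singleton_iff)
qed

lemma lin_pder: "lin y \<Longrightarrow> pder i y = 0"
  by (rule gpoly_eqI) (simp add: gcoeff_pder lin_other)

lemma lin_add: "lin y \<Longrightarrow> lin z \<Longrightarrow> lin (y + z)"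
  and lin_minus: "lin y \<Longrightarrow> lin z \<Longrightarrow> lin (y - z)"
  by (auto simp: lin_def homogeneous_add in_vars_add homogeneous_minus in_vars_minus)

lemma lin_uminus: "lin y \<Longrightarrow> lin (- y)"
  using lin_minus[of 0 y] by (simp add: lin_def)

lemma homogeneous_br_degree: "homogeneous (\<lambda>_. 1) 2 k a \<Longrightarrow> homogeneous (\<lambda>_. 1) 2 l b \<Longrightarrow> homogeneous (\<lambda>_. 1) 2 (k + l - 2) (br a b)"
  by (rule homogeneous_br) auto

text \<open>Without \<open>p\<close> in \<open>b\<close> no derivative of the coefficients of
  \<open>y\<close> survives: the bracket is tensorial in \<open>y\<close>.\<close>

lemma br_linear_pfree:
  assumes y: "lin y" and b: "\<And>i. pder i b = 0" and S: "finite S"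
  shows "gcoeff (br y b) (S, K) = (\<Sum>s<2 * r. gcoeff y ({s}, {#}) * gcoeff (lder (dual r s) b) (S, K))"
proof -
  have y': "gcoeff y m = 0" if "\<not> (\<exists>s. m = ({s}, {#}))" for m
    using lin_other[OF y, of m] that by blast
  have "gcoeff (parity (lder s y) * lder (dual r s) b) (S, K) =
      gcoeff y ({s}, {#}) * gcoeff (lder (dual r s) b) (S, K)" for s
    using gcoeff_scalar_left[of "parity (lder s y)" S "lder (dual r s) b" K] gcoeff_parity_lder_linear[OF y', of s] S
    by (simp del: gcoeff_parity)
  then show ?thesis by (simp add: br_def gcoeff_sum lin_pder[OF y] b del: gcoeff_cder gcoeff_parity)
qed

end

section \<open>Linear elements as local sections of E\<close>

locale coord_skew = coord_ctx A U \<phi> V e + skew_ctx A NN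
  for A :: "('m::{t2_space, second_countable_topology}, 'v::real_vector) vbundle" and U \<phi> V e NN

context coord_ctx
begin

text \<open>Inverts \<open>of_section\<close> pointwise on \<open>D\<close> by the expansion
  \<open>E_expand\<close>, so that brackets of linear elements can be read as vectors in the
  fibres.\<close>

definition vec :: "('m \<Rightarrow> real) gpoly \<Rightarrow> 'm \<Rightarrow> 'v gvec" where
  "vec y x = (\<Sum>s<2 * rk. E_scale (gcoeff y ({s}, {#}) x) (E_frame A e (dual rk s) x))"

lemma vec_in: "x \<in> V \<Longrightarrow> vec y x \<in> E_fibre A x"
  unfolding vec_def by (intro E_fibre_sum E_fibre_scale E_frame_in[OF fr] dual_less) auto

lemma vec_pair:
  assumes x: "x \<in> V" and t: "t < 2 * rk"
  shows "E_pair (vec y x) (E_frame A e t x) = gcoeff y ({t}, {#}) x"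
proof -
  have "E_pair (vec y x) (E_frame A e t x) =
    (\<Sum>s<2*rk. E_pair (E_scale (gcoeff y ({s}, {#}) x) (E_frame A e (dual rk s) x)) (E_frame A e t x))"
    unfolding vec_def
    by (rule E_pair_sum_left[where x = x]) (auto intro!: E_fibre_scale E_frame_in[OF fr x] dual_less t)
  also have "\<dots> = (\<Sum>s<2*rk. if s = t then gcoeff y ({s}, {#}) x else 0)"
    using E_frame_pair[OF fr x dual_less t] E_frame_in[OF fr x] t
    by (intro sum.cong refl) (auto simp: E_pair_scale_left[where x = x] dual_less dual_dual)
  finally show ?thesis using t by simp
qed

lemma fst_vec: "fst (vec y x) = (\<Sum>\<alpha><rk. gcoeff y ({rk + \<alpha>}, {#}) x *\<^sub>R e \<alpha> x)"
  unfolding vec_def sum_lessThan_double by (simp add: fst_sum' E_frame_def dual_def)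

lemma vec_eqI:
  assumes "x \<in> V" "u \<in> E_fibre A x" "\<And>t. t < 2 * rk \<Longrightarrow> gcoeff y ({t}, {#}) x = E_pair u (E_frame A e t x)"
  shows "vec y x = u"
  unfolding vec_def by (subst E_expand[OF fr assms(1,2)]) (auto intro!: sum.cong simp: assms(3))

text \<open>\<open>vec\<close> sees single generators at points of \<open>D\<close>; linearity and
  \<open>SM\<close> make all remaining coefficients 0.\<close>

lemma lin_eqI:
  assumes "lin y" "lin z" "y \<in> SM" "z \<in> SM" "\<And>x. x \<in> D \<Longrightarrow> vec y x = vec z x"
  shows "y = z"
proof (rule gpoly_eqI, rule ext)
  fix S :: "nat set" and K :: "nat multiset" and x
  show "gcoeff y (S, K) x = gcoeff z (S, K) x"
  proof (cases "x \<in> D \<and> (\<exists>s<2 * rk. (S, K) = ({s}, {#}))")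
    case True
    then obtain s where "s < 2 * rk" "(S, K) = ({s}, {#})" by blast
    then show ?thesis using vec_pair[OF D_V, of x s y] vec_pair[OF D_V, of x s z] assms(5)[of x] True by simp
  next
    case False
    then show ?thesis
      using SM_outside[OF assms(3)] SM_outside[OF assms(4)] lin_other[OF assms(1)] lin_other[OF assms(2)]
      by (metis zero_fun_apply)
  qed
qed

lemma lin_of_section: "u \<in> E_sections A \<Longrightarrow> lin (pl (of_section A u))"
  by (simp add: lin_def homogeneous_of_section)

lemma vec_of_section: "u \<in> E_sections A \<Longrightarrow> x \<in> D \<Longrightarrow> vec (pl (of_section A u)) x = u x"
proof -
  assume u: "u \<in> E_sections A" and x: "x \<in> D"
  have uE: "u x \<in> E_fibre A x" for x by (rule E_sections_D(1)[OF u])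
  show ?thesis
    by (rule vec_eqI[OF D_V[OF x] uE]) (simp add: gcoeff_pl good_of_section[OF u] of_section_c[of u, OF uE] x)
qed

end

context coord_skew
begin

lemma quad_SM [simp]: "pl quad \<in> SM"
  by (rule SM_pl[OF good_gfun_deg[OF quad_deg]])

lemma quad_even: "parity (pl quad) = pl quad"
  using parity_homogeneous[OF gfun_deg_in_vars(2)[OF quad_deg]] by simp

lemma quad_pfree: "pder i (pl quad) = 0"
proof (rule gpoly_eqI)
  fix S :: "nat set" and K :: "nat multiset"
  have "quad c (S, add_mset i K) = 0" by (rule ext) (simp add: quad_pder)
  then show "gcoeff (pder i (pl quad)) (S, K) = gcoeff 0 (S, K)"
    by (simp add: gcoeff_pder gcoeff_pl[OF good_gfun_deg[OF quad_deg]])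
qed

lemma lin_br_quad: "lin y \<Longrightarrow> lin (br y (pl quad))"
  unfolding lin_def
  using homogeneous_br_degree[of 1 y 2 "pl quad"] in_vars_br[of y "pl quad"] gfun_deg_in_vars[OF quad_deg] by simp

text \<open>Extends the characterisation of the quadratic function from global sections to all
  linear elements, as needed for the derivatives of \<mu> along \<open>p_i\<close> and for derived
  brackets.\<close>

lemma vec_br_quad:
  assumes y: "lin y" and x: "x \<in> D"
  shows "vec (br y (pl quad)) x = NN x (vec y x)"
proof (rule vec_eqI[OF D_V[OF x] NN_in[OF vec_in[OF D_V[OF x]]]])
  fix t assume t: "t < 2 * rk"
  have co: "coord_ctx A U \<phi> V e" by unfold_locales
  have "gcoeff (br y (pl quad)) ({t}, {#}) x =
      (\<Sum>s<2*rk. gcoeff y ({s}, {#}) x * gcoeff (lder (dual rk s) (pl quad)) ({t}, {#}) x)"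
    by (simp add: br_linear_pfree[OF y quad_pfree] sum_apply)
  also have "\<dots> = (\<Sum>s<2*rk. E_pair (vec y x) (E_frame A e s x) * E_pair (NN x (E_frame A e (dual rk s) x)) (E_frame A e t x))"
    by (intro sum.cong refl)
      (simp add: vec_pair[OF D_V[OF x]] lder_quad[OF co D_U[OF x] D_V[OF x] dual_less t])
  also have "\<dots> = E_pair (NN x (vec y x)) (E_frame A e t x)"
    by (rule pair_NN_expand[OF fr D_V[OF x] vec_in[OF D_V[OF x]] E_frame_in[OF fr D_V[OF x] t], symmetric])
  finally show "gcoeff (br y (pl quad)) ({t}, {#}) x = E_pair (NN x (vec y x)) (E_frame A e t x)" .
qed

lemma br_quad_swap: "br (pl quad) y = - br y (pl quad)"
  by (rule br_even_swap[OF quad_SM quad_even])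

end

section \<open>Deformation of a derived bracket\<close>

context diff_ring
begin

text \<open>Two Jacobi identities move \<open>h\<close> outwards. Let B be the derived bracket of
  \<open>v\<close>, and let \<open>h\<close> act by \<open>Z \<mapsto> br Z h\<close>, so that
  \<open>br h Z\<close> is minus this action. The right side is then B(hX,Y) + B(X,hY) - h B(X,Y),
  the bracket B deformed by \<open>h\<close>.\<close>

lemma derived_bracket_even:
  assumes SM: "h \<in> SM" "X \<in> SM" "Y \<in> SM" "v \<in> SM" and h: "parity h = h" "\<And>i. pder i h = 0"
  shows "br (br X (br h v)) Y = br h (br (br X v) Y) + br (br (br X h) v) Y + br (br X v) (br Y h)"
proof -
  have s: "br h Z = - br Z h" for Z by (rule br_even_swap[OF SM(1) h(1)])
  have "br h (br X v) = br (br h X) v + br X (br h v)"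
    by (rule br_jacobi_even[OF SM(1,2,4) h])
  then have 1: "br X (br h v) = br h (br X v) + br (br X h) v"
    using SM by (simp add: s[of X] br_uminus_left)
  have "br h (br (br X v) Y) = br (br h (br X v)) Y + br (br X v) (br h Y)"
    using SM by (intro br_jacobi_even[OF SM(1) _ _ h]) simp_all
  then have "br (br h (br X v)) Y = br h (br (br X v) Y) + br (br X v) (br Y h)"
    using SM by (simp add: s[of Y] br_uminus_right)
  then show ?thesis unfolding 1 using SM by (simp add: br_add_left)
qed

end

section \<open>The torsion element of a Nijenhuis tensor\<close>

locale nijenhuis_ctx = coord_ctx A U \<phi> V e
  for A :: "('m::{t2_space, second_countable_topology}, 'v::real_vector) vbundle" and U \<phi> V e +
  fixes \<mu> :: "('m, 'v) gfun" and N :: "'m \<Rightarrow> 'v \<Rightarrow> 'v"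
  assumes mu: "lie_algebroid A \<mu>" and N: "endomorphism A N" and nij: "nijenhuis_tensor A \<mu> N"
begin

abbreviation "NE \<equiv> block_endo A N (\<lambda>x \<xi>. 0)"
abbreviation "N2E \<equiv> block_endo A (\<lambda>x v. N x (N x v)) (\<lambda>x \<xi>. 0)"

sublocale N: coord_skew A U \<phi> V e NE
  by unfold_locales (rule block_endo_skew[OF N bivector_zero])

sublocale N2: coord_skew A U \<phi> V e N2E
  by unfold_locales (rule block_endo_skew[OF endomorphism_square[OF N] bivector_zero])

abbreviation "n1 \<equiv> pl N.quad"
abbreviation "n2 \<equiv> pl N2.quad"
abbreviation "m \<equiv> pl \<mu>"

lemma mu_deg: "\<mu> \<in> gfun_deg A 3" and mu_mu: "big_bracket A \<mu> \<mu> = gzero"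
  using mu unfolding lie_algebroid_def by blast+

lemma good_mu: "good \<mu>" by (rule good_gfun_deg[OF mu_deg])

lemma m_SM [simp]: "m \<in> SM" by (rule SM_pl[OF good_mu])

lemma m_odd: "parity m = - m"
  using parity_homogeneous[OF gfun_deg_in_vars(2)[OF mu_deg]] by simp

lemma m_m: "br m m = 0"
  using pl_big_bracket[OF good_mu good_mu] by (simp add: mu_mu)

text \<open>The number of factors \<open>\<theta>\<^sub>\<alpha>\<close> and \<open>p\<^sub>i\<close> of a monomial; \<open>N\<close> and \<open>\<mu>\<close> have exactly one, and so have their brackets.\<close>

definition momentum_weight :: "nat \<Rightarrow> int" where "momentum_weight s = (if s < rk then 0 else 1)"

lemma momentum_weight_dual: "s < 2 * rk \<Longrightarrow> momentum_weight s + momentum_weight (dual rk s) = 1"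
  by (auto simp: momentum_weight_def dual_def)

lemma nonzero_point: "f \<noteq> (0 :: 'm \<Rightarrow> real) \<Longrightarrow> \<exists>x. f x \<noteq> 0"
  by (rule ccontr) (metis ext zero_fun_apply)

text \<open>A block diagonal endomorphism maps A and its dual to themselves, so its entries on the
  frame pair one index below \<open>rk\<close> with one above: every monomial is a
  \<tau>\<theta>.\<close>

lemma block_quad_weight:
  assumes N': "endomorphism A N'" and sk: "skew_ctx A (block_endo A N' (\<lambda>x \<xi>. 0))"
  shows "homogeneous momentum_weight 1 1 (pl (skew_ctx.quad A (block_endo A N' (\<lambda>x \<xi>. 0))))"
  unfolding homogeneous_def
proof (intro allI impI)
  fix S :: "nat set" and K :: "nat multiset"
  interpret sk: skew_ctx A "block_endo A N' (\<lambda>x \<xi>. 0)" by (rule sk)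
  assume "gcoeff (pl sk.quad) (S, K) \<noteq> 0"
  then obtain x where nz: "sk.quad c (S, K) x \<noteq> 0"
    using nonzero_point by (auto simp: gcoeff_pl[OF good_gfun_deg[OF sk.quad_deg]])
  then obtain j t where h: "x \<in> coord_dom c" "j < t" "t < 2 * rk" "(S, K) = ({j, t}, {#})"
    by (rule sk.quad_nz)
  have x: "x \<in> D" "x \<in> V" using h(1) D_V by auto
  have "E_pair (block_endo A N' (\<lambda>x \<xi>. 0) x (E_frame A e j x)) (E_frame A e t x) \<noteq> 0"
    using nz sk.quad_pair[OF c_in h(1-3)] h(4) by simp
  then have "j < rk \<and> \<not> t < rk \<or> \<not> j < rk \<and> t < rk"
    using block_endo_pair_frame[OF N' bivector_zero fr x(2), of j t] h(2,3) coframe_zero[OF fr x(2)]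
    by (auto split: if_splits)
  then show "sum momentum_weight S + 1 * int (size K) = 1" using h by (auto simp: momentum_weight_def)
qed

lemma n1_weight: "homogeneous momentum_weight 1 1 n1" and n2_weight: "homogeneous momentum_weight 1 1 n2"
  by (rule block_quad_weight[OF N], unfold_locales)
    (rule block_quad_weight[OF endomorphism_square[OF N]], unfold_locales)

lemma m_weight: "homogeneous momentum_weight 1 1 m"
  unfolding homogeneous_def
proof (intro allI impI)
  fix S :: "nat set" and K :: "nat multiset"
  assume "gcoeff m (S, K) \<noteq> 0"
  then obtain x where nz: "\<mu> c (S, K) x \<noteq> 0" using nonzero_point by (auto simp: gcoeff_pl[OF good_mu])
  have "\<forall>c m x. \<mu> c m x \<noteq> 0 \<longrightarrow>
        (\<exists>\<alpha><rk. \<exists>i<nn. m = ({\<alpha>}, {#i#})) \<or>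
        (\<exists>\<alpha><rk. \<exists>\<beta><rk. \<exists>\<gamma><rk. \<alpha> \<noteq> \<beta> \<and> m = ({\<alpha>, \<beta>, rk + \<gamma>}, {#}))"
    using mu unfolding lie_algebroid_def by (elim conjE)
  with nz consider \<alpha> i where "\<alpha> < rk" "(S, K) = ({\<alpha>}, {#i#})" |
    \<alpha> \<beta> \<gamma> where "\<alpha> < rk" "\<beta> < rk" "\<alpha> \<noteq> \<beta>" "(S, K) = ({\<alpha>, \<beta>, rk + \<gamma>}, {#})"
    by meson
  then show "sum momentum_weight S + 1 * int (size K) = 1"
    by cases (auto simp: momentum_weight_def)
qed

definition T :: "('m \<Rightarrow> real) gpoly" where
  "T = br n1 (br n1 m) - br n2 m"

lemma T_SM [simp]: "T \<in> SM" by (simp add: T_def)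

lemma T_degree: "homogeneous (\<lambda>_. 1) 2 3 T"
proof -
  note d = gfun_deg_in_vars(2)[OF mu_deg] gfun_deg_in_vars(2)[OF N.quad_deg] gfun_deg_in_vars(2)[OF N2.quad_deg]
  have "homogeneous (\<lambda>_. 1) 2 3 (br n1 m)" "homogeneous (\<lambda>_. 1) 2 3 (br n2 m)"
    using homogeneous_br_degree[OF d(2,1)] homogeneous_br_degree[OF d(3,1)] by simp_all
  moreover have "homogeneous (\<lambda>_. 1) 2 3 (br n1 (br n1 m))"
    using homogeneous_br_degree[OF d(2) calculation(1)] by simp
  ultimately show ?thesis unfolding T_def by (intro homogeneous_minus)
qed

lemma T_weight: "homogeneous momentum_weight 1 1 T"
proof -
  have b: "homogeneous momentum_weight 1 1 (br a b)" if "homogeneous momentum_weight 1 1 a" "homogeneous momentum_weight 1 1 b" for a b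
    using homogeneous_br[of momentum_weight 1, OF momentum_weight_dual that] by simp
  show ?thesis unfolding T_def by (intro homogeneous_minus b n1_weight n2_weight m_weight)
qed

lemma T_vars: "in_vars T"
  unfolding T_def
  by (intro in_vars_minus in_vars_br gfun_deg_in_vars(1)[OF N.quad_deg] gfun_deg_in_vars(1)[OF N2.quad_deg]
      gfun_deg_in_vars(1)[OF mu_deg])

lemma lin_pder_m: "lin (pder i m)"
  using homogeneous_pder[OF gfun_deg_in_vars(2)[OF mu_deg], of i] in_vars_pder[OF gfun_deg_in_vars(1)[OF mu_deg], of i]
  by (simp add: lin_def)

lemma NE_fst: "fst (NE x u) = N x (fst u)" and NE_snd: "snd (NE x u) = (\<lambda>w. - transp A N x (snd u) w)"
  and N2E_fst: "fst (N2E x u) = N x (N x (fst u))" and N2E_snd: "snd (N2E x u) = (\<lambda>w. - transp A (\<lambda>x v. N x (N x v)) x (snd u) w)"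
  by (simp_all add: block_endo_def)

text \<open>The derivative \<open>q\<close> of \<mu> along \<open>p_i\<close> is a covector. The
  double bracket with \<open>n1\<close> acts on it by the square of the negative transpose, and
  \<open>- br n2 q\<close> by the negative transpose of N^2, so the two cancel. This fixes the sign
  of the second term in \<open>T\<close>.\<close>

lemma T_pfree: "pder i T = 0"
proof -
  define q where "q = pder i m"
  have q: "lin q" "q \<in> SM" by (simp_all add: q_def lin_pder_m)
  have "pder i T = br n1 (br n1 q) - br n2 q"
    by (simp add: T_def pder_minus pder_br N.quad_pfree N2.quad_pfree q_def)
  also have "\<dots> = br (br q n1) n1 + br q n2"
    using q by (simp add: N.br_quad_swap N2.br_quad_swap br_uminus_left)
  also have "\<dots> = 0"
  proof (rule lin_eqI)
    show "lin (br (br q n1) n1 + br q n2)" by (intro lin_add N.lin_br_quad N2.lin_br_quad q)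
    show "lin 0" by (simp add: lin_def)
    show "br (br q n1) n1 + br q n2 \<in> SM" using q by simp
    fix x assume x: "x \<in> D"
    define v where "v = vec q x"
    have vE: "v \<in> E_fibre A x" unfolding v_def by (rule vec_in[OF D_V[OF x]])
    \<comment> \<open>\<mu> has one momentum in each term and the derivative along
      \<open>p_i\<close> consumes it, so no \<theta> is left in \<open>q\<close> and its A-part
      vanishes.\<close>
    have "homogeneous momentum_weight 1 0 q" using homogeneous_pder[OF m_weight, of i] by (simp add: q_def)
    have z: "gcoeff q ({rk + \<alpha>}, {#}) = 0" if "\<alpha> < rk" for \<alpha>
      using homogeneous_D[OF \<open>homogeneous momentum_weight 1 0 q\<close>, of "{rk + \<alpha>}" "{#}"] by (auto simp: momentum_weight_def)
    have fv: "fst v = 0" unfolding v_def fst_vec by (simp add: z)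
    have snd0: "snd (NE x (NE x v)) w + snd (N2E x v) w = 0" if "w \<in> fibre A x" for w
      using that endomorphism_D(1)[OF N that] by (simp add: NE_snd N2E_snd transp_def)
    have fst0: "fst (NE x (NE x v)) = 0" "fst (N2E x v) = 0"
      by (simp_all add: NE_fst N2E_fst fv endomorphism_0[OF N])
    show "vec (br (br q n1) n1 + br q n2) x = vec 0 x"
    proof (rule vec_eqI[OF D_V[OF x] vec_in[OF D_V[OF x]]])
      fix t assume t: "t < 2 * rk"
      have d: "E_frame A e t x \<in> E_fibre A x" by (rule E_frame_in[OF fr D_V[OF x] t])
      have "gcoeff (br (br q n1) n1) ({t}, {#}) x = E_pair (NE x (NE x v)) (E_frame A e t x)"
        using vec_pair[OF D_V[OF x] t, of "br (br q n1) n1"]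
          N.vec_br_quad[OF N.lin_br_quad[OF q(1)] x] N.vec_br_quad[OF q(1) x] by (simp add: v_def)
      moreover have "gcoeff (br q n2) ({t}, {#}) x = E_pair (N2E x v) (E_frame A e t x)"
        using vec_pair[OF D_V[OF x] t, of "br q n2"] N2.vec_br_quad[OF q(1) x] by (simp add: v_def)
      moreover have "E_pair (NE x (NE x v)) (E_frame A e t x) + E_pair (N2E x v) (E_frame A e t x) = 0"
        using snd0[of "fst (E_frame A e t x)"] d dual_at_0 by (auto simp: E_pair_def fst0 E_fibre_def)
      ultimately show "gcoeff (br (br q n1) n1 + br q n2) ({t}, {#}) x = E_pair (vec 0 x) (E_frame A e t x)"
        by (simp add: vec_pair[OF D_V[OF x] t])
    qed
  qed simp
  finally show ?thesis .
qed

abbreviation A_part :: "('m \<Rightarrow> real) gpoly \<Rightarrow> 'm \<Rightarrow> 'v" where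
  "A_part y x \<equiv> fst (vec y x)"

lemma A_part_add: "A_part (y + z) x = A_part y x + A_part z x"
  and A_part_minus: "A_part (y - z) x = A_part y x - A_part z x"
  and A_part_uminus: "A_part (- y) x = - A_part y x"
  by (simp_all add: fst_vec scaleR_left_distrib sum.distrib scaleR_left_diff_distrib sum_subtractf sum_negf)

lemma A_part_in: "x \<in> D \<Longrightarrow> A_part y x \<in> fibre A x"
  using vec_in[OF D_V, of x y] by (auto simp: E_fibre_def)

lemma A_part_br_n1: "lin y \<Longrightarrow> x \<in> D \<Longrightarrow> A_part (br n1 y) x = - N x (A_part y x)"
  by (simp add: N.br_quad_swap[of y] A_part_uminus N.vec_br_quad NE_fst)

lemma A_part_br_n2: "lin y \<Longrightarrow> x \<in> D \<Longrightarrow> A_part (br n2 y) x = - N x (N x (A_part y x))"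
  by (simp add: N2.br_quad_swap[of y] A_part_uminus N2.vec_br_quad N2E_fst)

lemma lin_derived:
  assumes "lin X" "lin Y" "homogeneous (\<lambda>_. 1) 2 3 v" "in_vars v"
  shows "lin (br (br X v) Y)"
  using assms homogeneous_br_degree[of 1 X 3 v] homogeneous_br_degree[of 2 "br X v" 1 Y] in_vars_br
  by (simp add: lin_def)

text \<open>A section of \<open>A\<close> is encoded as a section of \<open>E\<close> with vanishing second component.\<close>

lemma torsion_derived:
  assumes u: "u \<in> E_sections A" "\<And>z. snd (u z) = (\<lambda>_. 0)" and v: "v \<in> E_sections A" "\<And>z. snd (v z) = (\<lambda>_. 0)"
    and x: "x \<in> D"
  shows "A_part (br (br (pl (of_section A u)) T) (pl (of_section A v))) x = 0"
proof -
  define X where "X = pl (of_section A u)"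
  define Y where "Y = pl (of_section A v)"
  have gu: "good (of_section A u)" and gv: "good (of_section A v)" using u v good_of_section by blast+
  have SM [simp]: "X \<in> SM" "Y \<in> SM" using gu gv by (simp_all add: X_def Y_def)
  have lX: "lin X" and lY: "lin Y" using u v by (simp_all add: X_def Y_def lin_of_section)
  have sec: "(\<lambda>z. fst (w z)) \<in> sections A" if w: "w \<in> E_sections A" for w
  proof -
    have "fst (w x) \<in> fibre A x" for x
      using E_sections_D(1)[OF w, of x] unfolding E_fibre_def by (rule mem_Times_iff[THEN iffD1, THEN conjunct1])
    then show ?thesis using E_sections_D(2)[OF w] unfolding sections_def by auto
  qed
  have pair: "(\<lambda>z. (fst (w z), \<lambda>_. 0)) = w" if "\<And>z. snd (w z) = (\<lambda>_. 0)" for w :: "'m \<Rightarrow> 'v gvec"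
    by (rule ext, rule prod_eqI) (simp_all add: that)
  have ofA: "of_A_section A (\<lambda>z. fst (w z)) = of_section A w" if "\<And>z. snd (w z) = (\<lambda>_. 0)" for w :: "'m \<Rightarrow> 'v gvec"
    unfolding of_A_section_def pair[OF that] ..
  have NEz: "snd (NE z (w z)) = (\<lambda>_. 0)" if "\<And>z. snd (w z) = (\<lambda>_. 0)" for w :: "'m \<Rightarrow> 'v gvec" and z
    by (rule ext) (simp add: NE_snd that transp_def)
  have ofNA: "of_A_section A (\<lambda>z. N z (fst (w z))) = of_section A (\<lambda>z. NE z (w z))" if "\<And>z. snd (w z) = (\<lambda>_. 0)" for w
    using ofA[of "\<lambda>z. NE z (w z)"] NEz[of w] that by (simp add: NE_fst)
  define X1 where "X1 = br X n1"
  define Y1 where "Y1 = br Y n1"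
  have gN: "good (of_section A (\<lambda>z. NE z (u z)))" "good (of_section A (\<lambda>z. NE z (v z)))"
    using N.section_bracket_quad[OF u(1)] N.section_bracket_quad[OF v(1)] gu gv good_gfun_deg[OF N.quad_deg] by simp_all
  have X1: "pl (of_section A (\<lambda>z. NE z (u z))) = X1" and Y1: "pl (of_section A (\<lambda>z. NE z (v z))) = Y1"
    using N.section_bracket_quad[OF u(1)] N.section_bracket_quad[OF v(1)] gu gv good_gfun_deg[OF N.quad_deg]
    by (simp_all add: X1_def Y1_def X_def Y_def)
  have SM1 [simp]: "X1 \<in> SM" "Y1 \<in> SM" by (simp_all add: X1_def Y1_def)
  have l1: "lin X1" "lin Y1" by (simp_all add: X1_def Y1_def N.lin_br_quad lX lY)
  \<comment> \<open>On A the square of \<open>NE\<close> is \<open>N2E\<close>. On the dual they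
    differ in sign, so the vanishing second component is essential here.\<close>
  have sq: "br (br Z n1) n1 = br Z n2" if Z: "Z = pl (of_section A w)" "w \<in> E_sections A" "\<And>z. snd (w z) = (\<lambda>_. 0)" for Z w
  proof (rule lin_eqI)
    have lZ: "lin Z" using Z by (simp add: lin_of_section)
    have "Z \<in> SM" using Z good_of_section by simp
    then show "br (br Z n1) n1 \<in> SM" "br Z n2 \<in> SM" by simp_all
    show "lin (br (br Z n1) n1)" "lin (br Z n2)" by (intro N.lin_br_quad N2.lin_br_quad lZ)+
    fix x assume x: "x \<in> D"
    show "vec (br (br Z n1) n1) x = vec (br Z n2) x"
      unfolding N.vec_br_quad[OF N.lin_br_quad[OF lZ] x] N.vec_br_quad[OF lZ x] N2.vec_br_quad[OF lZ x]
        vec_of_section[OF Z(2) x, folded Z(1)]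
      by (rule prod_eqI) (auto simp: NE_fst N2E_fst NE_snd N2E_snd Z(3) transp_def)
  qed
  note d = gfun_deg_in_vars(2)[OF mu_deg] gfun_deg_in_vars(1)[OF mu_deg]
  define B where "B Z W = br (br Z m) W" for Z W
  have lB: "lin (B Z W)" if "lin Z" "lin W" for Z W
    unfolding B_def using d by (intro lin_derived that) simp_all
  have SMB [simp]: "B Z W \<in> SM" if "Z \<in> SM" "W \<in> SM" for Z W using that by (simp add: B_def)
  have lie: "lie_bracket A \<mu> c X' Y' x = A_part (B Z W) x"
    if "good (of_A_section A X')" "good (of_A_section A Y')" "pl (of_A_section A X') = Z" "pl (of_A_section A Y') = W" for X' Y' Z W
    unfolding lie_bracket_def fst_vec B_def that(3,4)[symmetric]
    by (simp add: big_bracket_gcoeff good_mu that(1,2))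
  have D1: "br (br Z (br n1 w)) W = br n1 (br (br Z w) W) + br (br (br Z n1) w) W + br (br Z w) (br W n1)"
    if "Z \<in> SM" "W \<in> SM" "w \<in> SM" for Z W w
    by (rule derived_bracket_even[OF N.quad_SM that N.quad_even N.quad_pfree])
  have D2: "br (br Z (br n2 w)) W = br n2 (br (br Z w) W) + br (br (br Z n2) w) W + br (br Z w) (br W n2)"
    if "Z \<in> SM" "W \<in> SM" "w \<in> SM" for Z W w
    by (rule derived_bracket_even[OF N2.quad_SM that N2.quad_even N2.quad_pfree])
  have B1: "br (br Z (br n1 m)) W = br n1 (B Z W) + B (br Z n1) W + B Z (br W n1)" if "Z \<in> SM" "W \<in> SM" for Z W
    using D1[OF that m_SM] by (simp add: B_def)
  \<comment> \<open>\<open>B1\<close> is the bracket deformed by N; using \<open>D1\<close> for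
    \<open>br n1 m\<close> deforms it once more, which gives nine terms.\<close>
  have E1: "br (br X (br n1 (br n1 m))) Y =
      br n1 (br n1 (B X Y) + B X1 Y + B X Y1) + (br n1 (B X1 Y) + B (br X1 n1) Y + B X1 Y1) + (br n1 (B X Y1) + B X1 Y1 + B X (br Y1 n1))"
    using D1[of X Y "br n1 m"] B1[of X Y] B1[of X1 Y] B1[of X Y1] by (simp add: X1_def[symmetric] Y1_def[symmetric])
  \<comment> \<open>By \<open>sq\<close> the terms with N^2 in an argument have the same form as in
    \<open>E1\<close>, so they cancel in the difference.\<close>
  have E2: "br (br X (br n2 m)) Y = br n2 (B X Y) + B (br X1 n1) Y + B X (br Y1 n1)"
    using D2[of X Y m] sq[OF X_def u] sq[OF Y_def v] by (simp add: B_def X1_def Y1_def)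
  have "br (br X T) Y = br (br X (br n1 (br n1 m))) Y - br (br X (br n2 m)) Y"
    by (simp add: T_def br_minus_right br_minus_left)
  then have "A_part (br (br X T) Y) x =
    A_part (br n1 (br n1 (B X Y) + B X1 Y + B X Y1)) x + A_part (br n1 (B X1 Y)) x + A_part (B X1 Y1) x + A_part (br n1 (B X Y1)) x + A_part (B X1 Y1) x - A_part (br n2 (B X Y)) x"
    unfolding E1 E2 by (simp add: A_part_add A_part_minus)
  also have "\<dots> = N x (N x (A_part (B X Y) x)) - N x (A_part (B X1 Y) x) - N x (A_part (B X Y1) x) - N x (A_part (B X1 Y) x) + A_part (B X1 Y1) x
      - N x (A_part (B X Y1) x) + A_part (B X1 Y1) x + N x (N x (A_part (B X Y) x))"
  proof -
    have l: "lin (B X Y)" "lin (B X1 Y)" "lin (B X Y1)" "lin (B X1 Y1)" using lX lY l1 by (auto intro: lB)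
    have ln: "lin (br n1 (B X Y))" using N.lin_br_quad[OF l(1)] by (simp add: N.br_quad_swap[of "B X Y"] lin_uminus)
    have "A_part (br n1 (br n1 (B X Y) + B X1 Y + B X Y1)) x = A_part (br n1 (br n1 (B X Y))) x + A_part (br n1 (B X1 Y)) x + A_part (br n1 (B X Y1)) x"
      by (simp add: br_add_right A_part_add)
    moreover have "N x (- N x (A_part (B X Y) x)) = - N x (N x (A_part (B X Y) x))"
      using endomorphism_D(3)[OF N endomorphism_D(1)[OF N A_part_in[OF x]], of "-1"] by simp
    ultimately show ?thesis by (simp add: A_part_br_n1[OF _ x] A_part_br_n2[OF _ x] l ln)
  qed
  also have "\<dots> = 2 *\<^sub>R (A_part (B X1 Y1) x - N x (A_part (B X1 Y) x + A_part (B X Y1) x - N x (A_part (B X Y) x)))"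
  proof -
    have "N x (a - b) = N x a - N x b" if "a \<in> fibre A x" "b \<in> fibre A x" for a b
      using endomorphism_D(2)[OF N that(1) fibre_scale[OF that(2), of "-1"]] endomorphism_D(3)[OF N that(2), of "-1"] by simp
    then show ?thesis
      using A_part_in[OF x] endomorphism_D(1)[OF N A_part_in[OF x]] by (simp add: endomorphism_D(2)[OF N] scaleR_2 algebra_simps)
  qed
  also have "A_part (B X1 Y1) x - N x (A_part (B X1 Y) x + A_part (B X Y1) x - N x (A_part (B X Y) x)) = 0"
  proof -
    have L: "lie_bracket A \<mu> c (\<lambda>z. N z (fst (u z))) (\<lambda>z. N z (fst (v z))) x = A_part (B X1 Y1) x"
      "lie_bracket A \<mu> c (\<lambda>z. N z (fst (u z))) (\<lambda>z. fst (v z)) x = A_part (B X1 Y) x"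
      "lie_bracket A \<mu> c (\<lambda>z. fst (u z)) (\<lambda>z. N z (fst (v z))) x = A_part (B X Y1) x"
      "lie_bracket A \<mu> c (\<lambda>z. fst (u z)) (\<lambda>z. fst (v z)) x = A_part (B X Y) x"
      by (rule lie; simp add: ofA[OF u(2)] ofA[OF v(2)] ofNA[OF u(2)] ofNA[OF v(2)] gu gv gN X1 Y1 X_def Y_def)+
    have "x \<in> coord_dom c" using x by simp
    from nij[unfolded nijenhuis_tensor_def, rule_format, OF sec[OF u(1)] sec[OF v(1)] c_in this]
    show ?thesis unfolding Let_def L .
  qed
  finally show ?thesis by (simp add: X_def Y_def)
qed

text \<open>As \<open>T\<close> is free of \<open>p\<close>, its derived bracket at \<open>x\<close>
  depends only on the values of the sections at \<open>x\<close>. Cut-off frame elements therefore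
  suffice, and they read off the coefficient up to sign.\<close>

lemma T_torsion_coeff:
  assumes ab: "\<alpha> < rk" "\<beta> < rk" "\<alpha> \<noteq> \<beta>" and \<gamma>: "\<gamma> < rk" and x: "x \<in> D"
  shows "gcoeff T ({\<alpha>, \<beta>, rk + \<gamma>}, {#}) x = 0"
proof -
  have DU: "D \<subseteq> U" by (auto simp: D_def)
  obtain g K where g: "closed K" "K \<subseteq> D" "\<And>z. z \<notin> K \<Longrightarrow> g z = 0" "g x = 1" "smooth_on_base A UNIV g"
    using bump[OF ch open_D DU x] by metis
  have KV: "K \<subseteq> V" using g(2) D_V by blast
  have G: "glob s g \<in> E_sections A" "snd (glob s g z) = (\<lambda>_. 0)" if "s < rk" for s z
    using glob_E_sections[OF g(5,1) KV g(3), of s] that by (auto simp: glob_def E_frame_def zero_fun_def)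
  define X where "X = pl (of_section A (glob \<alpha> g))"
  define Y where "Y = pl (of_section A (glob \<beta> g))"
  have SM [simp]: "X \<in> SM" "Y \<in> SM" using G good_of_section ab by (simp_all add: X_def Y_def)
  have lX: "lin X" and lY: "lin Y" using G ab by (simp_all add: X_def Y_def lin_of_section)
  have val: "gcoeff (pl (of_section A (glob s g))) ({t}, {#}) x = (if t = dual rk s then 1 else 0)"
    if "s < rk" "t < 2 * rk" for s t
  proof -
    have "gcoeff (pl (of_section A (glob s g))) ({t}, {#}) x = E_pair (glob s g x) (E_frame A e t x)"
      using vec_pair[OF D_V[OF x] that(2), of "pl (of_section A (glob s g))"] vec_of_section[OF G(1)[OF that(1)] x]
      by simp
    then show ?thesis using glob_pair[OF D_V[OF x] _ that(2), of s g] that(1) g(4) by simp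
  qed
  define w where "w = br X T"
  \<comment> \<open>At \<open>x\<close> the section is the frame element \<open>\<alpha>\<close>,
    whose generator is dual to \<open>\<tau>^\<alpha>\<close>, so bracketing with it is the left
    derivative along \<open>\<tau>^\<alpha>\<close>.\<close>
  have w: "gcoeff w (S, K) x = gcoeff (lder \<alpha> T) (S, K) x" if "finite S" for S K
  proof -
    have "gcoeff w (S, K) x = (\<Sum>s<2*rk. gcoeff X ({s}, {#}) x * gcoeff (lder (dual rk s) T) (S, K) x)"
      unfolding w_def by (simp add: br_linear_pfree[OF lX T_pfree that] sum_apply)
    also have "\<dots> = (\<Sum>s<2*rk. if s = dual rk \<alpha> then gcoeff (lder (dual rk s) T) (S, K) x else 0)"
      using val[OF ab(1)] by (intro sum.cong refl) (simp add: X_def)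
    finally show ?thesis using ab(1) dual_less[of \<alpha> rk] dual_dual[of \<alpha> rk] by simp
  qed
  have "homogeneous (\<lambda>_. 1) 2 (int 2) w"
    using homogeneous_br_degree[of 1 X 3 T] lX T_degree by (simp add: w_def lin_def)
  then have we: "parity w = w" using parity_homogeneous[of 2 w] by simp
  have wp: "pder i w = 0" for i
    by (simp add: w_def pder_br T_pfree lin_pder[OF lX])
  have "gcoeff (br w Y) ({rk + \<gamma>}, {#}) x = - gcoeff (br Y w) ({rk + \<gamma>}, {#}) x"
    using br_even_swap[OF _ we, of Y] by (simp add: w_def)
  also have "gcoeff (br Y w) ({rk + \<gamma>}, {#}) x = (\<Sum>s<2*rk. gcoeff Y ({s}, {#}) x * gcoeff (lder (dual rk s) w) ({rk + \<gamma>}, {#}) x)"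
    by (simp add: br_linear_pfree[OF lY wp] sum_apply)
  also have "\<dots> = (\<Sum>s<2*rk. if s = dual rk \<beta> then gcoeff (lder (dual rk s) w) ({rk + \<gamma>}, {#}) x else 0)"
    using val[OF ab(2)] by (intro sum.cong refl) (simp add: Y_def)
  also have "\<dots> = gcoeff (lder \<beta> w) ({rk + \<gamma>}, {#}) x"
    using ab(2) dual_less[of \<beta> rk] dual_dual[of \<beta> rk] by simp
  also have "\<dots> = (sg {\<beta>} {rk + \<gamma>} * sg {\<alpha>} {\<beta>, rk + \<gamma>} :: 'm \<Rightarrow> real) x * gcoeff T ({\<alpha>, \<beta>, rk + \<gamma>}, {#}) x"
    using ab by (simp add: gcoeff_lder w)
  finally have "gcoeff (br w Y) ({rk + \<gamma>}, {#}) x =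
    - ((sg {\<beta>} {rk + \<gamma>} * sg {\<alpha>} {\<beta>, rk + \<gamma>} :: 'm \<Rightarrow> real) x * gcoeff T ({\<alpha>, \<beta>, rk + \<gamma>}, {#}) x)" .
  moreover have "gcoeff (br w Y) ({rk + \<gamma>}, {#}) x = 0"
  proof -
    have "A_part (br w Y) x = 0"
      using torsion_derived[OF G(1)[OF ab(1)] G(2)[OF ab(1)] G(1)[OF ab(2)] G(2)[OF ab(2)] x] by (simp add: w_def X_def Y_def)
    then show ?thesis
      using vec_pair[OF D_V[OF x], of "rk + \<gamma>" "br w Y"] E_pair_frame[OF vec_in[OF D_V[OF x]] D_V[OF x], of "br w Y" "rk + \<gamma>"] \<gamma>
      by (simp add: coframe_zero[OF fr D_V[OF x]])
  qed
  ultimately show ?thesis by (simp add: sg_apply gsign_def)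
qed

text \<open>No \<open>p\<close>, degree 3 and exactly one momentum leave the monomials with two
  \<tau> and one \<theta>, which are those covered by \<open>T_torsion_coeff\<close>.\<close>

lemma T_zero: "T = 0"
proof (rule gpoly_eqI, rule ccontr)
  fix S :: "nat set" and K :: "nat multiset"
  assume S: "finite S" and "gcoeff T (S, K) \<noteq> gcoeff 0 (S, K)"
  then have nz: "gcoeff T (S, K) \<noteq> 0" by simp
  then obtain x where x: "gcoeff T (S, K) x \<noteq> 0" using nonzero_point by blast
  have xD: "x \<in> D" using SM_outside[OF T_SM] x by blast
  have K: "K = {#}"
  proof (rule ccontr)
    assume "K \<noteq> {#}"
    then obtain i K' where Ki: "K = add_mset i K'" by (metis multiset_cases)
    have "gcoeff (pder i T) (S, K') x = real (count K' i + 1) * gcoeff T (S, K) x"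
      by (simp add: gcoeff_pder Ki)
    then show False using x by (simp add: T_pfree)
  qed
  have c3: "card S = 3" using homogeneous_degree[of 3 T S K] T_degree nz K by simp
  have sub: "S \<subseteq> {..<2 * rk}" using in_vars_D[OF T_vars nz] by blast
  have "sum momentum_weight S = 1" using homogeneous_D[OF T_weight nz] K by simp
  moreover have "sum momentum_weight S = int (card (S - {..<rk}))"
  proof -
    have "sum momentum_weight S = sum momentum_weight (S \<inter> {..<rk}) + sum momentum_weight (S - {..<rk})" using S by (rule sum.Int_Diff)
    also have "sum momentum_weight (S \<inter> {..<rk}) = 0" by (rule sum.neutral) (simp add: momentum_weight_def)
    also have "sum momentum_weight (S - {..<rk}) = (\<Sum>s\<in>S - {..<rk}. 1)" by (rule sum.cong) (simp_all add: momentum_weight_def)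
    finally show ?thesis by simp
  qed
  ultimately have c1: "card (S - {..<rk}) = 1" by simp
  then obtain t where t: "S - {..<rk} = {t}" by (metis card_1_singletonE)
  have "card (S \<inter> {..<rk}) = 2"
    using c1 c3 card_Int_Diff[OF S, of "{..<rk}"] by simp
  then obtain \<alpha> \<beta> where ab: "S \<inter> {..<rk} = {\<alpha>, \<beta>}" "\<alpha> \<noteq> \<beta>" by (auto simp: card_2_iff)
  have "S = (S \<inter> {..<rk}) \<union> (S - {..<rk})" by blast
  then have S': "S = {\<alpha>, \<beta>, t}" using ab t by auto
  have "t \<in> S - {..<rk}" "\<alpha> \<in> S \<inter> {..<rk}" "\<beta> \<in> S \<inter> {..<rk}" unfolding ab(1) t by simp_all
  moreover have "t < 2 * rk" using sub S' by blast
  ultimately have "rk \<le> t" "t < 2 * rk" "\<alpha> < rk" "\<beta> < rk" by simp_all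
  then have "gcoeff T (S, K) x = 0"
    using T_torsion_coeff[of \<alpha> \<beta> "t - rk" x] ab(2) xD S' K by simp
  then show False using x by simp
qed

text \<open>Both \<open>m\<close> and \<open>br n2 m\<close> are odd, so their bracket is symmetric,
  and the two terms that Jacobi produces from \<open>br m m = 0\<close> coincide.\<close>

lemma bracket_mu_N2: "br m (br n2 m) = 0"
proof -
  have "br n2 (br m m) = br (br n2 m) m + br m (br n2 m)"
    by (rule br_jacobi_even) (simp_all add: N2.quad_even N2.quad_pfree)
  moreover have "parity (br n2 m) = - br n2 m"
    by (simp add: parity_br N2.quad_even m_odd br_uminus_right)
  then have "br (br n2 m) m = br m (br n2 m)"
    by (intro br_odd_swap) (simp_all add: m_odd)
  ultimately have z: "br m (br n2 m) + br m (br n2 m) = 0" by (simp add: m_m)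
  \<comment> \<open>Twice the element is 0; the halving takes place in the real values of the
    coefficients.\<close>
  show ?thesis
  proof (rule gpoly_eqI, rule ext)
    fix S :: "nat set" and K :: "nat multiset" and x
    have "gcoeff (br m (br n2 m)) (S, K) x + gcoeff (br m (br n2 m)) (S, K) x = 0"
      using arg_cong[OF z, of "\<lambda>p. gcoeff p (S, K) x"] by simp
    then show "gcoeff (br m (br n2 m)) (S, K) x = gcoeff 0 (S, K) x" by simp
  qed
qed

section \<open>The deforming condition in one coordinate system\<close>

lemma weak_deforming_local:
  assumes p: "p \<in> SM" "parity p = p" and poisson: "br (br p m) p = 0"
    and C: "br p (br n1 m) + br n1 (br p m) = 0"
  shows "br m (br (br (n1 + p) m) (n1 + p)) = 0"
proof -
  have "br (br (n1 + p) m) (n1 + p) = br (br n1 m) n1 + br (br n1 m) p + (br (br p m) n1 + br (br p m) p)"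
    using p by (simp add: br_add_left br_add_right add.assoc add.left_commute)
  also have "br (br n1 m) p = - br p (br n1 m)" using br_even_swap[OF p, of "br n1 m"] by simp
  also have "br (br p m) n1 = - br n1 (br p m)" using N.br_quad_swap[of "br p m"] by simp
  also have "br (br n1 m) n1 + - br p (br n1 m) + (- br n1 (br p m) + br (br p m) p) =
      br (br n1 m) n1 - (br p (br n1 m) + br n1 (br p m)) + br (br p m) p"
    by (simp add: algebra_simps)
  also have "\<dots> = br (br n1 m) n1" by (simp add: C poisson)
  also have "\<dots> = - br n1 (br n1 m)" using N.br_quad_swap[of "br n1 m"] by simp
  also have "\<dots> = - br n2 m" using T_zero by (simp add: T_def)
  finally show ?thesis by (simp add: br_uminus_right bracket_mu_N2)
qed

end

section \<open>The theorem\<close>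

text \<open>Serves rank 0, where nothing is known about the value of \<open>tilde\<close>; hence
  there is no condition on \<open>b\<close>.\<close>

lemma big_bracket_gzero_left:
  fixes A :: "('m, 'v) vbundle"
  shows "big_bracket A gzero b = gzero"
proof -
  have "Defs.dx c i (\<lambda>x. 0) x = 0" for c :: "('m, 'v) coords" and i x
    by (simp add: Defs.dx_def pderiv_at_def comp_def split: prod.split)
  moreover have "dp i (\<lambda>_. 0) = (\<lambda>_. 0)" "dright i (\<lambda>_. 0) = (\<lambda>_. 0)" for i
    by (auto simp: dp_def dright_def)
  moreover have "gmult (\<lambda>_. 0) f m = 0" for f m
    by (simp add: gmult_def split: prod.split)
  ultimately show ?thesis
    unfolding big_bracket_def gzero_def Let_def by (intro ext) simp
qed

theorem proposition4p15:
  fixes A :: "('m::{t2_space, second_countable_topology}, 'v::real_vector) vbundle"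
    and \<mu> :: "('m, 'v) gfun"
    and N :: "'m \<Rightarrow> 'v \<Rightarrow> 'v"
    and \<pi> :: "'m \<Rightarrow> ('v \<Rightarrow> real) \<Rightarrow> 'v"
  assumes "vector_bundle A"
    and "lie_algebroid A \<mu>"
    and "endomorphism A N"
    and "bivector A \<pi>"
    and "intertwined A \<pi> N"
    and "PN_structure A \<mu> \<pi> N"
  shows "weak_deforming_tensor A \<mu> (block_endo A N \<pi>)"
proof -
  interpret vbundle_ctx A by unfold_locales (rule assms(1))
  note N = assms(3) and \<pi> = assms(4)
  have mu3: "\<mu> \<in> gfun_deg A 3" and mu_mu: "big_bracket A \<mu> \<mu> = gzero"
    using assms(2) unfolding lie_algebroid_def by blast+
  have nij: "nijenhuis_tensor A \<mu> N" and poisson: "poisson_bivector A \<mu> \<pi>" and C: "C_concomitant A \<mu> \<pi> N = gzero"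
    using assms(6) unfolding PN_structure_def by blast+
  interpret E: skew_ctx A "block_endo A N \<pi>"
    by unfold_locales (rule block_endo_skew[OF N \<pi>])
  interpret P: skew_ctx A "block_endo A (\<lambda>x v. 0) \<pi>"
    by unfold_locales (rule block_endo_skew[OF endomorphism_zero \<pi>])
  interpret N: skew_ctx A "block_endo A N (\<lambda>x \<xi>. 0)"
    by unfold_locales (rule block_endo_skew[OF N bivector_zero])
  have "big_bracket A \<mu> (big_bracket A (big_bracket A (tilde A (block_endo A N \<pi>)) \<mu>) (tilde A (block_endo A N \<pi>))) = gzero"
  proof (cases "rk = 0")
    case True
    have "\<mu> c (S, K) x = 0" for c S K x
    proof (rule ccontr)
      assume "\<mu> c (S, K) x \<noteq> 0"
      \<comment> \<open>Without odd generators every degree is even.\<close>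
      from gfun_deg_support(3,5)[OF mu3 this] have "2 * size K = 3" by (simp add: True mono_deg_def)
      then show False by presburger
    qed
    then have "\<mu> = gzero" unfolding gzero_def by (intro ext) (metis surj_pair)
    then show ?thesis by (simp add: big_bracket_gzero_left)
  next
    case False
    then have rk: "rk > 0" by simp
    show ?thesis
    proof (intro ext)
      fix c :: "('m, 'v) coords" and m x
      show "big_bracket A \<mu> (big_bracket A (big_bracket A (tilde A (block_endo A N \<pi>)) \<mu>) (tilde A (block_endo A N \<pi>))) c m x = gzero c m x"
      proof (cases "c \<in> coord_systems A \<and> x \<in> coord_dom c")
        case False
        then show ?thesis by (auto simp: big_bracket_def gzero_def)
      next
        case True
        obtain U \<phi> V e where ce: "c = ((U, \<phi>), (V, e))" by (metis surj_pair)
        have mem: "(U, \<phi>) \<in> charts A" "(V, e) \<in> frames A"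
          using True by (auto simp: ce coord_systems_def)
        interpret loc: nijenhuis_ctx A U \<phi> V e \<mu> N
          using mem assms(2) N nij by unfold_locales
        interpret Pl: coord_skew A U \<phi> V e "block_endo A (\<lambda>x v. 0) \<pi>" by unfold_locales
        interpret El: coord_skew A U \<phi> V e "block_endo A N \<pi>" by unfold_locales
        have cc: "loc.c = c" by (simp add: loc.c_def ce)
        have good: "loc.good N.quad" "loc.good P.quad" "loc.good E.quad" "loc.good \<mu>"
          by (rule loc.good_gfun_deg, rule N.quad_deg P.quad_deg E.quad_deg mu3)+
        \<comment> \<open>Additivity of the quadratic functions is seen on the matrix entries in the
          induced frame, where each of the three block endomorphisms has an explicit
          formula.\<close>
        have sum: "loc.pl E.quad = loc.pl N.quad + loc.pl P.quad"
        proof (rule gpoly_eqI, rule ext)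
          fix S :: "nat set" and K :: "nat multiset" and x
          have "E.quad loc.c (S, K) x = N.quad loc.c (S, K) x + P.quad loc.c (S, K) x"
          proof (cases "x \<in> loc.D \<and> (\<exists>j t. j < t \<and> t < 2 * rk \<and> (S, K) = ({j, t}, {#}))")
            case True
            then obtain j t where h: "j < t" "t < 2 * rk" "(S, K) = ({j, t}, {#})" by blast
            have x: "x \<in> coord_dom loc.c" "x \<in> V" "j < 2 * rk" using True loc.D_V h by auto
            show ?thesis
              unfolding h(3) E.quad_pair[OF loc.c_in x(1) h(1,2)] P.quad_pair[OF loc.c_in x(1) h(1,2)]
                N.quad_pair[OF loc.c_in x(1) h(1,2)] loc.c_frame
                block_endo_pair_frame[OF N \<pi> mem(2) x(2,3) h(2)]
                block_endo_pair_frame[OF N bivector_zero mem(2) x(2,3) h(2)]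
                block_endo_pair_frame[OF endomorphism_zero \<pi> mem(2) x(2,3) h(2)]
              using coframe_zero[OF mem(2) x(2)] by simp
          next
            case False
            then have "E.quad loc.c (S, K) x = 0" "N.quad loc.c (S, K) x = 0" "P.quad loc.c (S, K) x = 0"
              by (auto simp: E.quad_def N.quad_def P.quad_def)
            then show ?thesis by simp
          qed
          then show "gcoeff (loc.pl E.quad) (S, K) x = gcoeff (loc.pl N.quad + loc.pl P.quad) (S, K) x"
            by (simp add: loc.gcoeff_pl good)
        qed
        have "big_bracket A (big_bracket A P.quad \<mu>) P.quad = gzero"
          using poisson unfolding poisson_bivector_def bivector_gfun_def P.tilde_quad[OF rk] .
        from arg_cong[OF this, of loc.pl]
        have poi: "loc.br (loc.br (loc.pl P.quad) (loc.pl \<mu>)) (loc.pl P.quad) = 0"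
          by (simp add: good)
        have "gadd (big_bracket A P.quad (big_bracket A N.quad \<mu>)) (big_bracket A N.quad (big_bracket A P.quad \<mu>)) = gzero"
          using C unfolding C_concomitant_def bivector_gfun_def endo_gfun_def P.tilde_quad[OF rk] N.tilde_quad[OF rk] .
        from arg_cong[OF this, of loc.pl]
        have com: "loc.br (loc.pl P.quad) (loc.br (loc.pl N.quad) (loc.pl \<mu>)) +
            loc.br (loc.pl N.quad) (loc.br (loc.pl P.quad) (loc.pl \<mu>)) = 0"
          by (simp add: good)
        have "loc.br (loc.pl \<mu>) (loc.br (loc.br (loc.pl E.quad) (loc.pl \<mu>)) (loc.pl E.quad)) = 0"
          unfolding sum by (rule loc.weak_deforming_local[OF Pl.quad_SM Pl.quad_even poi com])
        then have "big_bracket A \<mu> (big_bracket A (big_bracket A E.quad \<mu>) E.quad) loc.c m = 0"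
          by (subst loc.big_bracket_gcoeff) (simp_all add: good)
        then show ?thesis
          unfolding E.tilde_quad[OF rk] by (simp add: cc gzero_def)
      qed
    qed
  qed
  then show ?thesis
    using mu3 mu_mu E.skew unfolding weak_deforming_tensor_def courant_structure_def by blast
qed

end
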